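(* Assume the hypotheses of Theorem 3.1(b) (stated in the context) and, in addition, that $\mathbf Y_0\overset{d}{=}\mathbf U^{(0)}$. Then $(\mathbf Y_t)_{t\ge0}$ and $(V_t)_{t\ge0}$ are strictly periodically stationary with period $\tau$: for all $n\in\mathbb{N}$, $s_1,\dots,s_n\ge0$, Borel sets $\mathbf E_1,\dots,\mathbf E_n\subseteq\mathbb{R}^q$, Borel sets $J_1,\dots,J_n\subseteq\mathbb{R}$ and $k\in\mathbb{N}$, $$P(\mathbf Y_{s_1}\in\mathbf E_1,\dots,\mathbf Y_{s_n}\in\mathbf E_n)=P(\mathbf Y_{s_1+k\tau}\in\mathbf E_1,\dots,\mathbf Y_{s_n+k\tau}\in\mathbf E_n),$$ $$P(V_{s_1}\in J_1,\dots,V_{s_n}\in J_n)=P(V_{s_1+k\tau}\in J_1,\dots,V_{s_n+k\tau}\in J_n).$$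
   Context: Setup (simple semi-Lévy process). Fix $\tau>0$, $l\in\mathbb{N}$ and a partition $0=t_0<t_1<t_2<\cdots$ of $[0,\infty)$ with $t_n\to\infty$; put $A_j=[t_{j-1},t_j)$ and assume $|A_{j+l}|=|A_j|$ for all $j$ and $\tau=\sum_{j=1}^l|A_j|$. For $j=1,\dots,l$ let $\mathfrak D_j=\bigcup_{k\ge0}A_{j+kl}$, and for $s\ge0$ let $j(s)$ be the unique $j$ with $s\in\mathfrak D_j$. Let $\lambda\ge0$ be locally integrable and $\tau$-periodic, $\Lambda(t)=\int_0^t\lambda(u)du$, and $N$ a Poisson process with independent increments, $N(t)-N(s)\sim\mathrm{Poisson}(\Lambda(t)-\Lambda(s))$; $\Upsilon_n$ its $n$-th arrival time, $\Upsilon_0=0$. Let $F_1,\dots,F_l$ be distributions on $\mathbb{R}$ with finite second moments; $(Z_n^j)$ independent, independent of $N$, $Z_n^j\sim F_j$, and $Z_n=\sum_{j=1}^lZ_n^j\mathbf 1_{\{\Upsilon_n\in\mathfrak D_j\}}$. Let $D$ be a deterministic continuous $\tau$-periodic function of finite variation with $D_0=0$, and $S_t=D_t+\sum_{n=1}^{N(t)}Z_n$; its local Lévy measure is $\nu_s(dz)=\lambda(s)F_{j(s)}(dz)$ and $[S,S]_t=\sum_{n=1}^{N(t)}Z_n^2$. Setup (SS-COGARCH). Let $q\ge p\ge1$, $\alpha_0>0$, $\alpha_1,\dots,\alpha_p,\beta_1,\dots,\beta_q\in\mathbb{R}$ with $\alpha_p\ne0$, $\beta_q\ne0$, $\alpha_{p+1}=\dots=\alpha_q=0$.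 Let $B$ be the $q\times q$ companion matrix with ones on the superdiagonal, last row $(-\beta_q,-\beta_{q-1},\dots,-\beta_1)$ and zeros elsewhere; $\mathbf a=(\alpha_1,\dots,\alpha_q)'$, $\mathbf e=(0,\dots,0,1)'$. The state process $\mathbf Y$ is the càdlàg solution of $d\mathbf Y_t=B\mathbf Y_{t-}dt+\mathbf e(\alpha_0+\mathbf a'\mathbf Y_{t-})d[S,S]_t$, with $\mathbf Y_0$ $\mathcal F_0$-measurable and independent of $S$; the volatility is $V_t=\alpha_0+\mathbf a'\mathbf Y_{t-}$ ($t>0$), $V_0=\alpha_0+\mathbf a'\mathbf Y_0$; and $G_t=\int_0^t\sqrt{V_u}\,dS_u$. Definition of $\mathfrak J,\mathfrak K$. Put $Q_n=(I+Z_n^2\mathbf e\mathbf a')e^{B(\Upsilon_n-\Upsilon_{n-1})}$ and $R_n=\alpha_0Z_n^2\mathbf e$. For $0\le s\le t$: if $N(t)=N(s)$, $\mathfrak J_{s,t}=e^{B(t-s)}$ and $\mathfrak K_{s,t}=0$; otherwise $\mathfrak J_{s,t}=e^{B(t-\Upsilon_{N(t)})}Q_{N(t)}\cdots Q_{N(s)+2}(I+Z_{N(s)+1}^2\mathbf e\mathbf a')e^{B(\Upsilon_{N(s)+1}-s)}$ and $\mathfrak K_{s,t}=e^{B(t-\Upsilon_{N(t)})}\big(R_{N(t)}+Q_{N(t)}R_{N(t)-1}+\cdots+Q_{N(t)}\cdots Q_{N(s)+2}R_{N(s)+1}\big)$. Hypotheses of Theorem 3.1(b): $B$ is invertible and diagonalizable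 with all eigenvalues $\eta_1,\dots,\eta_q$ having strictly negative real parts; $P$ is invertible with $P^{-1}BP$ diagonal; $\eta=\max_i\mathrm{Re}\,\eta_i$; and for some $r\in[1,\infty]$, $\int_{\mathbb{R}}\log(1+\|P^{-1}\mathbf e\mathbf a'P\|_rz^2)\nu_t(dz)<-\nu_t(\mathbb{R})\eta\tau/(\Lambda(t+\tau)-\Lambda(t))$ for all $t\in[0,\tau)$, where $\|C\|_r$ is the operator norm induced by the $\ell^r$ norm on $\mathbb{C}^q$. Under these hypotheses $\mathbf U^{(0)}$ denotes the random vector whose law is the unique solution of $\mathbf U^{(0)}\overset{d}{=}\mathfrak J_{0,\tau}\mathbf U^{(0)}+\mathfrak K_{0,\tau}$ with $\mathbf U^{(0)}$ independent of $(\mathfrak J_{0,\tau},\mathfrak K_{0,\tau})$ (the limit in distribution of $\mathbf Y_{m\tau}$). *)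

theory Defs
  imports "HOL-Probability.Probability" "Jordan_Normal_Form.Matrix" "Jordan_Normal_Form.Char_Poly"
begin

definition blk :: "(nat \<Rightarrow> real) \<Rightarrow> nat \<Rightarrow> real set" where
  "blk tp n = {tp (n - 1)..<tp n}"

definition Dset :: "(nat \<Rightarrow> real) \<Rightarrow> nat \<Rightarrow> nat \<Rightarrow> real set" where
  "Dset tp l j = (\<Union>k. blk tp (j + k * l))"

definition jidx :: "(nat \<Rightarrow> real) \<Rightarrow> nat \<Rightarrow> real \<Rightarrow> nat" where
  "jidx tp l s = (THE j. j \<in> {1..l} \<and> s \<in> Dset tp l j)"

definition Lam :: "(real \<Rightarrow> real) \<Rightarrow> real \<Rightarrow> real" where
  "Lam lam t = (LINT u:{0..t}|lborel. lam u)"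

definition nu :: "(real \<Rightarrow> real) \<Rightarrow> (nat \<Rightarrow> real measure) \<Rightarrow> (nat \<Rightarrow> real) \<Rightarrow> nat \<Rightarrow> real \<Rightarrow> real measure" where
  "nu lam F tp l s = scale_measure (ennreal (lam s)) (F (jidx tp l s))"

definition arrival :: "(real \<Rightarrow> 'a \<Rightarrow> nat) \<Rightarrow> nat \<Rightarrow> 'a \<Rightarrow> real" where
  "arrival N n \<omega> = Inf {u. 0 \<le> u \<and> n \<le> N u \<omega>}"

text \<open>Mark Z_n = sum_j Z_n^j 1{Upsilon_n in D_j}.\<close>
definition mark :: "(nat \<Rightarrow> real) \<Rightarrow> nat \<Rightarrow> (nat \<Rightarrow> nat \<Rightarrow> 'a \<Rightarrow> real) \<Rightarrow> (real \<Rightarrow> 'a \<Rightarrow> nat) \<Rightarrow> nat \<Rightarrow> 'a \<Rightarrow> real" where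
  "mark tp l Z N n \<omega> = Z n (jidx tp l (arrival N n \<omega>)) \<omega>"

definition Sproc :: "(real \<Rightarrow> real) \<Rightarrow> (nat \<Rightarrow> real) \<Rightarrow> nat \<Rightarrow> (nat \<Rightarrow> nat \<Rightarrow> 'a \<Rightarrow> real) \<Rightarrow> (real \<Rightarrow> 'a \<Rightarrow> nat) \<Rightarrow> real \<Rightarrow> 'a \<Rightarrow> real" where
  "Sproc D tp l Z N s \<omega> = D s + (\<Sum>n = 1..N s \<omega>. mark tp l Z N n \<omega>)"

definition loc_bounded_variation :: "(real \<Rightarrow> real) \<Rightarrow> bool" where
  "loc_bounded_variation f = (\<forall>a b. 0 \<le> a \<longrightarrow> (\<exists>C. \<forall>xs :: real list. sorted xs \<and> set xs \<subseteq> {a..b} \<longrightarrow>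
      (\<Sum>i < length xs - 1. \<bar>f (xs ! Suc i) - f (xs ! i)\<bar>) \<le> C))"

text \<open>Companion matrix B (0-based indices): superdiagonal ones, last row (-beta_q,...,-beta_1).\<close>
definition Bmat :: "nat \<Rightarrow> (nat \<Rightarrow> real) \<Rightarrow> real mat" where
  "Bmat q \<beta> = mat q q (\<lambda>(i, j). if i = q - 1 then - \<beta> (q - j) else if j = Suc i then 1 else 0)"

definition avec :: "nat \<Rightarrow> (nat \<Rightarrow> real) \<Rightarrow> real vec" where
  "avec q \<alpha> = vec q (\<lambda>j. \<alpha> (Suc j))"

definition evec :: "nat \<Rightarrow> real vec" where
  "evec q = unit_vec q (q - 1)"

definition EAmat :: "nat \<Rightarrow> (nat \<Rightarrow> real) \<Rightarrow> real mat" where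
  "EAmat q \<alpha> = mat q q (\<lambda>(i, j). evec q $ i * avec q \<alpha> $ j)"

definition mexp :: "nat \<Rightarrow> real mat \<Rightarrow> real mat" where
  "mexp q A = mat q q (\<lambda>(i, j). \<Sum>k. (A ^\<^sub>m k) $$ (i, j) / fact k)"

text \<open>Factor (I + Z_n^2 e a') e^(B(Upsilon_n - prev)), prev = s for the first jump after s.\<close>
definition cfac :: "nat \<Rightarrow> (nat \<Rightarrow> real) \<Rightarrow> (nat \<Rightarrow> real) \<Rightarrow> nat \<Rightarrow> real \<Rightarrow> (nat \<Rightarrow> real) \<Rightarrow> (nat \<Rightarrow> real) \<Rightarrow> nat \<Rightarrow> real mat" where
  "cfac q \<alpha> \<beta> Ns s Ups Zm n =
     (1\<^sub>m q + ((Zm n)\<^sup>2 \<cdot>\<^sub>m EAmat q \<alpha>)) *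
     mexp q ((Ups n - (if n = Suc Ns then s else Ups (n - 1))) \<cdot>\<^sub>m Bmat q \<beta>)"

fun pJ :: "nat \<Rightarrow> (nat \<Rightarrow> real) \<Rightarrow> (nat \<Rightarrow> real) \<Rightarrow> nat \<Rightarrow> real \<Rightarrow> (nat \<Rightarrow> real) \<Rightarrow> (nat \<Rightarrow> real) \<Rightarrow> nat \<Rightarrow> real mat" where
  "pJ q \<alpha> \<beta> Ns s Ups Zm 0 = 1\<^sub>m q"
| "pJ q \<alpha> \<beta> Ns s Ups Zm (Suc k) = cfac q \<alpha> \<beta> Ns s Ups Zm (Ns + Suc k) * pJ q \<alpha> \<beta> Ns s Ups Zm k"

fun pK :: "nat \<Rightarrow> real \<Rightarrow> (nat \<Rightarrow> real) \<Rightarrow> (nat \<Rightarrow> real) \<Rightarrow> nat \<Rightarrow> real \<Rightarrow> (nat \<Rightarrow> real) \<Rightarrow> (nat \<Rightarrow> real) \<Rightarrow> nat \<Rightarrow> real vec" where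
  "pK q \<alpha>0 \<alpha> \<beta> Ns s Ups Zm 0 = 0\<^sub>v q"
| "pK q \<alpha>0 \<alpha> \<beta> Ns s Ups Zm (Suc k) =
     cfac q \<alpha> \<beta> Ns s Ups Zm (Ns + Suc k) *\<^sub>v pK q \<alpha>0 \<alpha> \<beta> Ns s Ups Zm k
     + (\<alpha>0 * (Zm (Ns + Suc k))\<^sup>2) \<cdot>\<^sub>v evec q"

text \<open>J_(s,t) and K_(s,t), pathwise: Npath is the path of N, Ups the arrival times, Zm the marks.\<close>
definition lastjump :: "(real \<Rightarrow> nat) \<Rightarrow> (nat \<Rightarrow> real) \<Rightarrow> real \<Rightarrow> real \<Rightarrow> real" where
  "lastjump Npath Ups s t = (if Npath t = Npath s then s else Ups (Npath t))"

definition Jst :: "nat \<Rightarrow> (nat \<Rightarrow> real) \<Rightarrow> (nat \<Rightarrow> real) \<Rightarrow> (real \<Rightarrow> nat) \<Rightarrow> (nat \<Rightarrow> real) \<Rightarrow> (nat \<Rightarrow> real) \<Rightarrow> real \<Rightarrow> real \<Rightarrow> real mat" where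
  "Jst q \<alpha> \<beta> Npath Ups Zm s t =
     mexp q ((t - lastjump Npath Ups s t) \<cdot>\<^sub>m Bmat q \<beta>) * pJ q \<alpha> \<beta> (Npath s) s Ups Zm (Npath t - Npath s)"

definition Kst :: "nat \<Rightarrow> real \<Rightarrow> (nat \<Rightarrow> real) \<Rightarrow> (nat \<Rightarrow> real) \<Rightarrow> (real \<Rightarrow> nat) \<Rightarrow> (nat \<Rightarrow> real) \<Rightarrow> (nat \<Rightarrow> real) \<Rightarrow> real \<Rightarrow> real \<Rightarrow> real vec" where
  "Kst q \<alpha>0 \<alpha> \<beta> Npath Ups Zm s t =
     mexp q ((t - lastjump Npath Ups s t) \<cdot>\<^sub>m Bmat q \<beta>) *\<^sub>v pK q \<alpha>0 \<alpha> \<beta> (Npath s) s Ups Zm (Npath t - Npath s)"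

text \<open>The affine map u |-> J u + K on R^q (elements of R^q are extensional functions on {..<q}).\<close>
definition affmap :: "nat \<Rightarrow> real mat \<Rightarrow> real vec \<Rightarrow> (nat \<Rightarrow> real) \<Rightarrow> (nat \<Rightarrow> real)" where
  "affmap q J K u = (\<lambda>i\<in>{..<q}. (J *\<^sub>v vec q u + K) $ i)"

definition lrnorm :: "ereal \<Rightarrow> complex vec \<Rightarrow> real" where
  "lrnorm r v = (if r = \<infinity> then Max (insert 0 ((\<lambda>i. cmod (v $ i)) ` {..<dim_vec v}))
                 else (\<Sum>i<dim_vec v. cmod (v $ i) powr real_of_ereal r) powr (1 / real_of_ereal r))"

definition opnorm :: "nat \<Rightarrow> ereal \<Rightarrow> complex mat \<Rightarrow> real" where
  "opnorm q r C = Sup {lrnorm r (C *\<^sub>v v) / lrnorm r v | v. v \<in> carrier_vec q \<and> v \<noteq> 0\<^sub>v q}"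

definition leftlim :: "(real \<Rightarrow> real) \<Rightarrow> real \<Rightarrow> real" where
  "leftlim f u = Lim (at_left u) f"

definition Vproc :: "nat \<Rightarrow> real \<Rightarrow> (nat \<Rightarrow> real) \<Rightarrow> (real \<Rightarrow> 'a \<Rightarrow> nat \<Rightarrow> real) \<Rightarrow> real \<Rightarrow> 'a \<Rightarrow> real" where
  "Vproc q \<alpha>0 \<alpha> Y s \<omega> =
     (if s = 0 then \<alpha>0 + (\<Sum>k<q. \<alpha> (Suc k) * Y 0 \<omega> k)
      else \<alpha>0 + (\<Sum>k<q. \<alpha> (Suc k) * leftlim (\<lambda>v. Y v \<omega> k) s))"

end

theory Submission
  imports Defs
begin

text \<open>Put \<open>X = S - D\<close>, a pure jump process. Almost surely the jumps of \<open>N\<close> have size one, and then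
  the state solves a linear differential equation between jumps and is hit by an affine map at each
  jump. Hence the state at time \<open>s + t\<close> is a functional of the state at \<open>s\<close> and of the path
  $u \mapsto X_{s+u} - X_s$ on $[0, t]$; it is measurable because it is the limit of a scheme that reads
  only the increments of \<open>X\<close> on a grid, and on $[0, \tau]$ it is the affine map $y \mapsto J_{0,\tau}y + K_{0,\tau}$.

  On a grid refining the partition, all jumps in one grid interval carry marks of a single
  distribution. Conditioning on the countably valued increments of \<open>N\<close> shows that \<open>X\<close> has independent
  increments whose laws are \<open>\<tau>\<close>-periodic. So the path after \<open>\<tau>\<close> has the law of the path from 0 and is
  independent of the initial state together with the path on $[0, \tau]$. As the fixed point equation
  gives \<open>Y \<tau>\<close> the law of \<open>Y 0\<close>, the pair of the state and the future path has the same law at 0 and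
  at \<open>\<tau>\<close>, and every finite-dimensional distribution of \<open>Y\<close> is a functional of that pair.
  The volatility at a fixed time is almost surely an affine function of the state, because a fixed
  time is almost surely not a jump time.\<close>

section \<open>The matrix exponential and linear differential equations\<close>

text \<open>The matrix J and the vector K are written through N, the arrival times and the marks,
  whereas the initial state is only known to be independent of S. Since a mark may be zero, N cannot
  be recovered from S, so this independence says nothing directly about J and K. Hence the detour
  through a functional that reads X alone: the fixed point equation is rewritten in terms of X
  before the independence of the initial state is used. The functional must make sense without
  knowing where the jumps are, so it is a limit of a discretisation and not a formula in the jump
  times. Unit jumps are essential and not built into the paths of N. At a jump of size two the
  equation evaluates both kicks at the same left limit, while the product defining J composes them,
  and X shows only the sum of the two marks. The Poisson law confines this to a null set.
  Periodicity of the law of X is reduced to grid intervals inside one block, where an increment is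
  compound Poisson: its mark distribution depends on the block modulo l, its intensity on an
  increment of \<open>Lam\<close>, and a shift by one period changes neither.\<close>

definition flow :: "nat \<Rightarrow> real mat \<Rightarrow> real \<Rightarrow> (nat \<Rightarrow> real) \<Rightarrow> nat \<Rightarrow> real" where
  "flow q A t y i = (\<Sum>k<q. mexp q (t \<cdot>\<^sub>m A) $$ (i, k) * y k)"

lemma mult_mat_entry:
  fixes A B :: "'b :: semiring_0 mat"
  assumes "A \<in> carrier_mat q q" "B \<in> carrier_mat q q" "i < q" "j < q"
  shows "(A * B) $$ (i, j) = (\<Sum>k<q. A $$ (i, k) * B $$ (k, j))"
  using assms by (auto simp: scalar_prod_def lessThan_atLeast0 intro!: sum.cong)

lemma mult_mat_vec_entry:
  fixes A :: "'b :: semiring_0 mat"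
  assumes "A \<in> carrier_mat q q" "v \<in> carrier_vec q" "i < q"
  shows "(A *\<^sub>v v) $ i = (\<Sum>k<q. A $$ (i, k) * v $ k)"
  using assms by (auto simp: scalar_prod_def lessThan_atLeast0 intro!: sum.cong)

text \<open>\<open>pow_mat\<close> appends the new factor on the right, while the derivative of the
  exponential has to carry A on the left to match the state equation.\<close>

lemma pow_mat_Suc_left:
  fixes A :: "'b :: semiring_1 mat"
  assumes A: "A \<in> carrier_mat q q"
  shows "A ^\<^sub>m Suc n = A * A ^\<^sub>m n"
proof (induction n)
  case 0
  then show ?case using A by simp
next
  case (Suc n)
  have "A ^\<^sub>m Suc (Suc n) = (A * A ^\<^sub>m n) * A" using Suc by simp
  also have "\<dots> = A * (A ^\<^sub>m n * A)" using A by (intro assoc_mult_mat) (auto intro: pow_carrier_mat)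
  finally show ?case by simp
qed

lemma smult_pow_mat:
  fixes A :: "real mat"
  assumes A: "A \<in> carrier_mat q q"
  shows "(t \<cdot>\<^sub>m A) ^\<^sub>m n = t ^ n \<cdot>\<^sub>m A ^\<^sub>m n"
proof (induction n)
  case 0
  then show ?case using A by (intro eq_matI) auto
next
  case (Suc n)
  have "(t \<cdot>\<^sub>m A) ^\<^sub>m Suc n = (t ^ n \<cdot>\<^sub>m A ^\<^sub>m n) * (t \<cdot>\<^sub>m A)" using Suc by simp
  also have "\<dots> = t \<cdot>\<^sub>m (t ^ n \<cdot>\<^sub>m (A ^\<^sub>m n * A))"
    using A pow_carrier_mat[OF A, of n]
    by (simp add: mult_smult_assoc_mat[of _ q q _ q] mult_smult_distrib[of _ q q _ q])
  also have "\<dots> = t ^ Suc n \<cdot>\<^sub>m (A ^\<^sub>m n * A)"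
    by (intro eq_matI) (auto simp: mult_ac)
  finally show ?case by simp
qed

text \<open>The sum over all entries dominates single entries and column sums alike, so entries of
  powers of A are bounded by powers of this one number, without a factor q.\<close>

definition entry_bound :: "nat \<Rightarrow> real mat \<Rightarrow> real" where
  "entry_bound q A = (\<Sum>i<q. \<Sum>j<q. \<bar>A $$ (i, j)\<bar>)"

lemma entry_bound_nonneg: "0 \<le> entry_bound q A"
  by (auto simp: entry_bound_def intro!: sum_nonneg)

lemma col_sum_le_entry_bound:
  assumes "j < q" shows "(\<Sum>i<q. \<bar>A $$ (i, j)\<bar>) \<le> entry_bound q A"
proof -
  have "(\<Sum>i<q. \<bar>A $$ (i, j)\<bar>) \<le> (\<Sum>i<q. \<Sum>j<q. \<bar>A $$ (i, j)\<bar>)"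
    using assms by (intro sum_mono member_le_sum) auto
  then show ?thesis by (simp add: entry_bound_def)
qed

lemma entry_le_entry_bound:
  assumes "i < q" "j < q" shows "\<bar>A $$ (i, j)\<bar> \<le> entry_bound q A"
proof -
  have "\<bar>A $$ (i, j)\<bar> \<le> (\<Sum>i<q. \<bar>A $$ (i, j)\<bar>)"
    using assms by (intro member_le_sum) auto
  then show ?thesis using col_sum_le_entry_bound[OF assms(2)] by (meson order_trans)
qed

lemma pow_mat_entry_bound:
  assumes A: "A \<in> carrier_mat q q" and "i < q" "j < q"
  shows "\<bar>(A ^\<^sub>m n) $$ (i, j)\<bar> \<le> entry_bound q A ^ n"
  using assms(2,3)
proof (induction n arbitrary: i j)
  case 0
  then show ?case using A by auto
next
  case (Suc n)
  have "\<bar>(A ^\<^sub>m Suc n) $$ (i, j)\<bar> = \<bar>\<Sum>k<q. (A ^\<^sub>m n) $$ (i, k) * A $$ (k, j)\<bar>"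
    using A Suc.prems pow_carrier_mat[OF A, of n]
    by (simp add: mult_mat_entry[of _ q] del: index_mult_mat)
  also have "\<dots> \<le> (\<Sum>k<q. \<bar>(A ^\<^sub>m n) $$ (i, k)\<bar> * \<bar>A $$ (k, j)\<bar>)"
    by (rule order_trans[OF sum_abs]) (simp add: abs_mult)
  also have "\<dots> \<le> (\<Sum>k<q. entry_bound q A ^ n * \<bar>A $$ (k, j)\<bar>)"
    using Suc by (intro sum_mono mult_right_mono) auto
  also have "\<dots> \<le> entry_bound q A ^ n * entry_bound q A"
    unfolding sum_distrib_left[symmetric] using Suc.prems
    by (intro mult_left_mono col_sum_le_entry_bound) (auto simp: entry_bound_nonneg)
  finally show ?case by (simp add: mult.commute)
qed

lemma mexp_entry:
  assumes A: "A \<in> carrier_mat q q" and "i < q" "j < q"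
  shows "mexp q (t \<cdot>\<^sub>m A) $$ (i, j) = (\<Sum>n. (A ^\<^sub>m n) $$ (i, j) / fact n * t ^ n)"
proof -
  have "((t \<cdot>\<^sub>m A) ^\<^sub>m n) $$ (i, j) = t ^ n * (A ^\<^sub>m n) $$ (i, j)" for n
    using assms pow_carrier_mat[OF A, of n] by (subst smult_pow_mat[OF A]) auto
  then show ?thesis using assms by (simp add: mexp_def mult_ac)
qed

lemma mexp_carrier [simp]: "mexp q A \<in> carrier_mat q q"
  by (simp add: mexp_def)

lemma mexp_summable:
  fixes A :: "real mat"
  assumes A: "A \<in> carrier_mat q q" and "i < q" "j < q"
  shows "summable (\<lambda>n. (A ^\<^sub>m n) $$ (i, j) / fact n * t ^ n)"
proof -
  have "summable (\<lambda>n. (entry_bound q A * \<bar>t\<bar>) ^ n / fact n)"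
    using summable_exp[of "entry_bound q A * \<bar>t\<bar>"] by (simp add: divide_inverse mult.commute)
  then show ?thesis
  proof (rule summable_comparison_test[rotated], intro exI[of _ 0] allI impI)
    fix n :: nat
    show "norm ((A ^\<^sub>m n) $$ (i, j) / fact n * t ^ n) \<le> (entry_bound q A * \<bar>t\<bar>) ^ n / fact n"
    using mult_right_mono[OF pow_mat_entry_bound[OF assms, of n], of "\<bar>t\<bar> ^ n / fact n"]
    by (simp add: abs_mult power_abs power_mult_distrib)
  qed
qed

lemma mexp_has_derivative:
  assumes A: "A \<in> carrier_mat q q" and i: "i < q" and j: "j < q"
  shows "((\<lambda>t. mexp q (t \<cdot>\<^sub>m A) $$ (i, j)) has_real_derivative
           (\<Sum>k<q. A $$ (i, k) * mexp q (t \<cdot>\<^sub>m A) $$ (k, j))) (at t)"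
proof -
  let ?c = "\<lambda>i n. (A ^\<^sub>m n) $$ (i, j) / fact n :: real"
  \<comment> \<open>Differentiation turns the coefficient A^n / n! into A^(n+1) / n!; splitting off
    the left factor A expresses the derivative through the series of column j.\<close>
  have d: "diffs (?c i) n = (\<Sum>k<q. A $$ (i, k) * ?c k n)" for n
  proof -
    have "diffs (?c i) n = (A ^\<^sub>m Suc n) $$ (i, j) / fact n"
      by (simp add: diffs_def field_simps del: pow_mat.simps of_nat_Suc)
    then show ?thesis using assms pow_carrier_mat[OF A, of n]
      by (simp add: pow_mat_Suc_left[OF A] mult_mat_entry[of _ q] sum_divide_distrib
          del: pow_mat.simps index_mult_mat)
  qed
  have "((\<lambda>t. \<Sum>n. ?c i n * t ^ n) has_real_derivative (\<Sum>n. diffs (?c i) n * t ^ n)) (at t)"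
    by (rule termdiffs_strong_converges_everywhere) (rule mexp_summable[OF assms])
  moreover have "(\<Sum>n. diffs (?c i) n * t ^ n) = (\<Sum>k<q. A $$ (i, k) * (\<Sum>n. ?c k n * t ^ n))"
  proof -
    have "(\<Sum>n. diffs (?c i) n * t ^ n) = (\<Sum>n. \<Sum>k<q. A $$ (i, k) * (?c k n * t ^ n))"
      by (simp add: d sum_distrib_right mult.assoc)
    also have "\<dots> = (\<Sum>k<q. \<Sum>n. A $$ (i, k) * (?c k n * t ^ n))"
      using j by (intro suminf_sum summable_mult mexp_summable[OF A]) auto
    also have "\<dots> = (\<Sum>k<q. A $$ (i, k) * (\<Sum>n. ?c k n * t ^ n))"
      using j by (intro sum.cong refl suminf_mult mexp_summable[OF A]) auto
    finally show ?thesis .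
  qed
  ultimately show ?thesis using assms by (simp add: mexp_entry)
qed

lemma flow_has_derivative:
  assumes A: "A \<in> carrier_mat q q" and i: "i < q"
  shows "((\<lambda>t. flow q A t y i) has_real_derivative (\<Sum>k<q. A $$ (i, k) * flow q A t y k)) (at t)"
proof -
  have "((\<lambda>t. flow q A t y i) has_real_derivative
     (\<Sum>j<q. (\<Sum>k<q. A $$ (i, k) * mexp q (t \<cdot>\<^sub>m A) $$ (k, j)) * y j)) (at t)"
    unfolding flow_def using i by (intro DERIV_sum DERIV_cmult_right mexp_has_derivative[OF A]) auto
  also have "(\<Sum>j<q. (\<Sum>k<q. A $$ (i, k) * mexp q (t \<cdot>\<^sub>m A) $$ (k, j)) * y j) =
      (\<Sum>k<q. A $$ (i, k) * flow q A t y k)"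
    unfolding flow_def sum_distrib_left sum_distrib_right
    by (subst sum.swap) (simp add: mult.assoc)
  finally show ?thesis .
qed

lemma flow_0:
  assumes A: "A \<in> carrier_mat q q" and i: "i < q"
  shows "flow q A 0 y i = y i"
proof -
  have "mexp q (0 \<cdot>\<^sub>m A) $$ (i, k) = (if i = k then 1 else 0)" if "k < q" for k
    using A i that powser_zero[of "\<lambda>n. (A ^\<^sub>m n) $$ (i, k) / fact n"]
    by (subst mexp_entry[OF A]) simp_all
  then show ?thesis using i by (simp add: flow_def if_distrib[of "\<lambda>x. x * _"] cong: if_cong)
qed

lemma flow_cong: "(\<And>k. k < q \<Longrightarrow> y k = y' k) \<Longrightarrow> flow q A t y i = flow q A t y' i"
  by (simp add: flow_def)

lemma flow_tendsto:
  assumes A: "A \<in> carrier_mat q q" and i: "i < q"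
    and t: "(t \<longlongrightarrow> t0) X" and y: "\<And>k. k < q \<Longrightarrow> ((\<lambda>m. y m k) \<longlongrightarrow> y0 k) X"
  shows "((\<lambda>m. flow q A (t m) (y m) i) \<longlongrightarrow> flow q A t0 y0 i) X"
  unfolding flow_def
proof (intro tendsto_sum tendsto_mult)
  fix k assume "k \<in> {..<q}"
  then have k: "k < q" by simp
  show "((\<lambda>m. mexp q (t m \<cdot>\<^sub>m A) $$ (i, k)) \<longlongrightarrow> mexp q (t0 \<cdot>\<^sub>m A) $$ (i, k)) X"
    using DERIV_isCont[OF mexp_has_derivative[OF A i k]] t by (rule isCont_tendsto_compose)
qed (use y in auto)

text \<open>Gronwall: the weighted energy $e^{-2Ct}\sum_i w_i(t)^2$ is nonincreasing.\<close>

lemma linear_ode_zero: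
  fixes w :: "real \<Rightarrow> nat \<Rightarrow> real"
  assumes w: "\<And>u i. i < q \<Longrightarrow> a \<le> u \<Longrightarrow> u \<le> b \<Longrightarrow>
      ((\<lambda>u. w u i) has_real_derivative (\<Sum>k<q. A $$ (i, k) * w u k)) (at u within {a..b})"
    and w0: "\<And>i. i < q \<Longrightarrow> w a i = 0" and u: "a \<le> u" "u \<le> b" and i: "i < q"
  shows "w u i = 0"
proof -
  \<comment> \<open>By 2 |w_i w_k| <= w_i^2 + w_k^2, summed over both indices, every square occurs
    2q times; this gives s' <= 2 C s.\<close>
  define C where "C = real q * entry_bound q A"
  define s where "s v = (\<Sum>i<q. (w v i)\<^sup>2)" for v
  define s' where "s' v = (\<Sum>i<q. 2 * w v i * (\<Sum>k<q. A $$ (i, k) * w v k))" for v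
  have ds: "(s has_real_derivative s' v) (at v within {a..b})" if "a \<le> v" "v \<le> b" for v
    unfolding s_def s'_def
    by (rule DERIV_sum) (auto intro!: derivative_eq_intros w that)
  have s': "s' v \<le> 2 * C * s v" for v
  proof -
    have "s' v \<le> (\<Sum>i<q. \<Sum>k<q. entry_bound q A * ((w v i)\<^sup>2 + (w v k)\<^sup>2))"
      unfolding s'_def sum_distrib_left
    proof (intro sum_mono)
      fix i k assume ik: "i \<in> {..<q}" "k \<in> {..<q}"
      have "2 * (\<bar>w v i\<bar> * \<bar>w v k\<bar>) \<le> (w v i)\<^sup>2 + (w v k)\<^sup>2"
        using sum_squares_bound[of "\<bar>w v i\<bar>" "\<bar>w v k\<bar>"] by simp
      then have "\<bar>A $$ (i, k)\<bar> * (2 * (\<bar>w v i\<bar> * \<bar>w v k\<bar>)) \<le> entry_bound q A * ((w v i)\<^sup>2 + (w v k)\<^sup>2)"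
        using ik entry_le_entry_bound[of i q k A] by (intro mult_mono) (auto simp: entry_bound_nonneg)
      moreover have "2 * w v i * (A $$ (i, k) * w v k) \<le> \<bar>2 * w v i * (A $$ (i, k) * w v k)\<bar>" by simp
      ultimately show "2 * w v i * (A $$ (i, k) * w v k) \<le> entry_bound q A * ((w v i)\<^sup>2 + (w v k)\<^sup>2)"
        by (simp add: abs_mult mult_ac)
    qed
    also have "\<dots> = entry_bound q A * (\<Sum>i<q. \<Sum>k<q. (w v i)\<^sup>2 + (w v k)\<^sup>2)"
      by (simp only: sum_distrib_left)
    also have "(\<Sum>i<q. \<Sum>k<q. (w v i)\<^sup>2 + (w v k)\<^sup>2) = 2 * real q * s v"
      by (simp add: sum.distrib s_def sum_distrib_left mult.assoc)
    also have "entry_bound q A * (2 * real q * s v) = 2 * C * s v"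
      by (simp add: C_def)
    finally show ?thesis .
  qed
  define g where "g v = exp (- 2 * C * v) * s v" for v
  have dg: "(g has_real_derivative exp (- 2 * C * v) * (s' v - 2 * C * s v)) (at v within {a..b})"
    if "a \<le> v" "v \<le> b" for v
  proof -
    have "((\<lambda>v. exp (- 2 * C * v)) has_real_derivative exp (- 2 * C * v) * (- 2 * C)) (at v within {a..b})"
      by (auto intro!: derivative_eq_intros)
    from DERIV_mult'[OF this ds[OF that]] show ?thesis
      unfolding g_def by (rule DERIV_cong) (simp add: algebra_simps)
  qed
  have "g u \<le> g a"
  proof (rule DERIV_nonpos_imp_decreasing_open[OF u(1)])
    fix x assume x: "a < x" "x < u"
    then have "(g has_real_derivative exp (- 2 * C * x) * (s' x - 2 * C * s x)) (at x)"
      using dg[of x] u by (simp add: at_within_Icc_at)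
    moreover have "exp (- 2 * C * x) * (s' x - 2 * C * s x) \<le> 0"
      using s'[of x] by (intro mult_nonneg_nonpos) auto
    ultimately show "\<exists>y. (g has_real_derivative y) (at x) \<and> y \<le> 0" by blast
  next
    have "continuous_on {a..b} g"
      by (rule DERIV_continuous_on) (use dg in auto)
    then show "continuous_on {a..u} g" by (rule continuous_on_subset) (use u in auto)
  qed
  moreover have "g a = 0" using w0 by (simp add: g_def s_def)
  ultimately have "s u \<le> 0" by (simp add: g_def mult_le_0_iff not_le)
  moreover have "(w u i)\<^sup>2 \<le> s u"
    unfolding s_def using i by (intro member_le_sum) auto
  ultimately have "(w u i)\<^sup>2 \<le> 0" by linarith
  then show ?thesis by simp
qed

lemma linear_ode_unique:
  fixes w :: "real \<Rightarrow> nat \<Rightarrow> real"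
  assumes A: "A \<in> carrier_mat q q"
    and w: "\<And>u i. i < q \<Longrightarrow> a \<le> u \<Longrightarrow> u \<le> b \<Longrightarrow>
      ((\<lambda>u. w u i) has_real_derivative (\<Sum>k<q. A $$ (i, k) * w u k)) (at u within {a..b})"
    and u: "a \<le> u" "u \<le> b" and i: "i < q"
  shows "w u i = flow q A (u - a) (w a) i"
proof -
  have "w u i - flow q A (u - a) (w a) i = 0"
  proof (rule linear_ode_zero[where w="\<lambda>u i. w u i - flow q A (u - a) (w a) i" and a=a and b=b])
    fix u i assume "i < q" "a \<le> u" "u \<le> b"
    then have "((\<lambda>u. w u i - flow q A (u - a) (w a) i) has_real_derivative
       (\<Sum>k<q. A $$ (i, k) * w u k) - (\<Sum>k<q. A $$ (i, k) * flow q A (u - a) (w a) k) * 1) (at u within {a..b})"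
      by (intro DERIV_diff w DERIV_chain'[OF _ flow_has_derivative[OF A]])
         (auto intro!: derivative_eq_intros)
    then show "((\<lambda>u. w u i - flow q A (u - a) (w a) i) has_real_derivative
       (\<Sum>k<q. A $$ (i, k) * (w u k - flow q A (u - a) (w a) k))) (at u within {a..b})"
      by (simp add: right_diff_distrib sum_subtractf)
  qed (use u i flow_0[OF A] in auto)
  then show ?thesis by simp
qed

text \<open>As a function of s, the right-hand side solves the same linear equation with the value
  \<open>flow q A t y\<close> at s = 0, so uniqueness takes the place of multiplying power
  series.\<close>

lemma flow_add:
  assumes A: "A \<in> carrier_mat q q" and i: "i < q" and s: "0 \<le> s"
  shows "flow q A s (flow q A t y) i = flow q A (s + t) y i"
proof -
  have "flow q A (s + t) y i = flow q A (s - 0) (\<lambda>k. flow q A (0 + t) y k) i"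
    using s i
    by (intro linear_ode_unique[where w="\<lambda>u k. flow q A (u + t) y k" and b=s, OF A])
       (auto intro!: DERIV_subset[OF DERIV_chain'[OF _ flow_has_derivative[OF A], where D=1, simplified]]
          derivative_eq_intros)
  then show ?thesis by simp
qed

section \<open>A discretisation of the state equation\<close>

text \<open>One jump of size z is the affine map v -> (I + z^2 e a') v + \<alpha>0 z^2 e; its linear
  and constant parts are the building blocks of J and K.\<close>

definition kick :: "nat \<Rightarrow> real \<Rightarrow> (nat \<Rightarrow> real) \<Rightarrow> real \<Rightarrow> (nat \<Rightarrow> real) \<Rightarrow> nat \<Rightarrow> real" where
  "kick q \<alpha>0 \<alpha> z v i = v i + evec q $ i * (\<alpha>0 + (\<Sum>k<q. avec q \<alpha> $ k * v k)) * z\<^sup>2"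

text \<open>The exact state right after the k-th jump, when the jump times T and sizes z are
  known.\<close>

fun flow_kick :: "nat \<Rightarrow> real mat \<Rightarrow> real \<Rightarrow> (nat \<Rightarrow> real) \<Rightarrow> (nat \<Rightarrow> real) \<Rightarrow> (nat \<Rightarrow> real) \<Rightarrow> (nat \<Rightarrow> real)
    \<Rightarrow> nat \<Rightarrow> nat \<Rightarrow> real" where
  "flow_kick q A \<alpha>0 \<alpha> T z y 0 = y"
| "flow_kick q A \<alpha>0 \<alpha> T z y (Suc k) =
     kick q \<alpha>0 \<alpha> (z (Suc k)) (flow q A (T (Suc k) - T k) (flow_kick q A \<alpha>0 \<alpha> T z y k))"

text \<open>Each step flows for time h and then kicks with the increment of x over the step. No test
  for a jump is made, because a kick of size 0 is the identity; so the scheme depends on finitely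
  many values of x and is measurable without locating any jump.\<close>

fun scheme :: "nat \<Rightarrow> real mat \<Rightarrow> real \<Rightarrow> (nat \<Rightarrow> real) \<Rightarrow> (real \<Rightarrow> real) \<Rightarrow> real \<Rightarrow> (nat \<Rightarrow> real)
    \<Rightarrow> nat \<Rightarrow> nat \<Rightarrow> real" where
  "scheme q A \<alpha>0 \<alpha> x h y 0 = y"
| "scheme q A \<alpha>0 \<alpha> x h y (Suc n) =
     kick q \<alpha>0 \<alpha> (x (real (Suc n) * h) - x (real n * h)) (flow q A h (scheme q A \<alpha>0 \<alpha> x h y n))"

lemma kick_0: "kick q \<alpha>0 \<alpha> 0 v = v"
  by (simp add: kick_def fun_eq_iff)

lemma kick_cong: "i < q \<Longrightarrow> (\<And>k. k < q \<Longrightarrow> v k = v' k) \<Longrightarrow> kick q \<alpha>0 \<alpha> z v i = kick q \<alpha>0 \<alpha> z v' i"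
  by (simp add: kick_def)

lemma kick_tendsto:
  assumes "i < q" "\<And>k. k < q \<Longrightarrow> ((\<lambda>m. v m k) \<longlongrightarrow> v0 k) X"
  shows "((\<lambda>m. kick q \<alpha>0 \<alpha> z (v m) i) \<longlongrightarrow> kick q \<alpha>0 \<alpha> z v0 i) X"
  unfolding kick_def using assms by (intro tendsto_intros) auto

lemma scheme_cong:
  assumes "0 \<le> h" "\<And>u. 0 \<le> u \<Longrightarrow> u \<le> real n * h \<Longrightarrow> x u = x' u" "\<And>k. k < q \<Longrightarrow> y k = y' k" "i < q"
  shows "scheme q A \<alpha>0 \<alpha> x h y n i = scheme q A \<alpha>0 \<alpha> x' h y' n i"
  using assms(2,4)
proof (induction n arbitrary: i)
  case 0
  then show ?case using assms by simp
next
  case (Suc n)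
  have le: "real n * h \<le> real (Suc n) * h" using assms(1) by (intro mult_right_mono) auto
  have "x (real (Suc n) * h) = x' (real (Suc n) * h)" "x (real n * h) = x' (real n * h)"
    using Suc.prems le assms(1) by auto
  moreover have "scheme q A \<alpha>0 \<alpha> x h y n k = scheme q A \<alpha>0 \<alpha> x' h y' n k" if "k < q" for k
    using that Suc.prems(1) le by (intro Suc.IH) auto
  ultimately show ?case
    using Suc.prems by (simp del: of_nat_Suc) (intro kick_cong flow_cong, auto)
qed

lemma scheme_no_jump:
  assumes A: "A \<in> carrier_mat q q" and h: "0 \<le> h"
    and x: "\<And>r. r < d \<Longrightarrow> x (real (Suc (n + r)) * h) = x (real (n + r) * h)" and i: "i < q"
  shows "scheme q A \<alpha>0 \<alpha> x h y (n + d) i = flow q A (real d * h) (scheme q A \<alpha>0 \<alpha> x h y n) i"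
  using x i
proof (induction d arbitrary: i)
  case 0
  then show ?case by (simp add: flow_0[OF A])
next
  case (Suc d)
  have "scheme q A \<alpha>0 \<alpha> x h y (n + Suc d) i = flow q A h (scheme q A \<alpha>0 \<alpha> x h y (n + d)) i"
    using Suc.prems(1)[of d] by (simp add: kick_0 del: of_nat_Suc of_nat_add)
  also have "\<dots> = flow q A h (flow q A (real d * h) (scheme q A \<alpha>0 \<alpha> x h y n)) i"
    by (intro flow_cong Suc.IH) (use Suc.prems in auto)
  also have "\<dots> = flow q A (real (Suc d) * h) (scheme q A \<alpha>0 \<alpha> x h y n) i"
    using flow_add[OF A Suc.prems(2) h] by (simp add: algebra_simps)
  finally show ?case .
qed

text \<open>Once the mesh is smaller than all the gaps between jump times, every grid interval contains
  at most one jump, and the scheme differs from the exact solution only in the position of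
  the jump inside its grid interval.\<close>

lemma scheme_tendsto:
  fixes T z :: "nat \<Rightarrow> real" and x :: "real \<Rightarrow> real"
  assumes A: "A \<in> carrier_mat q q" and t: "0 < t" and T0: "T 0 = 0"
    and T: "\<And>k. k < K \<Longrightarrow> T k < T (Suc k)" and TK: "T K \<le> t"
    and x: "\<And>u v. 0 \<le> v \<Longrightarrow> v \<le> u \<Longrightarrow> u \<le> t \<Longrightarrow>
              x u - x v = (\<Sum>k\<in>{1..K}. if v < T k \<and> T k \<le> u then z k else 0)"
    and i: "i < q"
  shows "(\<lambda>m. scheme q A \<alpha>0 \<alpha> x (t / real (Suc m)) y (Suc m) i)
           \<longlonglongrightarrow> flow q A (t - T K) (flow_kick q A \<alpha>0 \<alpha> T z y K) i"
proof -
  define h where "h m = t / real (Suc m)" for m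
  \<comment> \<open>The grid step whose kick registers the k-th jump: \<open>c k m\<close> is the
    index of the first grid point at or after \<open>T k\<close>.\<close>
  define c where "c k m = nat \<lceil>T k / h m\<rceil>" for k m
  let ?S = "\<lambda>m. scheme q A \<alpha>0 \<alpha> x (h m) y"
  let ?U = "flow_kick q A \<alpha>0 \<alpha> T z y"
  have hpos: "0 < h m" for m using t by (simp add: h_def)
  have h0: "h \<longlonglongrightarrow> 0"
    unfolding h_def using tendsto_mult[OF tendsto_const[of t] LIMSEQ_inverse_real_of_nat]
    by (simp add: divide_inverse)
  have Tmono: "T j \<le> T k" if "j \<le> k" "k \<le> K" for j k
    using that
  proof (induction k)
    case (Suc k)
    then show ?case using T[of k] by (cases "j = Suc k") force+
  qed simp
  have Tpos: "0 \<le> T k" if "k \<le> K" for k using Tmono[of 0 k] that T0 by simp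
  have c1: "T k \<le> real (c k m) * h m" "real (c k m) * h m < T k + h m" if "k \<le> K" for k m
  proof -
    have "0 \<le> T k / h m" using Tpos[OF that] hpos[of m] by simp
    then have "T k / h m \<le> real (c k m)" "real (c k m) < T k / h m + 1"
      unfolding c_def by linarith+
    then show "T k \<le> real (c k m) * h m" "real (c k m) * h m < T k + h m"
      using hpos[of m] by (simp_all add: field_simps)
  qed
  have clim: "(\<lambda>m. real (c k m) * h m) \<longlonglongrightarrow> T k" if "k \<le> K" for k
    by (rule tendsto_sandwich[of "\<lambda>_. T k" _ _ "\<lambda>m. T k + h m"])
       (use c1[OF that] tendsto_add[OF tendsto_const h0, of "T k"] in \<open>auto intro!: always_eventually less_imp_le\<close>)
  have le_t: "real n * h m \<le> t" if "n \<le> Suc m" for n m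
  proof -
    have "real n * h m \<le> real (Suc m) * h m" using that hpos[of m] by (intro mult_right_mono) auto
    then show ?thesis by (simp add: h_def)
  qed
  have cle: "c k m \<le> Suc m" if "k \<le> K" for k m
  proof -
    have "T k \<le> t" using Tmono[of k K] TK that by simp
    then have "T k / h m \<le> t / h m" using hpos[of m] by (intro divide_right_mono) auto
    then have "T k / h m \<le> real (Suc m)" using t by (simp add: h_def)
    then show ?thesis unfolding c_def by linarith
  qed
  have nojump: "x (real (Suc n) * h m) = x (real n * h m)"
    if k: "k \<le> K" and n: "c k m \<le> n" "Suc n \<le> Suc m" and nx: "k < K \<longrightarrow> real (Suc n) * h m < T (Suc k)" for k m n
  proof -
    have "\<not> (real n * h m < T j \<and> T j \<le> real (Suc n) * h m)" if j: "j \<in> {1..K}" for j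
    proof (cases "j \<le> k")
      case True
      have "T j \<le> T k" using Tmono True k by simp
      also have "\<dots> \<le> real (c k m) * h m" using c1 k by simp
      also have "\<dots> \<le> real n * h m" using n hpos[of m] by (intro mult_right_mono) auto
      finally show ?thesis by simp
    next
      case False
      then have "T (Suc k) \<le> T j" "k < K" using Tmono j by auto
      then show ?thesis using nx by linarith
    qed
    then have "(\<Sum>j\<in>{1..K}. if real n * h m < T j \<and> T j \<le> real (Suc n) * h m then z j else 0) = 0"
      by (intro sum.neutral) auto
    moreover have "real n * h m \<le> real (Suc n) * h m" using hpos[of m] by (intro mult_right_mono) auto
    ultimately show ?thesis
      using x[of "real n * h m" "real (Suc n) * h m"] le_t[OF n(2)] hpos[of m] by simp
  qed
  have main: "\<forall>i<q. (\<lambda>m. ?S m (c k m) i) \<longlonglongrightarrow> ?U k i" if "k \<le> K" for k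
    using that
  proof (induction k)
    case 0
    have "c 0 m = 0" for m by (simp add: c_def T0)
    then show ?case by simp
  next
    case (Suc k)
    then have k: "k < K" "k \<le> K" "Suc k \<le> K" by auto
    \<comment> \<open>The first gap condition keeps jump k out of the cell of jump k + 1, the second
      keeps jump k + 2 out of it. The second is void when k + 1 = K.\<close>
    have gap: "eventually (\<lambda>m. h m < T (Suc k) - T k) sequentially"
      using h0 T[OF k(1)] by (intro order_tendstoD) auto
    have gap2: "eventually (\<lambda>m. Suc k < K \<longrightarrow> h m < T (Suc (Suc k)) - T (Suc k)) sequentially"
      using order_tendstoD(2)[OF h0, of "T (Suc (Suc k)) - T (Suc k)"] T[of "Suc k"]
      by (cases "Suc k < K") auto
    have step: "eventually (\<lambda>m. \<forall>i<q. kick q \<alpha>0 \<alpha> (z (Suc k))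
        (flow q A (real (c (Suc k) m) * h m - real (c k m) * h m) (?S m (c k m))) i = ?S m (c (Suc k) m) i) sequentially"
      using gap gap2
    proof eventually_elim
      case (elim m)
      note hm = hpos[of m]
      have "real (c k m) * h m < real (c (Suc k) m) * h m"
        using c1[OF k(2), of m] c1[OF k(3), of m] elim by linarith
      then have clt: "c k m < c (Suc k) m" using hm by simp
      \<comment> \<open>The d steps after \<open>c k m\<close> see no jump; the step from n to n + 1
        sees exactly jump k + 1. The total flow time is (d + 1) h, the distance of the two
        registering grid points.\<close>
      define d where "d = c (Suc k) m - 1 - c k m"
      define n where "n = c (Suc k) m - 1"
      have nd: "c k m + d = n" "Suc n = c (Suc k) m" "Suc n \<le> Suc m"
        using clt cle[OF k(3), of m] by (auto simp: d_def n_def)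
      have nT: "real n * h m < T (Suc k)" "T (Suc k) \<le> real (Suc n) * h m"
        using c1[OF k(3), of m] nd(2)[symmetric] by (auto simp: algebra_simps)
      have before: "?S m n i = flow q A (real d * h m) (?S m (c k m)) i" if "i < q" for i
        unfolding nd(1)[symmetric]
      proof (intro scheme_no_jump[OF A less_imp_le[OF hm] _ that] nojump[OF k(2)] impI)
        fix r assume r: "r < d"
        then have "Suc (c k m + r) \<le> n" using nd by simp
        then have "real (Suc (c k m + r)) * h m \<le> real n * h m" using hm by (intro mult_right_mono) auto
        then show "real (Suc (c k m + r)) * h m < T (Suc k)" using nT by simp
        show "Suc (c k m + r) \<le> Suc m" using \<open>Suc (c k m + r) \<le> n\<close> nd by simp
      qed simp
      have "(real n * h m < T j \<and> T j \<le> real (Suc n) * h m) = (j = Suc k)" if j: "j \<in> {1..K}" for j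
      proof (cases j "Suc k" rule: linorder_cases)
        case less
        then have "T j \<le> T k" using Tmono k by simp
        also have "\<dots> \<le> real (c k m) * h m" using c1 k by simp
        also have "\<dots> \<le> real n * h m" using nd hm by (intro mult_right_mono) auto
        finally show ?thesis using less by simp
      next
        case greater
        then have "T (Suc (Suc k)) \<le> T j" "Suc k < K" using Tmono j by auto
        then have "real (Suc n) * h m < T j"
          using c1(2)[OF k(3), of m] nd(2) elim by (simp del: of_nat_Suc)
        then show ?thesis using greater by simp
      qed (use nT in simp)
      then have "(\<Sum>j\<in>{1..K}. if real n * h m < T j \<and> T j \<le> real (Suc n) * h m then z j else 0)
          = (\<Sum>j\<in>{1..K}. if j = Suc k then z j else 0)"
        by (intro sum.cong) auto
      also have "\<dots> = z (Suc k)" using k by simp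
      finally have jump: "x (real (Suc n) * h m) - x (real n * h m) = z (Suc k)"
        using x[of "real n * h m" "real (Suc n) * h m"] le_t[OF nd(3)] hm nT by (simp del: of_nat_Suc)
      show ?case
      proof (intro allI impI)
        fix i assume i: "i < q"
        have "?S m (c (Suc k) m) i = kick q \<alpha>0 \<alpha> (z (Suc k)) (flow q A (h m) (?S m n)) i"
          unfolding nd(2)[symmetric] by (simp add: jump del: of_nat_Suc)
        also have "\<dots> = kick q \<alpha>0 \<alpha> (z (Suc k)) (flow q A (h m) (flow q A (real d * h m) (?S m (c k m)))) i"
          by (intro kick_cong i flow_cong before)
        also have "\<dots> = kick q \<alpha>0 \<alpha> (z (Suc k)) (flow q A (h m + real d * h m) (?S m (c k m))) i"
          by (intro kick_cong i flow_add[OF A]) (use hm in auto)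
        also have "h m + real d * h m = real (c (Suc k) m) * h m - real (c k m) * h m"
          unfolding nd(2)[symmetric] nd(1)[symmetric] by (simp add: algebra_simps)
        finally show "kick q \<alpha>0 \<alpha> (z (Suc k))
          (flow q A (real (c (Suc k) m) * h m - real (c k m) * h m) (?S m (c k m))) i = ?S m (c (Suc k) m) i"
          by simp
      qed
    qed
    show ?case
    proof (intro allI impI)
      fix i assume i: "i < q"
      have "(\<lambda>m. kick q \<alpha>0 \<alpha> (z (Suc k))
          (flow q A (real (c (Suc k) m) * h m - real (c k m) * h m) (?S m (c k m))) i) \<longlonglongrightarrow> ?U (Suc k) i"
        unfolding flow_kick.simps
        by (intro kick_tendsto i flow_tendsto[OF A] tendsto_diff clim k) (use Suc.IH k in auto)
      then show "(\<lambda>m. ?S m (c (Suc k) m) i) \<longlonglongrightarrow> ?U (Suc k) i"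
        using step i by (elim Lim_transform_eventually) (auto elim: eventually_mono)
    qed
  qed
  \<comment> \<open>After the last registered jump the scheme only flows, until the grid point (m +
    1) h = t.\<close>
  have last: "?S m (Suc m) i = flow q A (t - real (c K m) * h m) (?S m (c K m)) i" for m
  proof -
    have "?S m (c K m + (Suc m - c K m)) i = flow q A (real (Suc m - c K m) * h m) (?S m (c K m)) i"
      using hpos[of m] cle[of K m] by (intro scheme_no_jump[OF A _ _ i] nojump[of K]) auto
    moreover have "real (Suc m - c K m) * h m = t - real (c K m) * h m"
      using cle[of K m] by (simp add: of_nat_diff left_diff_distrib h_def field_simps)
    ultimately show ?thesis using cle[of K m] by simp
  qed
  have "(\<lambda>m. flow q A (t - real (c K m) * h m) (?S m (c K m)) i) \<longlonglongrightarrow> flow q A (t - T K) (?U K) i"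
    by (intro flow_tendsto[OF A i] tendsto_diff tendsto_const clim) (use main in auto)
  then show ?thesis by (simp add: last[symmetric]) (simp add: h_def)
qed

text \<open>Through the scheme the solution becomes a measurable functional of the initial value and of
  the values of the driving path in \<open>[0, t]\<close>.\<close>

definition solution_map :: "nat \<Rightarrow> real mat \<Rightarrow> real \<Rightarrow> (nat \<Rightarrow> real) \<Rightarrow> real \<Rightarrow> (nat \<Rightarrow> real) \<Rightarrow> (real \<Rightarrow> real) \<Rightarrow> nat \<Rightarrow> real" where
  "solution_map q A \<alpha>0 \<alpha> t y x = (\<lambda>i\<in>{..<q}. if t = 0 then y i
     else lim (\<lambda>m. scheme q A \<alpha>0 \<alpha> x (t / real (Suc m)) y (Suc m) i))"

lemma solution_map_cong:
  assumes t: "0 \<le> t" and x: "\<And>u. 0 \<le> u \<Longrightarrow> u \<le> t \<Longrightarrow> x u = x' u" and y: "\<And>k. k < q \<Longrightarrow> y k = y' k"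
  shows "solution_map q A \<alpha>0 \<alpha> t y x = solution_map q A \<alpha>0 \<alpha> t y' x'"
proof -
  have "scheme q A \<alpha>0 \<alpha> x (t / real (Suc m)) y (Suc m) i = scheme q A \<alpha>0 \<alpha> x' (t / real (Suc m)) y' (Suc m) i"
    if "i < q" for m i
    using t that by (intro scheme_cong x y) (auto simp del: of_nat_Suc)
  then show ?thesis using y by (auto simp: solution_map_def fun_eq_iff restrict_def)
qed

lemma scheme_measurable:
  assumes y: "\<And>k. k < q \<Longrightarrow> (\<lambda>p. f p k) \<in> borel_measurable M"
    and x: "\<And>u. 0 \<le> u \<Longrightarrow> u \<le> real n * h \<Longrightarrow> (\<lambda>p. g p u) \<in> borel_measurable M"
    and h: "0 \<le> h" and i: "i < q"
  shows "(\<lambda>p. scheme q A \<alpha>0 \<alpha> (g p) h (f p) n i) \<in> borel_measurable M"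
  using x i
proof (induction n arbitrary: i)
  case 0
  then show ?case using y by simp
next
  case (Suc n)
  have le: "real n * h \<le> real (Suc n) * h" using h by (intro mult_right_mono) auto
  have IH: "(\<lambda>p. scheme q A \<alpha>0 \<alpha> (g p) h (f p) n k) \<in> borel_measurable M" if "k < q" for k
    by (intro Suc.IH Suc.prems) (use le that in auto)
  have "(\<lambda>p. flow q A h (scheme q A \<alpha>0 \<alpha> (g p) h (f p) n) k) \<in> borel_measurable M" for k
    unfolding flow_def by (intro borel_measurable_sum borel_measurable_times IH) auto
  moreover have "(\<lambda>p. g p (real (Suc n) * h)) \<in> borel_measurable M" "(\<lambda>p. g p (real n * h)) \<in> borel_measurable M"
    using le h by (auto intro!: Suc.prems simp del: of_nat_Suc)
  ultimately show ?case unfolding scheme.simps kick_def by measurable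
qed

lemma solution_map_measurable:
  assumes t: "0 \<le> t" and I: "{0..t} \<subseteq> I"
  shows "(\<lambda>p. solution_map q A \<alpha>0 \<alpha> t (fst p) (snd p))
    \<in> measurable (PiM {..<q} (\<lambda>_. borel) \<Otimes>\<^sub>M PiM I (\<lambda>_. borel)) (PiM {..<q} (\<lambda>_. borel))"
  unfolding solution_map_def
proof (rule measurable_restrict)
  fix i assume "i \<in> {..<q}"
  then have i: "i < q" by simp
  have y: "(\<lambda>p. fst p k) \<in> borel_measurable (PiM {..<q} (\<lambda>_. borel) \<Otimes>\<^sub>M PiM I (\<lambda>_. borel))" if "k < q" for k
    using that by (intro measurable_compose[OF measurable_fst] measurable_component_singleton) auto
  have x: "(\<lambda>p. snd p u) \<in> borel_measurable (PiM {..<q} (\<lambda>_. borel) \<Otimes>\<^sub>M PiM I (\<lambda>_. borel))"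
    if "0 \<le> u" "u \<le> t" for u
    using that I by (intro measurable_compose[OF measurable_snd] measurable_component_singleton) auto
  have "(\<lambda>p. scheme q A \<alpha>0 \<alpha> (snd p) (t / real (Suc m)) (fst p) (Suc m) i)
      \<in> borel_measurable (PiM {..<q} (\<lambda>_. borel) \<Otimes>\<^sub>M PiM I (\<lambda>_. borel))" for m
    using t i by (intro scheme_measurable y x) (auto simp del: of_nat_Suc)
  then show "(\<lambda>p. if t = 0 then fst p i else lim (\<lambda>m. scheme q A \<alpha>0 \<alpha> (snd p) (t / real (Suc m)) (fst p) (Suc m) i))
      \<in> borel_measurable (PiM {..<q} (\<lambda>_. borel) \<Otimes>\<^sub>M PiM I (\<lambda>_. borel))"
    using y[OF i] by (cases "t = 0") (auto intro!: borel_measurable_lim_metric simp del: of_nat_Suc scheme.simps)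
qed

lemma solution_map_eq:
  fixes T z :: "nat \<Rightarrow> real" and x :: "real \<Rightarrow> real"
  assumes A: "A \<in> carrier_mat q q" and t: "0 \<le> t" and T0: "T 0 = 0"
    and T: "\<And>k. k < K \<Longrightarrow> T k < T (Suc k)" and TK: "T K \<le> t"
    and x: "\<And>u v. 0 \<le> v \<Longrightarrow> v \<le> u \<Longrightarrow> u \<le> t \<Longrightarrow>
              x u - x v = (\<Sum>k\<in>{1..K}. if v < T k \<and> T k \<le> u then z k else 0)"
  shows "solution_map q A \<alpha>0 \<alpha> t y x = (\<lambda>i\<in>{..<q}. flow q A (t - T K) (flow_kick q A \<alpha>0 \<alpha> T z y K) i)"
proof (cases "t = 0")
  case True
  have "K = 0"
  proof (rule ccontr)
    assume K: "K \<noteq> 0"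
    have "T 0 < T (Suc k)" if "Suc k \<le> K" for k
      using that by (induction k) (use T in \<open>auto intro: less_trans\<close>)
    from this[of "K - 1"] K T0 TK True show False by simp
  qed
  then show ?thesis using True T0 by (auto simp: solution_map_def flow_0[OF A] fun_eq_iff restrict_def)
next
  case False
  then have "0 < t" using t by simp
  from limI[OF scheme_tendsto[OF A this T0 T TK x]] False show ?thesis
    by (auto simp: solution_map_def fun_eq_iff restrict_def simp del: scheme.simps of_nat_Suc)
qed

section \<open>Paths of the state process\<close>

definition cadlag :: "(real \<Rightarrow> real) \<Rightarrow> bool" where
  "cadlag f \<longleftrightarrow> (\<forall>u\<ge>0. (f \<longlongrightarrow> f u) (at_right u) \<and> (0 < u \<longrightarrow> (\<exists>L. (f \<longlongrightarrow> L) (at_left u))))"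

lemma leftlim_eqI: "(f \<longlongrightarrow> L) (at_left u) \<Longrightarrow> leftlim f u = L"
  by (simp add: leftlim_def tendsto_Lim)

lemma cadlag_tendsto_leftlim: "cadlag f \<Longrightarrow> 0 < u \<Longrightarrow> (f \<longlongrightarrow> leftlim f u) (at_left u)"
  by (auto simp: cadlag_def leftlim_eqI dest!: spec[of _ u])

lemma cadlag_locally_bounded:
  assumes f: "cadlag f" and u: "0 \<le> u"
  shows "\<exists>d>0. \<exists>C. \<forall>v. 0 \<le> v \<and> \<bar>v - u\<bar> < d \<longrightarrow> \<bar>f v\<bar> \<le> C"
proof -
  have "eventually (\<lambda>v. \<bar>f v - f u\<bar> < 1) (at_right u)"
    using f u tendstoD[of f "f u" "at_right u" 1] by (auto simp: cadlag_def dist_real_def)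
  then obtain b where b: "b > u" "\<And>v. u < v \<Longrightarrow> v < b \<Longrightarrow> \<bar>f v - f u\<bar> < 1"
    unfolding eventually_at_right_field by blast
  obtain a C where a: "a < u" "\<And>v. 0 \<le> v \<Longrightarrow> a < v \<Longrightarrow> v < u \<Longrightarrow> \<bar>f v\<bar> \<le> C"
  proof (cases "u = 0")
    case True
    then show thesis using that[of "-1"] by auto
  next
    case False
    then have "eventually (\<lambda>v. \<bar>f v - leftlim f u\<bar> < 1) (at_left u)"
      using tendstoD[OF cadlag_tendsto_leftlim[OF f], of u 1] u by (auto simp: dist_real_def)
    then obtain a where "a < u" "\<And>v. a < v \<Longrightarrow> v < u \<Longrightarrow> \<bar>f v - leftlim f u\<bar> < 1"
      unfolding eventually_at_left_field by blast
    then show thesis using that[of a "\<bar>leftlim f u\<bar> + 1"] by force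
  qed
  have "\<bar>f v\<bar> \<le> max C (\<bar>f u\<bar> + 1)" if "0 \<le> v" "\<bar>v - u\<bar> < min (u - a) (b - u)" for v
  proof (cases v u rule: linorder_cases)
    case less
    then show ?thesis using a(2)[of v] that by auto
  next
    case greater
    then show ?thesis using b(2)[of v] that by auto
  qed auto
  then show ?thesis using a(1) b(1) by (intro exI[of _ "min (u - a) (b - u)"]) auto
qed

text \<open>The one-sided limits bound f near each point, and finitely many such neighbourhoods
  cover [0, t]. Boundedness is what makes the integrand of the state equation integrable.\<close>

lemma cadlag_bounded:
  assumes f: "cadlag f"
  shows "\<exists>C. \<forall>v\<in>{0..t}. \<bar>f v\<bar> \<le> C"
proof -
  obtain d C where d: "\<And>u. 0 \<le> u \<Longrightarrow> 0 < d u"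
    and C: "\<And>u v. 0 \<le> u \<Longrightarrow> 0 \<le> v \<Longrightarrow> \<bar>v - u\<bar> < d u \<Longrightarrow> \<bar>f v\<bar> \<le> C u"
    using cadlag_locally_bounded[OF f] by metis
  have "{0..t} \<subseteq> (\<Union>u\<in>{0..t}. ball u (d u))" using d by fastforce
  then obtain F where F: "F \<subseteq> {0..t}" "finite F" "{0..t} \<subseteq> (\<Union>u\<in>F. ball u (d u))"
    using compactE_image[OF compact_Icc[of 0 t], of "{0..t}" "\<lambda>u. ball u (d u)"] by auto
  have "\<bar>f v\<bar> \<le> (\<Sum>u\<in>F. \<bar>C u\<bar>)" if v: "v \<in> {0..t}" for v
  proof -
    obtain u where u: "u \<in> F" "v \<in> ball u (d u)" using F v by blast
    then have "\<bar>f v\<bar> \<le> C u" using C[of u v] F v by (auto simp: dist_real_def abs_minus_commute)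
    also have "\<dots> \<le> \<bar>C u\<bar>" by simp
    also have "\<dots> \<le> (\<Sum>u\<in>F. \<bar>C u\<bar>)" using u F by (intro member_le_sum) auto
    finally show ?thesis .
  qed
  then show ?thesis by blast
qed

lemma leftlim_bounded:
  assumes f: "cadlag f" and C: "\<And>v. v \<in> {0..t} \<Longrightarrow> \<bar>f v\<bar> \<le> C" and u: "0 < u" "u \<le> t"
  shows "\<bar>leftlim f u\<bar> \<le> C"
proof (rule tendsto_upperbound[OF tendsto_rabs[OF cadlag_tendsto_leftlim[OF f u(1)]]])
  have "eventually (\<lambda>v. v \<in> {0<..<u}) (at_left u)" using u(1) by (rule eventually_at_left_real)
  then show "eventually (\<lambda>v. \<bar>f v\<bar> \<le> C) (at_left u)"
    by eventually_elim (use u C in auto)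
qed simp

text \<open>The grid points $(\lceil nu \rceil - 1)/n < u$ approach \<open>u\<close> strictly from the left.\<close>

lemma leftlim_measurable:
  assumes f: "cadlag f"
  shows "(\<lambda>u. if 0 < u then leftlim f u else 0) \<in> borel_measurable borel"
proof (rule borel_measurable_LIMSEQ_real)
  let ?g = "\<lambda>n u. (real_of_int \<lceil>real (Suc n) * u\<rceil> - 1) / real (Suc n)"
  show "(\<lambda>u. if 0 < u then f (?g n u) else 0) \<in> borel_measurable borel" for n
  proof (intro measurable_If)
    have "(\<lambda>u::real. \<lceil>real (Suc n) * u\<rceil>) \<in> measurable borel (count_space UNIV)" by measurable
    then show "(\<lambda>u. f (?g n u)) \<in> borel_measurable borel"
      by (rule measurable_compose[where g="\<lambda>k. f ((real_of_int k - 1) / real (Suc n))"]) simp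
  qed auto
  fix u :: real
  show "(\<lambda>n. if 0 < u then f (?g n u) else 0) \<longlonglongrightarrow> (if 0 < u then leftlim f u else 0)"
  proof (cases "0 < u")
    case True
    have lt: "?g n u < u" and ge: "u - 1 / real (Suc n) \<le> ?g n u" for n
    proof -
      have "real_of_int \<lceil>real (Suc n) * u\<rceil> - 1 < real (Suc n) * u" by linarith
      then show "?g n u < u" by (subst pos_divide_less_eq) (simp_all add: mult.commute)
      have "real (Suc n) * u - 1 \<le> real_of_int \<lceil>real (Suc n) * u\<rceil> - 1" by linarith
      then have "(real (Suc n) * u - 1) / real (Suc n) \<le> ?g n u" by (rule divide_right_mono) simp
      then show "u - 1 / real (Suc n) \<le> ?g n u" by (simp add: diff_divide_distrib del: of_nat_Suc)
    qed
    have "(\<lambda>n. u - 1 / real (Suc n)) \<longlonglongrightarrow> u - 0"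
      using LIMSEQ_inverse_real_of_nat by (intro tendsto_intros) (simp add: inverse_eq_divide)
    then have "(\<lambda>n. ?g n u) \<longlonglongrightarrow> u"
      by (intro tendsto_sandwich[OF _ _ _ tendsto_const, of "\<lambda>n. u - 1 / real (Suc n)" "\<lambda>n. ?g n u"])
         (use lt ge in \<open>auto intro!: always_eventually less_imp_le simp del: of_nat_Suc\<close>)
    then have "filterlim (\<lambda>n. ?g n u) (at_left u) sequentially"
      unfolding filterlim_at using lt less_imp_neq[OF lt] by (intro conjI always_eventually allI) auto
    from filterlim_compose[OF cadlag_tendsto_leftlim[OF f True] this] True show ?thesis by simp
  qed simp
qed

text \<open>Away from 0 the integrand is measurable and bounded. At 0, where \<open>cadlag\<close>
  does not control \<open>leftlim\<close>, it is some fixed number; this point is split off as an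
  integrable term supported on {0}.\<close>

lemma leftlim_integrable:
  assumes f: "cadlag f"
  shows "set_integrable lborel {0..t} (\<lambda>u. leftlim f u)"
proof -
  obtain C where C: "\<And>v. v \<in> {0..t} \<Longrightarrow> \<bar>f v\<bar> \<le> C" using cadlag_bounded[OF f] by blast
  have "integrable lborel (\<lambda>u. indicator {0..t} u *\<^sub>R (if 0 < u then leftlim f u else 0))"
  proof (rule Bochner_Integration.integrable_bound)
    show "integrable lborel (\<lambda>u. \<bar>C\<bar> * indicator {0..t} u :: real)"
      by (intro integrable_mult_right integrable_real_indicator) (auto simp: emeasure_lborel_Icc_eq)
    show "(\<lambda>u. indicator {0..t} u *\<^sub>R (if 0 < u then leftlim f u else 0)) \<in> borel_measurable lborel"
      using leftlim_measurable[OF f] by measurable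
    show "AE u in lborel. norm (indicator {0..t} u *\<^sub>R (if 0 < u then leftlim f u else 0)) \<le> norm (\<bar>C\<bar> * indicator {0..t} u :: real)"
    proof (rule AE_I2)
      fix u :: real
      have "\<bar>leftlim f u\<bar> \<le> \<bar>C\<bar>" if "0 < u" "u \<le> t"
        using leftlim_bounded[OF f C that] by linarith
      then show "norm (indicator {0..t} u *\<^sub>R (if 0 < u then leftlim f u else 0)) \<le> norm (\<bar>C\<bar> * indicator {0..t} u :: real)"
        by (auto simp: indicator_def)
    qed
  qed
  moreover have "integrable lborel (\<lambda>u::real. leftlim f 0 * indicator ({0} \<inter> {0..t}) u)"
    by (intro integrable_mult_right integrable_real_indicator) (auto simp: Int_insert_left)
  moreover have "indicator {0..t} u *\<^sub>R leftlim f u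
      = indicator {0..t} u *\<^sub>R (if 0 < u then leftlim f u else 0) + leftlim f 0 * indicator ({0} \<inter> {0..t}) u" for u
    by (auto simp: indicator_def)
  ultimately show ?thesis
    unfolding set_integrable_def by simp
qed

text \<open>The state may jump at b, so the argument runs through the continuous continuation w of y
  from [a, b) to [a, b]. The left limits of y on (a, b] are values of w, which turns the integral
  equation into one for w alone; w is therefore differentiable and solves the linear
  equation.\<close>

lemma sde_segment:
  fixes y :: "real \<Rightarrow> nat \<Rightarrow> real" and I :: "nat \<Rightarrow> real \<Rightarrow> real"
  assumes A: "A \<in> carrier_mat q q" and cl: "\<And>i. i < q \<Longrightarrow> cadlag (\<lambda>u. y u i)"
    and I: "\<And>i u. I i u = (LINT v:{0..u}|lborel. (\<Sum>k<q. A $$ (i, k) * leftlim (\<lambda>w. y w k) v))"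
    and ab: "0 \<le> a" "a \<le> b"
    and seg: "\<And>u i. a \<le> u \<Longrightarrow> u < b \<Longrightarrow> i < q \<Longrightarrow> y u i = y a i + (I i u - I i a)"
    and i: "i < q"
  shows "y a i + (I i b - I i a) = flow q A (b - a) (y a) i"
    and "a < b \<Longrightarrow> leftlim (\<lambda>u. y u i) b = flow q A (b - a) (y a) i"
proof -
  define f where "f i v = (\<Sum>k<q. A $$ (i, k) * leftlim (\<lambda>w. y w k) v)" for i v
  define w where "w u i = y a i + (I i u - I i a)" for u i
  have int: "set_integrable lborel {0..u} (f i)" for i u
  proof -
    have "(\<lambda>v. indicator {0..u} v *\<^sub>R f i v) = (\<lambda>v. \<Sum>k<q. A $$ (i, k) * (indicator {0..u} v *\<^sub>R leftlim (\<lambda>w. y w k) v))"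
      by (auto simp: f_def sum_distrib_left mult_ac fun_eq_iff)
    moreover have "integrable lborel (\<lambda>v. indicator {0..u} v *\<^sub>R leftlim (\<lambda>w. y w k) v)" if "k < q" for k
      using leftlim_integrable[OF cl[OF that]] by (simp add: set_integrable_def)
    ultimately show ?thesis
      unfolding set_integrable_def by (auto intro!: Bochner_Integration.integrable_sum)
  qed
  have hk: "f i integrable_on {0..b}" "I i u = integral {0..u} (f i)" for i u
    using set_borel_integral_eq_integral[OF int[of b i]] set_borel_integral_eq_integral[OF int[of u i]]
    by (auto simp: I f_def)
  have hka: "f i integrable_on {a..b}" for i
    by (rule integrable_subinterval_real[OF hk(1)]) (use ab in auto)
  have wI: "w u i = y a i + integral {a..u} (f i)" if u: "a \<le> u" "u \<le> b" for u i
  proof -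
    have "f i integrable_on {0..u}" by (rule integrable_subinterval_real[OF hk(1)]) (use u ab in auto)
    from Henstock_Kurzweil_Integration.integral_combine[OF ab(1) u(1) this] show ?thesis
      by (simp add: w_def hk(2))
  qed
  have cont: "continuous_on {a..b} (\<lambda>u. w u i)" for i
  proof -
    have "continuous_on {a..b} (\<lambda>u. y a i + integral {a..u} (f i))"
      by (intro continuous_intros indefinite_integral_continuous_1 hka)
    then show ?thesis by (rule continuous_on_eq) (simp add: wI)
  qed
  have wy: "w u i = y u i" if "a \<le> u" "u < b" "i < q" for u i
    using seg[OF that] by (simp add: w_def)
  have ll: "leftlim (\<lambda>u. y u i) u = w u i" if u: "a < u" "u \<le> b" and i: "i < q" for u i
  proof (rule leftlim_eqI)
    have "((\<lambda>u. w u i) \<longlongrightarrow> w u i) (at u within {a..b})"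
      using cont u by (auto simp: continuous_on)
    then have "((\<lambda>u. w u i) \<longlongrightarrow> w u i) (at u within {a..<u})"
      by (rule tendsto_within_subset) (use u in auto)
    moreover have "at u within {a..<u} = at_left u"
      using u by (intro at_within_nhd[of u "{a<..}"]) auto
    ultimately have "((\<lambda>u. w u i) \<longlongrightarrow> w u i) (at_left u)" by simp
    moreover have "eventually (\<lambda>v. v \<in> {a<..<u}) (at_left u)" using u(1) by (rule eventually_at_left_real)
    then have "eventually (\<lambda>v. w v i = y v i) (at_left u)"
      by eventually_elim (use u i wy in auto)
    ultimately show "((\<lambda>u. y u i) \<longlongrightarrow> w u i) (at_left u)"
      by (rule Lim_transform_eventually)
  qed
  have der: "((\<lambda>u. w u i) has_real_derivative (\<Sum>k<q. A $$ (i, k) * w u k)) (at u within {a..b})"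
    if u: "a \<le> u" "u \<le> b" and i: "i < q" for u i
  proof -
    let ?g = "\<lambda>u. \<Sum>k<q. A $$ (i, k) * w u k"
    have "w u i = y a i + integral {a..u} ?g" if u: "a \<le> u" "u \<le> b" for u
    proof -
      \<comment> \<open>At a itself the left limit of y looks at times before the segment and may
        differ from \<open>w a\<close>; a single point does not matter.\<close>
      have "integral {a..u} (f i) = integral {a..u} ?g"
        by (rule integral_spike[of "{a}"]) (use u ll in \<open>auto simp: f_def intro!: sum.cong\<close>)
      then show ?thesis using wI[OF u] by simp
    qed
    moreover have "((\<lambda>u. integral {a..u} ?g) has_real_derivative ?g u) (at u within {a..b})"
      using u by (intro integral_has_real_derivative continuous_intros cont) auto
    then have "((\<lambda>u. y a i + integral {a..u} ?g) has_real_derivative ?g u) (at u within {a..b})"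
      by (auto intro!: derivative_eq_intros)
    ultimately show ?thesis
      using u by (auto intro: has_field_derivative_transform_within[where d=1])
  qed
  have wa: "w a = y a" by (simp add: w_def fun_eq_iff)
  have "w b i = flow q A (b - a) (w a) i"
    by (rule linear_ode_unique[where w=w and a=a and b=b, OF A]) (use ab i der in auto)
  then show *: "y a i + (I i b - I i a) = flow q A (b - a) (y a) i" by (simp add: wa) (simp add: w_def)
  show "leftlim (\<lambda>u. y u i) b = flow q A (b - a) (y a) i" if "a < b"
    using ll[of b i] that i * by (simp add: w_def)
qed

section \<open>Counting paths and their arrival times\<close>

locale counting_path =
  fixes n :: "real \<Rightarrow> nat"
  assumes n0: "n 0 = 0" and mono: "mono_on {0..} n"
    and rc: "\<And>u. 0 \<le> u \<Longrightarrow> \<exists>e>0. \<forall>v\<in>{u..u + e}. n v = n u"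
begin

definition arr :: "nat \<Rightarrow> real" where
  "arr k = Inf {u. 0 \<le> u \<and> k \<le> n u}"

lemma n_le: "0 \<le> u \<Longrightarrow> u \<le> v \<Longrightarrow> n u \<le> n v"
  using mono by (auto simp: mono_on_def)

lemma arr_nonneg:
  assumes "0 \<le> u" "k \<le> n u" shows "0 \<le> arr k"
  unfolding arr_def by (rule cInf_greatest) (use assms in auto)

text \<open>Right continuity makes the infimum attained: a point of the set lies within the interval
  to the right of \<open>arr k\<close> on which n is constant.\<close>

lemma le_n_arr:
  assumes u: "0 \<le> u" "k \<le> n u" shows "k \<le> n (arr k)"
proof -
  obtain e where e: "e > 0" "\<forall>v\<in>{arr k..arr k + e}. n v = n (arr k)"
    using rc[OF arr_nonneg[OF u]] by blast
  have "Inf {u. 0 \<le> u \<and> k \<le> n u} < arr k + e" using e(1) by (simp add: arr_def)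
  then obtain s where s: "0 \<le> s" "k \<le> n s" "s < arr k + e"
    using cInf_lessD[of "{u. 0 \<le> u \<and> k \<le> n u}"] u by auto
  have "arr k \<le> s" unfolding arr_def by (rule cInf_lower) (use s in \<open>auto intro!: bdd_belowI[of _ 0]\<close>)
  then have "s \<in> {arr k..arr k + e}" using s by simp
  then have "n s = n (arr k)" using e(2) by blast
  then show ?thesis using s by simp
qed

text \<open>A Galois connection between arrival times and counts. The witness u says that level k is
  reached at all, so that \<open>arr k\<close> is the infimum of a nonempty set.\<close>

lemma arr_le_iff:
  assumes u: "0 \<le> u" "k \<le> n u" and v: "0 \<le> v"
  shows "arr k \<le> v \<longleftrightarrow> k \<le> n v"
proof
  assume "arr k \<le> v"
  then have "n (arr k) \<le> n v" using arr_nonneg[OF u] by (intro n_le)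
  then show "k \<le> n v" using le_n_arr[OF u] by simp
next
  assume "k \<le> n v"
  then show "arr k \<le> v"
    unfolding arr_def using v by (intro cInf_lower) (auto intro!: bdd_belowI[of _ 0])
qed

text \<open>For a nondecreasing right-continuous path starting at 0 this says that all jumps have
  size one.\<close>

definition skip_free :: bool where
  "skip_free \<longleftrightarrow> (\<forall>u\<ge>0. \<forall>k\<le>n u. \<exists>v\<ge>0. n v = k)"

lemma n_arr:
  assumes sf: skip_free and u: "0 \<le> u" "k \<le> n u"
  shows "n (arr k) = k"
proof -
  obtain v where v: "0 \<le> v" "n v = k" using sf u by (auto simp: skip_free_def)
  then have "arr k \<le> v" using arr_le_iff[OF u v(1)] by simp
  then have "n (arr k) \<le> k" using n_le[OF arr_nonneg[OF u]] v by blast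
  then show ?thesis using le_n_arr[OF u] by simp
qed

lemma arr_less:
  assumes sf: skip_free and u: "0 \<le> u" "j \<le> n u" and k: "k < j"
  shows "arr k < arr j"
proof -
  have k': "k \<le> n u" using k u by simp
  have "\<not> arr j \<le> arr k"
    using arr_le_iff[OF u arr_nonneg[OF u(1) k']] n_arr[OF sf u(1) k'] k by simp
  then show ?thesis by simp
qed

text \<open>The value at k = 0 restarts the clock at s; \<open>arr (n s)\<close> would be the last
  jump up to s instead. This is the same convention as in \<open>cfac\<close>, where the first
  factor after s measures time from s.\<close>

definition wait :: "real \<Rightarrow> nat \<Rightarrow> real" where
  "wait s k = (if k = 0 then 0 else arr (n s + k) - s)"

lemma wait_less:
  assumes sf: skip_free and s: "0 \<le> s" "0 \<le> t" and k: "k < n (s + t) - n s"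
  shows "wait s k < wait s (Suc k)"
proof -
  have j: "n s + Suc k \<le> n (s + t)" using k by simp
  have st: "0 \<le> s + t" using s by simp
  show ?thesis
  proof (cases "k = 0")
    case True
    have "\<not> arr (n s + 1) \<le> s" using arr_le_iff[OF st _ s(1), of "n s + 1"] j True by simp
    then show ?thesis using True by (simp add: wait_def)
  next
    case False
    then show ?thesis using arr_less[OF sf st j, of "n s + k"] by (simp add: wait_def)
  qed
qed

lemma wait_le:
  assumes s: "0 \<le> s" "0 \<le> t" and k: "k \<le> n (s + t) - n s"
  shows "wait s k \<le> t"
proof (cases "k = 0")
  case False
  have "arr (n s + k) \<le> s + t" using arr_le_iff[of "s + t" "n s + k" "s + t"] s k False by simp
  then show ?thesis using False by (simp add: wait_def)
qed (use s in \<open>simp add: wait_def\<close>)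

lemma wait_nonneg:
  assumes s: "0 \<le> s" "0 \<le> t" and k: "k \<le> n (s + t) - n s"
  shows "0 \<le> wait s k"
proof (cases "k = 0")
  case False
  have "\<not> arr (n s + k) \<le> s" using arr_le_iff[of "s + t" "n s + k" s] s k False by simp
  then show ?thesis using False by (simp add: wait_def)
qed (simp add: wait_def)

lemma n_wait:
  assumes sf: skip_free and s: "0 \<le> s" "0 \<le> t" and k: "k \<le> n (s + t) - n s"
  shows "n (s + wait s k) = n s + k"
  using n_arr[OF sf, of "s + t" "n s + k"] s k by (cases "k = 0") (auto simp: wait_def)

text \<open>Brings increments of the partial sums into the form that \<open>scheme_tendsto\<close>
  asks for: by \<open>arr_le_iff\<close> the index window between n (s + v) and n (s + u) becomes
  the time window (v, u] for the waiting times.\<close>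

lemma increment_eq:
  assumes s: "0 \<le> s" and uv: "0 \<le> v" "v \<le> u" "u \<le> t"
  shows "(\<Sum>j=1..n (s + u). z j) - (\<Sum>j=1..n (s + v). z j) =
    (\<Sum>k\<in>{1..n (s + t) - n s}. if v < wait s k \<and> wait s k \<le> u then z (n s + k) else (0::real))"
proof -
  let ?K = "n (s + t) - n s"
  have le: "n (s + v) \<le> n (s + u)" "n (s + u) \<le> n (s + t)" "n s \<le> n (s + v)"
    using s uv by (auto intro!: n_le)
  have iff: "v < wait s k \<and> wait s k \<le> u \<longleftrightarrow> n s + k \<in> {n (s + v)<..n (s + u)}" if k: "k \<in> {1..?K}" for k
  proof -
    have "n s + k \<le> n (s + t)" using k le by auto
    then have "arr (n s + k) \<le> s + u \<longleftrightarrow> n s + k \<le> n (s + u)" "arr (n s + k) \<le> s + v \<longleftrightarrow> n s + k \<le> n (s + v)"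
      using s uv by (auto simp: arr_le_iff[of "s + t"])
    then show ?thesis using k by (auto simp: wait_def)
  qed
  have "{1..n (s + u)} = {1..n (s + v)} \<union> {n (s + v)<..n (s + u)}" using le by auto
  then have "(\<Sum>j=1..n (s + u). z j) - (\<Sum>j=1..n (s + v). z j) = (\<Sum>j\<in>{n (s + v)<..n (s + u)}. z j)"
    by (simp add: sum.union_disjoint ivl_disj_int)
  also have "\<dots> = (\<Sum>k\<in>{k\<in>{1..?K}. n s + k \<in> {n (s + v)<..n (s + u)}}. z (n s + k))"
    using le by (intro sum.reindex_bij_witness[of _ "\<lambda>k. n s + k" "\<lambda>j. j - n s"]) auto
  also have "\<dots> = (\<Sum>k\<in>{1..?K}. if n s + k \<in> {n (s + v)<..n (s + u)} then z (n s + k) else 0)"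
    by (subst sum.inter_filter[symmetric]) auto
  also have "\<dots> = (\<Sum>k\<in>{1..?K}. if v < wait s k \<and> wait s k \<le> u then z (n s + k) else 0)"
    using iff by (intro sum.cong) auto
  finally show ?thesis .
qed

lemma solution_map_flow_kick:
  assumes A: "A \<in> carrier_mat q q" and sf: skip_free and s: "0 \<le> s" "0 \<le> t"
  shows "solution_map q A \<alpha>0 \<alpha> t y (\<lambda>u. (\<Sum>j=1..n (s + u). z j) - (\<Sum>j=1..n s. z j)) =
    (\<lambda>i\<in>{..<q}. flow q A (t - wait s (n (s + t) - n s))
       (flow_kick q A \<alpha>0 \<alpha> (wait s) (\<lambda>k. z (n s + k)) y (n (s + t) - n s)) i)"
proof (rule solution_map_eq[OF A s(2)])
  show "wait s (n (s + t) - n s) \<le> t" by (rule wait_le[OF s order_refl])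
  show "wait s 0 = 0" by (simp add: wait_def)
  fix u v :: real assume "0 \<le> v" "v \<le> u" "u \<le> t"
  from increment_eq[OF s(1) this, of z]
  show "(\<Sum>j=1..n (s + u). z j) - (\<Sum>j=1..n s. z j) - ((\<Sum>j=1..n (s + v). z j) - (\<Sum>j=1..n s. z j)) =
      (\<Sum>k = 1..n (s + t) - n s. if v < wait s k \<and> wait s k \<le> u then z (n s + k) else 0)"
    by simp
qed (rule wait_less[OF sf s])

end

section \<open>The state equation along a single path\<close>

locale cogarch_path = counting_path n for n :: "real \<Rightarrow> nat" +
  fixes q :: nat and A :: "real mat" and \<alpha>0 :: real and \<alpha> z :: "nat \<Rightarrow> real" and y :: "real \<Rightarrow> nat \<Rightarrow> real"
  assumes A: "A \<in> carrier_mat q q"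
    and cadlag: "\<And>i. i < q \<Longrightarrow> cadlag (\<lambda>u. y u i)"
    and sde: "\<And>u i. 0 \<le> u \<Longrightarrow> i < q \<Longrightarrow> y u i = y 0 i
           + (LINT v:{0..u}|lborel. (\<Sum>k<q. A $$ (i, k) * leftlim (\<lambda>w. y w k) v))
           + (\<Sum>j = 1..n u. evec q $ i
                 * (\<alpha>0 + (\<Sum>k<q. avec q \<alpha> $ k * leftlim (\<lambda>w. y w k) (arr j))) * (z j)\<^sup>2)"
begin

lemma no_jump:
  assumes ab: "0 \<le> a" "a \<le> b" and n: "n a = n b" and i: "i < q"
  shows "y b i = flow q A (b - a) (y a) i" and "a < b \<Longrightarrow> leftlim (\<lambda>u. y u i) b = y b i"
proof -
  define I where "I i u = (LINT v:{0..u}|lborel. (\<Sum>k<q. A $$ (i, k) * leftlim (\<lambda>w. y w k) v))" for i u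
  have seg: "y u i = y a i + (I i u - I i a)" if u: "a \<le> u" "u \<le> b" and i: "i < q" for u i
  proof -
    have "n a \<le> n u" "n u \<le> n b" using u ab by (auto intro!: n_le)
    then have "n u = n a" using n by simp
    then show ?thesis using sde[OF _ i, of u] sde[OF _ i, of a] u ab by (simp add: I_def)
  qed
  note S = sde_segment[OF A cadlag I_def ab seg _]
  show *: "y b i = flow q A (b - a) (y a) i"
    using S(1)[OF _ _ less_imp_le _ i] seg[OF ab(2) order_refl i] by simp
  show "leftlim (\<lambda>u. y u i) b = y b i" if "a < b"
    using S(2)[OF _ _ less_imp_le _ i that] * by simp
qed

text \<open>The jump term of the equation is evaluated at the left limit at b, and
  \<open>sde_segment\<close> identifies this left limit with the flow started at a.\<close>

lemma single_jump:
  assumes ab: "0 \<le> a" "a < b" and na: "\<And>u. a \<le> u \<Longrightarrow> u < b \<Longrightarrow> n u = n a"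
    and nb: "n b = Suc (n a)" and i: "i < q"
  shows "y b i = kick q \<alpha>0 \<alpha> (z (n b)) (flow q A (b - a) (y a)) i"
proof -
  define I where "I i u = (LINT v:{0..u}|lborel. (\<Sum>k<q. A $$ (i, k) * leftlim (\<lambda>w. y w k) v))" for i u
  have seg: "y u i = y a i + (I i u - I i a)" if u: "a \<le> u" "u < b" and i: "i < q" for u i
    using sde[OF _ i, of u] sde[OF _ i, of a] u ab na[OF u] by (simp add: I_def)
  have b0: "0 \<le> b" using ab by simp
  \<comment> \<open>The equation takes the left limit at the arrival time, which must therefore be
    located at b: before b the count stays at \<open>n a\<close>, one below
    \<open>n b\<close>.\<close>
  have "arr (n b) = b"
  proof -
    have "arr (n b) \<le> b" using arr_le_iff[OF b0 order_refl b0] by simp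
    moreover have "\<not> arr (n b) < b"
    proof
      assume lt: "arr (n b) < b"
      have "n b \<le> n (max a (arr (n b)))"
        using arr_le_iff[OF b0 order_refl, of "max a (arr (n b))"] ab by simp
      also have "\<dots> = n a" using lt ab by (intro na) auto
      finally show False using nb by simp
    qed
    ultimately show ?thesis by simp
  qed
  then have "y b i = y a i + (I i b - I i a) + evec q $ i
                 * (\<alpha>0 + (\<Sum>k<q. avec q \<alpha> $ k * leftlim (\<lambda>w. y w k) b)) * (z (n b))\<^sup>2"
    using sde[OF b0 i] sde[OF ab(1) i] nb by (simp add: I_def)
  moreover note S = sde_segment[OF A cadlag I_def ab(1) less_imp_le[OF ab(2)] seg]
  have "y a i + (I i b - I i a) = flow q A (b - a) (y a) i"
    using S(1)[OF _ _ _ _ i] by simp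
  moreover have "leftlim (\<lambda>w. y w k) b = flow q A (b - a) (y a) k" if "k < q" for k
    using S(2)[OF _ _ _ _ that ab(2)] by simp
  ultimately show ?thesis by (simp add: kick_def)
qed

text \<open>Both sides are compared through \<open>flow_kick\<close>: the true state follows it from
  jump to jump after s and then flows freely to s + t, and \<open>solution_map\<close> recovers the
  same value from the increments of the path.\<close>

theorem solution:
  assumes sf: skip_free and s: "0 \<le> s" "0 \<le> t"
  shows "(\<lambda>i\<in>{..<q}. y (s + t) i) =
    solution_map q A \<alpha>0 \<alpha> t (y s) (\<lambda>u. (\<Sum>j=1..n (s + u). z j) - (\<Sum>j=1..n s. z j))"
proof -
  let ?U = "flow_kick q A \<alpha>0 \<alpha> (wait s) (\<lambda>k. z (n s + k)) (y s)"
  let ?K = "n (s + t) - n s"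
  have U: "\<forall>i<q. y (s + wait s k) i = ?U k i" if "k \<le> ?K" for k
    using that
  proof (induction k)
    case 0
    then show ?case by (simp add: wait_def)
  next
    case (Suc k)
    then have k: "k < ?K" "k \<le> ?K" by auto
    have lt: "wait s k < wait s (Suc k)" by (rule wait_less[OF sf s k(1)])
    have nk: "n (s + wait s k) = n s + k" "n (s + wait s (Suc k)) = n s + Suc k"
      using n_wait[OF sf s] k Suc.prems by auto
    have "n u = n (s + wait s k)" if u: "s + wait s k \<le> u" "u < s + wait s (Suc k)" for u
    proof -
      have u0: "0 \<le> u" using u(1) wait_nonneg[OF s k(2)] s by simp
      have "n (s + wait s k) \<le> n u" using u wait_nonneg[OF s k(2)] s by (intro n_le) auto
      moreover have "\<not> n s + Suc k \<le> n u"
        using arr_le_iff[of "s + t" "n s + Suc k" u] u u0 s Suc.prems by (simp add: wait_def)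
      ultimately show ?thesis using nk by simp
    qed
    then have "y (s + wait s (Suc k)) i = kick q \<alpha>0 \<alpha> (z (n s + Suc k)) (flow q A (wait s (Suc k) - wait s k) (y (s + wait s k))) i"
      if "i < q" for i
      using single_jump[of "s + wait s k" "s + wait s (Suc k)" i] wait_nonneg[OF s k(2)] s lt nk that
      by simp
    then show ?case using Suc.IH k by (auto intro!: kick_cong flow_cong)
  qed
  have "n s \<le> n (s + t)" using s by (intro n_le) auto
  then have "y (s + t) i = flow q A (t - wait s ?K) (y (s + wait s ?K)) i" if "i < q" for i
    using no_jump(1)[of "s + wait s ?K" "s + t" i] wait_nonneg[OF s, of ?K] wait_le[OF s, of ?K]
      n_wait[OF sf s, of ?K] s that by simp
  then show ?thesis
    unfolding solution_map_flow_kick[OF A sf s] using U by (auto simp: fun_eq_iff restrict_def intro!: flow_cong)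
qed

end

section \<open>The affine map given by J and K\<close>

lemma carrier_Bmat [simp]: "Bmat q \<beta> \<in> carrier_mat q q"
  by (simp add: Bmat_def)

lemma mexp_mult_vec:
  assumes "v \<in> carrier_vec q" "i < q"
  shows "(mexp q (t \<cdot>\<^sub>m A) *\<^sub>v v) $ i = flow q A t (\<lambda>k. v $ k) i"
  using assms by (subst mult_mat_vec_entry[of _ q]) (auto simp: flow_def)

text \<open>The partial products and sums behind J and K satisfy, by induction on the number of
  jumps, the recursion of \<open>flow_kick\<close>: the factor \<open>cfac\<close> is the linear
  part of flow and kick, the added multiple of e its constant part.\<close>

lemma (in counting_path) solution_map_affmap:
  assumes sf: skip_free and t: "0 \<le> t"
  shows "solution_map q (Bmat q \<beta>) \<alpha>0 \<alpha> t y (\<lambda>u. \<Sum>j=1..n u. z j) =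
    affmap q (Jst q \<alpha> \<beta> n arr z 0 t) (Kst q \<alpha>0 \<alpha> \<beta> n arr z 0 t) y"
proof -
  let ?B = "Bmat q \<beta>"
  let ?J = "pJ q \<alpha> \<beta> 0 0 arr z" and ?K = "pK q \<alpha>0 \<alpha> \<beta> 0 0 arr z"
  let ?U = "flow_kick q ?B \<alpha>0 \<alpha> (wait 0) z y"
  have wait: "wait 0 k = (if k = 0 then 0 else arr k)" for k by (simp add: wait_def n0)
  define c where "c k = cfac q \<alpha> \<beta> 0 0 arr z k" for k
  define EZ where "EZ k = 1\<^sub>m q + ((z k)\<^sup>2 \<cdot>\<^sub>m EAmat q \<alpha>)" for k
  have EA: "EAmat q \<alpha> \<in> carrier_mat q q" by (simp add: EAmat_def)
  have EZ: "EZ k \<in> carrier_mat q q" for k using EA by (simp add: EZ_def)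
  have c_eq: "c (Suc k) = EZ (Suc k) * mexp q ((wait 0 (Suc k) - wait 0 k) \<cdot>\<^sub>m ?B)" for k
    by (simp add: c_def cfac_def EZ_def wait)
  have c: "c k \<in> carrier_mat q q" for k
    unfolding c_def cfac_def EZ_def[symmetric] by (intro mult_carrier_mat[of _ q q] EZ mexp_carrier)
  have J: "?J k \<in> carrier_mat q q" for k
    by (induction k) (auto simp: c_def[symmetric] intro!: mult_carrier_mat[of _ q q] c)
  have e: "evec q \<in> carrier_vec q" by (simp add: evec_def)
  have K: "?K k \<in> carrier_vec q" for k
    by (induction k) (use e in \<open>auto simp: c_def[symmetric] intro!: add_carrier_vec mult_mat_vec_carrier[of _ q q] c\<close>)
  have y: "vec q y \<in> carrier_vec q" by simp
  have EZv: "(EZ k *\<^sub>v v) $ i = v $ i + evec q $ i * (\<Sum>k<q. avec q \<alpha> $ k * v $ k) * (z k)\<^sup>2"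
    if "v \<in> carrier_vec q" "i < q" for v i k
  proof -
    have "(EZ k *\<^sub>v v) $ i = (\<Sum>j<q. ((if i = j then 1 else 0) + (z k)\<^sup>2 * (evec q $ i * avec q \<alpha> $ j)) * v $ j)"
      using that EA by (subst mult_mat_vec_entry[OF EZ that]) (auto simp: EZ_def EAmat_def intro!: sum.cong)
    also have "\<dots> = (\<Sum>j<q. if i = j then v $ j else 0) + (\<Sum>j<q. evec q $ i * (avec q \<alpha> $ j * v $ j) * (z k)\<^sup>2)"
      unfolding sum.distrib[symmetric] by (intro sum.cong) (auto simp: algebra_simps)
    finally show ?thesis using that by (simp add: sum_distrib_left sum_distrib_right)
  qed
  have U: "\<forall>i<q. (?J k *\<^sub>v vec q y + ?K k) $ i = ?U k i" for k
  proof (induction k)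
    case 0
    then show ?case by simp
  next
    case (Suc k)
    define v where "v = ?J k *\<^sub>v vec q y + ?K k"
    have v: "v \<in> carrier_vec q" unfolding v_def by (intro add_carrier_vec mult_mat_vec_carrier[OF J y] K)
    let ?E = "mexp q ((wait 0 (Suc k) - wait 0 k) \<cdot>\<^sub>m ?B)"
    have "?J (Suc k) *\<^sub>v vec q y + ?K (Suc k)
        = c (Suc k) *\<^sub>v v + (\<alpha>0 * (z (Suc k))\<^sup>2) \<cdot>\<^sub>v evec q"
      using c[of "Suc k"] J[of k] K[of k] e y
      by (simp add: c_def[symmetric] v_def mult_add_distrib_mat_vec[of _ q q] assoc_mult_mat_vec[of _ q q _ q]
            assoc_add_vec[of _ q])
    also have "c (Suc k) *\<^sub>v v = EZ (Suc k) *\<^sub>v (?E *\<^sub>v v)"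
      unfolding c_eq using EZ v by (intro assoc_mult_mat_vec[of _ q q _ q]) auto
    finally have eq: "?J (Suc k) *\<^sub>v vec q y + ?K (Suc k)
        = EZ (Suc k) *\<^sub>v (?E *\<^sub>v v) + (\<alpha>0 * (z (Suc k))\<^sup>2) \<cdot>\<^sub>v evec q" .
    have Ev: "?E *\<^sub>v v \<in> carrier_vec q" using v by (intro mult_mat_vec_carrier[of _ q q]) auto
    have Eu: "(?E *\<^sub>v v) $ i = flow q ?B (wait 0 (Suc k) - wait 0 k) (?U k) i" if "i < q" for i
      unfolding mexp_mult_vec[OF v that] using Suc.IH by (intro flow_cong) (auto simp: v_def)
    show ?case
    proof (intro allI impI)
      fix i assume i: "i < q"
      have "(?J (Suc k) *\<^sub>v vec q y + ?K (Suc k)) $ i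
         = (EZ (Suc k) *\<^sub>v (?E *\<^sub>v v)) $ i + \<alpha>0 * (z (Suc k))\<^sup>2 * evec q $ i"
        unfolding eq using i e by simp
      also have "\<dots> = ?U (Suc k) i"
        unfolding EZv[OF Ev i] using i by (simp add: Eu kick_def algebra_simps)
      finally show "(?J (Suc k) *\<^sub>v vec q y + ?K (Suc k)) $ i = ?U (Suc k) i" .
    qed
  qed
  let ?L = "mexp q ((t - wait 0 (n t)) \<cdot>\<^sub>m ?B)"
  \<comment> \<open>Without a jump up to t both sides are the starting time 0.\<close>
  have last: "lastjump n arr 0 t = wait 0 (n t)" by (simp add: lastjump_def wait n0)
  have J': "Jst q \<alpha> \<beta> n arr z 0 t = ?L * ?J (n t)" by (simp add: Jst_def last n0)
  have K': "Kst q \<alpha>0 \<alpha> \<beta> n arr z 0 t = ?L *\<^sub>v ?K (n t)" by (simp add: Kst_def last n0)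
  have v: "?J (n t) *\<^sub>v vec q y + ?K (n t) \<in> carrier_vec q" by (intro add_carrier_vec mult_mat_vec_carrier[OF J y] K)
  have "?L * ?J (n t) *\<^sub>v vec q y + ?L *\<^sub>v ?K (n t) = ?L *\<^sub>v (?J (n t) *\<^sub>v vec q y + ?K (n t))"
    using J[of "n t"] K[of "n t"] y
    by (simp add: mult_add_distrib_mat_vec[of _ q q] assoc_mult_mat_vec[of _ q q _ q])
  then have "affmap q (Jst q \<alpha> \<beta> n arr z 0 t) (Kst q \<alpha>0 \<alpha> \<beta> n arr z 0 t) y
      = (\<lambda>i\<in>{..<q}. flow q ?B (t - wait 0 (n t)) (?U (n t)) i)"
    using U by (auto simp: affmap_def J' K' fun_eq_iff restrict_def mexp_mult_vec[OF v] intro!: flow_cong)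
  then show ?thesis
    using solution_map_flow_kick[OF carrier_Bmat sf order_refl t, of q \<beta> \<alpha>0 \<alpha> y z] by (simp add: n0)
qed

section \<open>The marked Poisson process\<close>

lemma left_sequence:
  fixes s :: real
  assumes s: "0 < s"
  shows "0 \<le> s - s / real (Suc m)" "s - s / real (Suc m) < s" "(\<lambda>m. s - s / real (Suc m)) \<longlonglongrightarrow> s"
proof -
  have "s / real (Suc m) \<le> s / 1" using s by (intro divide_left_mono) auto
  then show "0 \<le> s - s / real (Suc m)" by simp
  show "s - s / real (Suc m) < s" using s by simp
  have "(\<lambda>m. s - s / real (Suc m)) \<longlonglongrightarrow> s - 0"
    using tendsto_mult[OF tendsto_const[of s] LIMSEQ_inverse_real_of_nat]
    by (intro tendsto_diff tendsto_const) (simp add: divide_inverse)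
  then show "(\<lambda>m. s - s / real (Suc m)) \<longlonglongrightarrow> s" by simp
qed

locale marked_poisson = prob_space M for M :: "'a measure" +
  fixes \<tau> :: real and l :: nat and tp :: "nat \<Rightarrow> real" and lam :: "real \<Rightarrow> real"
    and N :: "real \<Rightarrow> 'a \<Rightarrow> nat" and F :: "nat \<Rightarrow> real measure" and Z :: "nat \<Rightarrow> nat \<Rightarrow> 'a \<Rightarrow> real"
  assumes tau_pos: "\<tau> > 0" and l_pos: "l \<ge> 1"
    and tp0: "tp 0 = 0" and tp_mono: "strict_mono tp" and tp_lim: "filterlim tp at_top sequentially"
    and tp_per: "\<forall>j\<ge>1. tp (j + l) - tp (j + l - 1) = tp j - tp (j - 1)"
    and tau_def: "\<tau> = (\<Sum>j = 1..l. tp j - tp (j - 1))"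
    and lam_nonneg: "\<forall>s\<ge>0. 0 \<le> lam s"
    and lam_locint: "\<forall>a b. 0 \<le> a \<longrightarrow> set_integrable lborel {a..b} lam"
    and lam_per: "\<forall>s\<ge>0. lam (s + \<tau>) = lam s"
    and N_meas: "\<forall>u\<ge>0. N u \<in> measurable M (count_space UNIV)"
    and N_paths: "\<forall>\<omega>\<in>space M. N 0 \<omega> = 0 \<and> mono_on {0..} (\<lambda>u. N u \<omega>)
                    \<and> (\<forall>u\<ge>0. \<exists>e>0. \<forall>v\<in>{u..u+e}. N v \<omega> = N u \<omega>)"
    and N_poisson: "\<forall>s u k. 0 \<le> s \<and> s < u \<longrightarrow>
         measure M {\<omega>\<in>space M. N u \<omega> - N s \<omega> = k}
           = (Lam lam u - Lam lam s) ^ k / fact k * exp (- (Lam lam u - Lam lam s))"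
    and N_indep_incr: "\<forall>m (u :: nat \<Rightarrow> real). 0 \<le> u 0 \<and> mono u \<longrightarrow>
         prob_space.indep_vars M (\<lambda>_. count_space UNIV) (\<lambda>i \<omega>. N (u (Suc i)) \<omega> - N (u i) \<omega>) {..<m}"
    and Z_distr: "\<forall>n\<ge>1. \<forall>j\<in>{1..l}. distr M borel (Z n j) = F j"
    and Z_indep: "prob_space.indep_vars M (\<lambda>_. borel) (\<lambda>(n, j). Z n j) ({1..} \<times> {1..l})"
    and ZN_indep: "prob_space.indep_set M
         (sets (vimage_algebra (space M) (\<lambda>\<omega>. \<lambda>nj\<in>{1..} \<times> {1..l}. Z (fst nj) (snd nj) \<omega>)
                 (PiM ({1..} \<times> {1..l}) (\<lambda>_. borel))))
         (sets (vimage_algebra (space M) (\<lambda>\<omega>. \<lambda>u\<in>{0..}. N u \<omega>) (PiM {0..} (\<lambda>_. count_space UNIV))))"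
begin

lemma N_measurable [measurable]: "0 \<le> u \<Longrightarrow> N u \<in> measurable M (count_space UNIV)"
  using N_meas by auto

lemma N_mono: "\<omega> \<in> space M \<Longrightarrow> 0 \<le> u \<Longrightarrow> u \<le> v \<Longrightarrow> N u \<omega> \<le> N v \<omega>"
  using N_paths by (auto simp: mono_on_def)

lemma N_0: "\<omega> \<in> space M \<Longrightarrow> N 0 \<omega> = 0"
  using N_paths by auto

lemma lam_set_integrable: "0 \<le> a \<Longrightarrow> set_integrable lborel {a..b} lam"
  using lam_locint by auto

lemma Lam_eq_integral: "Lam lam t = integral {0..t} lam" and lam_integrable: "0 \<le> a \<Longrightarrow> lam integrable_on {a..t}"
  using set_borel_integral_eq_integral[OF lam_set_integrable[of 0 t]]
    set_borel_integral_eq_integral[OF lam_set_integrable[of a t]] by (auto simp: Lam_def)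

lemma Lam_diff:
  assumes "0 \<le> a" "a \<le> b"
  shows "Lam lam b - Lam lam a = integral {a..b} lam"
proof -
  have "integral {0..a} lam + integral {a..b} lam = integral {0..b} lam"
    by (rule Henstock_Kurzweil_Integration.integral_combine[OF assms lam_integrable[OF order_refl]])
  then show ?thesis unfolding Lam_eq_integral by linarith
qed

lemma Lam_mono: "0 \<le> a \<Longrightarrow> a \<le> b \<Longrightarrow> Lam lam a \<le> Lam lam b"
  using Lam_diff[of a b] Henstock_Kurzweil_Integration.integral_nonneg[OF lam_integrable[of a b]] lam_nonneg by auto

lemma Lam_continuous: "continuous_on {0..t} (Lam lam)"
proof -
  have "continuous_on {0..t} (\<lambda>u. integral {0..u} lam)"
    by (intro indefinite_integral_continuous_1 lam_integrable) simp
  then show ?thesis by (simp add: Lam_eq_integral[abs_def])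
qed

lemma Lam_shift:
  assumes "0 \<le> a" "a \<le> b"
  shows "Lam lam (b + \<tau>) - Lam lam (a + \<tau>) = Lam lam b - Lam lam a"
proof -
  have "(lam has_integral integral {a + \<tau>..b + \<tau>} lam) {a + \<tau>..b + \<tau>}"
    using assms tau_pos by (intro integrable_integral lam_integrable) auto
  then have "((lam \<circ> (+) \<tau>) has_integral integral {a + \<tau>..b + \<tau>} lam) {a..b}"
    using has_integral_shift_cbox_iff[of lam \<tau> _ a b] by (simp only: cbox_interval)
  then have "(lam has_integral integral {a + \<tau>..b + \<tau>} lam) {a..b}"
  proof (rule has_integral_eq[rotated])
    fix x assume "x \<in> {a..b}"
    then have "0 \<le> x" using assms by simp
    then show "(lam \<circ> (+) \<tau>) x = lam x" using lam_per by (metis add.commute comp_apply)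
  qed
  then have "integral {a..b} lam = integral {a + \<tau>..b + \<tau>} lam" by (rule integral_unique)
  then show ?thesis using assms tau_pos by (simp add: Lam_diff)
qed

section \<open>Null events of the counting process\<close>

lemma N_incr_measurable [measurable]:
  "0 \<le> s \<Longrightarrow> 0 \<le> u \<Longrightarrow> (\<lambda>\<omega>. N u \<omega> - N s \<omega>) \<in> measurable M (count_space UNIV)"
  by measurable

lemma N_incr_event:
  assumes "0 \<le> s" "0 \<le> u" shows "{\<omega>\<in>space M. Q (N u \<omega> - N s \<omega>)} \<in> sets M"
  using measurable_sets[OF N_incr_measurable[OF assms], of "Collect Q"] by (simp add: vimage_def Int_def conj_commute)

text \<open>A jump at s forces an increment of N over every interval from s - s / (m + 1) to s. The
  probability of that is 1 - exp of minus an increment of \<open>Lam\<close>, which tends to 0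
  because \<open>Lam\<close> is continuous.\<close>

lemma no_jump_at:
  assumes s: "0 < s"
  shows "AE \<omega> in M. \<exists>v. 0 \<le> v \<and> v < s \<and> N v \<omega> = N s \<omega>"
proof -
  define v where "v m = s - s / real (Suc m)" for m
  have v: "0 \<le> v m" "v m < s" for m
    using left_sequence(1,2)[OF s, of m] by (simp_all add: v_def)
  let ?J = "\<lambda>m. {\<omega>\<in>space M. N s \<omega> - N (v m) \<omega> \<noteq> 0}" and ?C = "\<lambda>m. {\<omega>\<in>space M. N s \<omega> - N (v m) \<omega> = 0}"
  define A where "A = (\<Inter>m. (?J m))"
  have meas: "(?J m) \<in> sets M" "(?C m) \<in> sets M" for m
    using v[of m] s N_incr_event[of "v m" s "\<lambda>k. k \<noteq> 0"] N_incr_event[of "v m" s "\<lambda>k. k = 0"] by auto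
  have A: "A \<in> sets M" unfolding A_def using meas by (intro sets.countable_INT) auto
  have le: "prob A \<le> 1 - exp (- (Lam lam s - Lam lam (v m)))" for m
  proof -
    have "(?J m) = space M - (?C m)" by auto
    then have "prob (?J m) = 1 - exp (- (Lam lam s - Lam lam (v m)))"
      using N_poisson[rule_format, of "v m" s 0] v[of m] prob_compl[OF meas(2)[of m]] by simp
    moreover have "prob A \<le> prob (?J m)"
      using meas by (intro finite_measure_mono) (auto simp: A_def)
    ultimately show ?thesis by simp
  qed
  have "v \<longlonglongrightarrow> s" using left_sequence(3)[OF s] by (simp only: v_def[abs_def])
  moreover have "(Lam lam \<longlongrightarrow> Lam lam s) (at s within {0..s})"
    using Lam_continuous[of s] s by (auto simp: continuous_on)
  ultimately have "(\<lambda>m. Lam lam (v m)) \<longlonglongrightarrow> Lam lam s"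
    using v by (intro filterlim_compose[of "Lam lam" _ "at s within {0..s}" v])
      (auto simp: filterlim_at less_imp_le less_imp_neq intro!: always_eventually)
  then have "(\<lambda>m. 1 - exp (- (Lam lam s - Lam lam (v m)))) \<longlonglongrightarrow> 1 - exp (- (Lam lam s - Lam lam s))"
    by (intro tendsto_intros)
  then have "prob A \<le> 1 - exp (- (Lam lam s - Lam lam s))"
    by (rule LIMSEQ_le_const) (use le in auto)
  then have "prob A = 0" by (simp add: measure_le_0_iff)
  then have "AE \<omega> in M. \<omega> \<notin> A" using A by (simp add: prob_eq_0)
  then show ?thesis
  proof (rule AE_mp, intro AE_I2 impI)
    fix \<omega> assume \<omega>: "\<omega> \<in> space M" "\<omega> \<notin> A"
    then obtain m where "N s \<omega> - N (v m) \<omega> = 0" by (auto simp: A_def)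
    moreover have "N (v m) \<omega> \<le> N s \<omega>" using v[of m] \<omega> by (intro N_mono) auto
    ultimately show "\<exists>v. 0 \<le> v \<and> v < s \<and> N v \<omega> = N s \<omega>" using v[of m] by (intro exI[of _ "v m"]) auto
  qed
qed

text \<open>For a Poisson variable of mean x the probability is 1 - (1 + x) e^(-x), and e^(-x) >= 1
  - x gives x^2. What counts is the order: a quadratic bound vanishes when summed over a fine
  grid.\<close>

lemma double_jump_prob:
  assumes "0 \<le> s" "s < u"
  shows "prob {\<omega>\<in>space M. 2 \<le> N u \<omega> - N s \<omega>} \<le> (Lam lam u - Lam lam s)\<^sup>2"
proof -
  define x where "x = Lam lam u - Lam lam s"
  have x: "0 \<le> x" using Lam_mono[of s u] assms by (simp add: x_def)
  have m: "{\<omega>\<in>space M. N u \<omega> - N s \<omega> = k} \<in> sets M" for k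
    using assms by (intro N_incr_event) auto
  let ?E = "\<lambda>k. {\<omega>\<in>space M. N u \<omega> - N s \<omega> = k}"
  have two: "2 \<le> k \<longleftrightarrow> \<not> (k = 0 \<or> k = 1)" for k :: nat by arith
  have "{\<omega>\<in>space M. 2 \<le> N u \<omega> - N s \<omega>} = space M - (?E 0 \<union> ?E 1)"
    unfolding two by blast
  then have "prob {\<omega>\<in>space M. 2 \<le> N u \<omega> - N s \<omega>} = 1 - prob (?E 0 \<union> ?E 1)"
    using prob_compl[OF sets.Un[OF m[of 0] m[of 1]]] by simp
  also have "prob (?E 0 \<union> ?E 1) = prob (?E 0) + prob (?E 1)"
    by (rule finite_measure_Union[OF m m]) auto
  also have "\<dots> = exp (- x) * (1 + x)"
    using N_poisson[rule_format, of s u 0] N_poisson[rule_format, of s u 1] assms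
    by (simp add: x_def algebra_simps)
  also have "1 - exp (- x) * (1 + x) \<le> x\<^sup>2"
  proof -
    have "(1 - x) * (1 + x) \<le> exp (- x) * (1 + x)"
      using exp_ge_add_one_self[of "- x"] x by (intro mult_right_mono) auto
    then show ?thesis by (simp add: algebra_simps power2_eq_square)
  qed
  finally show ?thesis by (simp add: x_def)
qed

text \<open>The probability that some cell of a grid on [0, T] has two jumps is at most the sum of
  squared increments of \<open>Lam\<close>, hence at most their maximum times
  \<open>Lam lam T\<close>, which uniform continuity makes small. If no cell has two jumps, every
  level is taken at a grid point.\<close>

lemma skip_free_upto:
  assumes T: "0 < T"
  shows "AE \<omega> in M. \<forall>u\<in>{0..T}. \<forall>k\<le>N u \<omega>. \<exists>v\<ge>0. N v \<omega> = k"
proof -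
  define g where "g m i = real i * (T / real (Suc m))" for m i
  let ?D = "\<lambda>m i. {\<omega>\<in>space M. 2 \<le> N (g m (Suc i)) \<omega> - N (g m i) \<omega>}"
  let ?L = "\<lambda>m i. Lam lam (g m (Suc i)) - Lam lam (g m i)"
  define A where "A m = (\<Union>i\<in>{..m}. (?D m i))" for m
  have g: "0 \<le> g m i" "g m i < g m (Suc i)" "g m (Suc i) - g m i = T / real (Suc m)" for m i
    using T by (auto simp: g_def field_simps simp del: of_nat_Suc) (auto simp: field_simps)
  have gT: "g m i \<le> T" if "i \<le> Suc m" for m i
  proof -
    have "g m i \<le> real (Suc m) * (T / real (Suc m))"
      unfolding g_def using that T by (intro mult_right_mono) auto
    then show ?thesis by simp
  qed
  have meas: "(?D m i) \<in> sets M" for m i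
    using g(1) by (intro N_incr_event) auto
  have Am: "A m \<in> sets M" for m unfolding A_def using meas by auto
  have small: "\<exists>m. prob (A m) \<le> e * Lam lam T" if e: "0 < e" for e
  proof -
    have "uniformly_continuous_on {0..T} (Lam lam)"
      using Lam_continuous by (intro compact_uniformly_continuous) auto
    then obtain d where d: "0 < d" "\<And>x y. x \<in> {0..T} \<Longrightarrow> y \<in> {0..T} \<Longrightarrow> dist y x < d \<Longrightarrow> dist (Lam lam y) (Lam lam x) < e"
      unfolding uniformly_continuous_on_def using e by meson
    obtain m where m: "T / real (Suc m) < d"
    proof -
      obtain m where "T / d < real m" using reals_Archimedean2 by blast
      then have "T / real (Suc m) < d" using d(1) T by (simp add: field_simps)
      then show thesis by (rule that)
    qed
    have ge: "0 \<le> (?L m i)" for i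
      using Lam_mono[of "g m i" "g m (Suc i)"] g[of m i] by simp
    have "prob (A m) \<le> (\<Sum>i\<le>m. prob (?D m i))"
      unfolding A_def using meas by (intro finite_measure_subadditive_finite) auto
    also have "\<dots> \<le> (\<Sum>i\<le>m. ((?L m i))\<^sup>2)"
      using g by (intro sum_mono double_jump_prob) auto
    also have "\<dots> \<le> (\<Sum>i\<le>m. e * ((?L m i)))"
    proof (intro sum_mono)
      fix i assume i: "i \<in> {..m}"
      have "dist (Lam lam (g m (Suc i))) (Lam lam (g m i)) < e"
        using i g[of m i] g(1)[of m "Suc i"] gT[of i m] gT[of "Suc i" m] m by (intro d(2)) (auto simp: dist_real_def)
      then have "(?L m i) \<le> e" by (auto simp: dist_real_def)
      then show "((?L m i))\<^sup>2 \<le> e * ((?L m i))"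
        unfolding power2_eq_square using ge by (rule mult_right_mono)
    qed
    also have "\<dots> = e * (Lam lam (g m (Suc m)) - Lam lam (g m 0))"
      using sum_lessThan_telescope[of "\<lambda>i. Lam lam (g m i)" "Suc m"]
      by (simp add: sum_distrib_left[symmetric] lessThan_Suc_atMost)
    also have "\<dots> = e * Lam lam T" by (simp add: g_def Lam_eq_integral)
    finally show ?thesis by blast
  qed
  have "prob (\<Inter>m. A m) \<le> 0"
  proof (rule field_le_epsilon)
    fix e :: real assume e: "0 < e"
    have L: "0 \<le> Lam lam T" using Lam_mono[of 0 T] T by (simp add: Lam_eq_integral)
    \<comment> \<open>The summand 1 keeps the denominator positive when \<open>Lam lam T\<close> is
      0.\<close>
    obtain m where "prob (A m) \<le> e / (Lam lam T + 1) * Lam lam T"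
      using small[of "e / (Lam lam T + 1)"] e L by auto
    also have "\<dots> \<le> e" using e L by (simp add: field_simps)
    finally have "prob (A m) \<le> e" .
    moreover have "prob (\<Inter>m. A m) \<le> prob (A m)" using Am by (intro finite_measure_mono) auto
    ultimately show "prob (\<Inter>m. A m) \<le> 0 + e" by simp
  qed
  then have "prob (\<Inter>m. A m) = 0" by (simp add: measure_le_0_iff)
  moreover have "(\<Inter>m. A m) \<in> sets M" using Am by (intro sets.countable_INT) auto
  ultimately have "AE \<omega> in M. \<omega> \<notin> (\<Inter>m. A m)" by (simp add: prob_eq_0)
  then show ?thesis
  proof (rule AE_mp, intro AE_I2 impI ballI allI)
    fix \<omega> u k assume \<omega>: "\<omega> \<in> space M" "\<omega> \<notin> (\<Inter>m. A m)" and u: "u \<in> {0..T}" and k: "k \<le> N u \<omega>"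
    then obtain m where m: "\<omega> \<notin> A m" by auto
    then have unit: "N (g m (Suc i)) \<omega> \<le> Suc (N (g m i) \<omega>)" if "i \<le> m" for i
    proof -
      have "\<not> 2 \<le> N (g m (Suc i)) \<omega> - N (g m i) \<omega>"
        using m that \<omega>(1) unfolding A_def by blast
      then show ?thesis by arith
    qed
    have "N u \<omega> \<le> N (g m (Suc m)) \<omega>" using u \<omega> by (intro N_mono) (auto simp: g_def)
    then have ex: "k \<le> N (g m (Suc m)) \<omega>" using k by simp
    \<comment> \<open>At the first grid point where level k is reached the count is exactly k, since
      it was below k one step earlier and rises by at most one.\<close>
    define i where "i = (LEAST i. k \<le> N (g m i) \<omega>)"
    have i: "k \<le> N (g m i) \<omega>" "i \<le> Suc m"
      unfolding i_def using ex by (auto intro: LeastI Least_le)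
    have "N (g m i) \<omega> = k"
    proof (cases i)
      case 0
      then show ?thesis using i N_0[OF \<omega>(1)] by (simp add: g_def)
    next
      case (Suc j)
      then have "\<not> k \<le> N (g m j) \<omega>" using not_less_Least[of j "\<lambda>i. k \<le> N (g m i) \<omega>"] by (simp add: i_def)
      then show ?thesis using unit[of j] i Suc by simp
    qed
    then show "\<exists>v\<ge>0. N v \<omega> = k" using g(1) by blast
  qed
qed

lemma skip_free_AE: "AE \<omega> in M. \<forall>u\<ge>0. \<forall>k\<le>N u \<omega>. \<exists>v\<ge>0. N v \<omega> = k"
proof -
  have "AE \<omega> in M. \<forall>m. \<forall>u\<in>{0..real (Suc m)}. \<forall>k\<le>N u \<omega>. \<exists>v\<ge>0. N v \<omega> = k"
    unfolding AE_all_countable by (intro allI skip_free_upto) simp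
  then show ?thesis
  proof (rule AE_mp, intro AE_I2 impI allI)
    fix \<omega> u k assume H: "\<forall>m. \<forall>u\<in>{0..real (Suc m)}. \<forall>k\<le>N u \<omega>. \<exists>v\<ge>0. N v \<omega> = k"
      and u: "0 \<le> u" and k: "k \<le> N u \<omega>"
    obtain m where "u \<le> real m" using real_arch_simple by blast
    then have "u \<in> {0..real (Suc m)}" using u by simp
    then show "\<exists>v\<ge>0. N v \<omega> = k" using H k by blast
  qed
qed

end

section \<open>Conditioning on a countably valued variable\<close>

lemma (in prob_space) nn_integral_countable_valued:
  fixes \<kappa> :: "'a \<Rightarrow> 'c::countable" and G :: "'c \<Rightarrow> ennreal"
  assumes \<kappa>: "\<And>k. {\<omega>\<in>space M. \<kappa> \<omega> = k} \<in> sets M"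
  shows "(\<integral>\<^sup>+\<omega>. G (\<kappa> \<omega>) \<partial>M) = (\<integral>\<^sup>+k. G k * emeasure M {\<omega>\<in>space M. \<kappa> \<omega> = k} \<partial>count_space UNIV)"
proof -
  have "(\<integral>\<^sup>+k. G k * emeasure M {\<omega>\<in>space M. \<kappa> \<omega> = k} \<partial>count_space UNIV)
      = (\<integral>\<^sup>+k. \<integral>\<^sup>+\<omega>. G k * indicator {\<omega>\<in>space M. \<kappa> \<omega> = k} \<omega> \<partial>M \<partial>count_space UNIV)"
    using \<kappa> by (simp add: nn_integral_cmult_indicator)
  also have "\<dots> = (\<integral>\<^sup>+\<omega>. \<integral>\<^sup>+k. G k * indicator {\<omega>\<in>space M. \<kappa> \<omega> = k} \<omega> \<partial>count_space UNIV \<partial>M)"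
    using \<kappa> by (intro nn_integral_count_space_nn_integral[symmetric]) auto
  also have "\<dots> = (\<integral>\<^sup>+\<omega>. G (\<kappa> \<omega>) \<partial>M)"
  proof (rule nn_integral_cong)
    fix \<omega> assume \<omega>: "\<omega> \<in> space M"
    have "(\<integral>\<^sup>+k. G k * indicator {\<omega>\<in>space M. \<kappa> \<omega> = k} \<omega> \<partial>count_space UNIV)
        = (\<integral>\<^sup>+k. G (\<kappa> \<omega>) * indicator {\<kappa> \<omega>} k \<partial>count_space UNIV)"
      using \<omega> by (intro nn_integral_cong) (auto simp: indicator_def)
    then show "(\<integral>\<^sup>+k. G k * indicator {\<omega>\<in>space M. \<kappa> \<omega> = k} \<omega> \<partial>count_space UNIV) = G (\<kappa> \<omega>)"
      by (simp add: nn_integral_cmult_indicator)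
  qed
  finally show ?thesis by simp
qed

text \<open>The law of total probability, with G k the conditional probability of Q k given that the
  variable equals k. It freezes random index bounds to deterministic ones.\<close>

lemma (in prob_space) emeasure_countable_mixture:
  fixes \<kappa> :: "'a \<Rightarrow> 'c::countable" and G :: "'c \<Rightarrow> ennreal"
  assumes \<kappa>: "\<And>k. {\<omega>\<in>space M. \<kappa> \<omega> = k} \<in> sets M"
    and Q: "\<And>k. {\<omega>\<in>space M. \<kappa> \<omega> = k \<and> Q k \<omega>} \<in> sets M"
    and eq: "\<And>k. emeasure M {\<omega>\<in>space M. \<kappa> \<omega> = k \<and> Q k \<omega>} = G k * emeasure M {\<omega>\<in>space M. \<kappa> \<omega> = k}"
  shows "emeasure M {\<omega>\<in>space M. Q (\<kappa> \<omega>) \<omega>} = (\<integral>\<^sup>+\<omega>. G (\<kappa> \<omega>) \<partial>M)"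
proof -
  have "{\<omega>\<in>space M. Q (\<kappa> \<omega>) \<omega>} = (\<Union>k. {\<omega>\<in>space M. \<kappa> \<omega> = k \<and> Q k \<omega>})" by auto
  moreover have "emeasure M (\<Union>k. {\<omega>\<in>space M. \<kappa> \<omega> = k \<and> Q k \<omega>})
      = (\<integral>\<^sup>+k. emeasure M {\<omega>\<in>space M. \<kappa> \<omega> = k \<and> Q k \<omega>} \<partial>count_space UNIV)"
    by (rule emeasure_UN_countable) (use Q in \<open>auto simp: disjoint_family_on_def\<close>)
  ultimately show ?thesis by (simp only: eq nn_integral_countable_valued[OF \<kappa>])
qed

section \<open>Partition classes and sums of marks\<close>

context marked_poisson
begin

lemma tp_l: "tp l = \<tau>"
proof -
  have "(\<Sum>j = 1..m. tp j - tp (j - 1)) = tp m - tp 0" for m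
    by (induction m) auto
  then show ?thesis by (simp add: tau_def tp0)
qed

lemma tp_shift: "tp (n + l) = tp n + \<tau>"
proof (induction n)
  case 0
  then show ?case by (simp add: tp_l tp0)
next
  case (Suc n)
  then show ?case using tp_per[rule_format, of "Suc n"] by simp
qed

lemma tp_le: "m \<le> n \<Longrightarrow> tp m \<le> tp n"
  using tp_mono by (simp add: strict_mono_less_eq)

text \<open>Blocks are numbered from 1 while partition points start at 0: the interval from
  \<open>tp n\<close> to \<open>tp (Suc n)\<close> is block n + 1, so its class is n mod l plus
  1.\<close>

lemma jidx_eq:
  assumes s: "tp n \<le> s" "s < tp (Suc n)"
  shows "jidx tp l s = Suc (n mod l)"
  unfolding jidx_def
proof (rule the_equality)
  have "s \<in> blk tp (Suc (n mod l) + (n div l) * l)"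
    using s by (simp add: blk_def)
  moreover have "n mod l < l" using l_pos by simp
  ultimately show "Suc (n mod l) \<in> {1..l} \<and> s \<in> Dset tp l (Suc (n mod l))"
    unfolding Dset_def by (intro conjI UN_I[OF UNIV_I, of _ _ "n div l"]) auto
next
  fix j assume j: "j \<in> {1..l} \<and> s \<in> Dset tp l j"
  then obtain k where k: "tp (j + k * l - 1) \<le> s" "s < tp (j + k * l)"
    by (auto simp: Dset_def blk_def)
  define m where "m = j + k * l - 1"
  have m: "Suc m = j + k * l" using j by (simp add: m_def)
  have "\<not> m < n" using tp_le[of "Suc m" n] k s m by auto
  moreover have "\<not> n < m" using tp_le[of "Suc n" m] k s by (auto simp: m_def)
  ultimately have "n = (j - 1) + k * l" using m j by auto
  moreover have "j - 1 < l" using j by auto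
  ultimately have "n mod l = j - 1" by simp
  then show "j = Suc (n mod l)" using j by auto
qed

text \<open>What X gains from jumps a + 1 to b when all of them fall into class j; the class is
  fixed here and no longer depends on the arrival times.\<close>

definition jump_sum :: "nat \<Rightarrow> nat \<Rightarrow> nat \<Rightarrow> 'a \<Rightarrow> real" where
  "jump_sum j a b \<omega> = (\<Sum>n\<in>{a<..b}. Z n j \<omega>)"

lemma Z_rv [measurable]: "1 \<le> n \<Longrightarrow> j \<in> {1..l} \<Longrightarrow> Z n j \<in> borel_measurable M"
  using Z_indep unfolding indep_vars_def2 by auto

lemma jump_sum_rv [measurable]: "j \<in> {1..l} \<Longrightarrow> jump_sum j a b \<in> borel_measurable M"
  unfolding jump_sum_def[abs_def] by (intro borel_measurable_sum Z_rv) auto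

lemma jump_sum_pairs:
  "jump_sum j a b \<omega> = (\<Sum>p\<in>{a<..b} \<times> {j}. (case p of (n, j) \<Rightarrow> Z n j) \<omega>)"
  by (simp add: jump_sum_def sum.cartesian_product[symmetric] case_prod_unfold)
     (simp add: sum.cartesian_product' )

text \<open>Both laws are the k-fold convolution of \<open>F j\<close>, because each further mark is
  independent of the sum so far.\<close>

lemma jump_sum_distr:
  assumes j: "j \<in> {1..l}"
  shows "distr M borel (jump_sum j a (a + k)) = distr M borel (jump_sum j 0 k)"
proof -
  have step: "distr M borel (jump_sum j a (Suc (a + k))) =
      convolution (F j) (distr M borel (jump_sum j a (a + k)))" for a k
  proof -
    let ?I = "{a<..a + k} \<times> {j}" and ?i = "(Suc (a + k), j)"
    have "indep_vars (\<lambda>_. borel) (\<lambda>(n, j). Z n j) (insert ?i ?I)"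
      using j by (intro indep_vars_subset[OF Z_indep]) auto
    from indep_vars_sum[OF _ _ this]
    have ind: "indep_var borel (Z (Suc (a + k)) j) borel (jump_sum j a (a + k))"
      by (simp add: jump_sum_pairs[abs_def])
    have "{a<..Suc (a + k)} = insert (Suc (a + k)) {a<..a + k}" by auto
    then have "jump_sum j a (Suc (a + k)) = (\<lambda>\<omega>. Z (Suc (a + k)) j \<omega> + jump_sum j a (a + k) \<omega>)"
      by (simp add: jump_sum_def fun_eq_iff)
    then show ?thesis
      using sum_indep_random_variable[OF ind] Z_rv[of "Suc (a + k)" j] jump_sum_rv[OF j] Z_distr j by simp
  qed
  show ?thesis
  proof (induction k)
    case 0
    then show ?case by (simp add: jump_sum_def[abs_def])
  next
    case (Suc k)
    then show ?case using step[of a k] step[of 0 k] by simp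
  qed
qed

definition jump_sum_law :: "nat \<Rightarrow> nat \<Rightarrow> real set \<Rightarrow> ennreal" where
  "jump_sum_law j k A = emeasure M {\<omega>\<in>space M. jump_sum j 0 k \<omega> \<in> A}"

lemma jump_sum_law_eq:
  assumes j: "j \<in> {1..l}" and A: "A \<in> sets borel" and ab: "a \<le> b"
  shows "emeasure M {\<omega>\<in>space M. jump_sum j a b \<omega> \<in> A} = jump_sum_law j (b - a) A"
proof -
  have "emeasure (distr M borel (jump_sum j a (a + (b - a)))) A = emeasure (distr M borel (jump_sum j 0 (b - a))) A"
    by (simp add: jump_sum_distr[OF j])
  then show ?thesis
    using ab A jump_sum_rv[OF j] by (simp add: emeasure_distr jump_sum_law_def vimage_def Int_def conj_commute)
qed

text \<open>The index windows of a monotone k do not overlap, so the sums are functions of disjoint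
  groups of marks, even where classes repeat.\<close>

lemma jump_sums_disjoint:
  fixes k :: "nat \<Rightarrow> nat"
  assumes k: "mono k" and j: "\<And>i. i < m \<Longrightarrow> j i \<in> {1..l}" and A: "\<And>i. i < m \<Longrightarrow> A i \<in> sets borel"
  shows "emeasure M {\<omega>\<in>space M. \<forall>i<m. jump_sum (j i) (k i) (k (Suc i)) \<omega> \<in> A i}
     = (\<Prod>i<m. jump_sum_law (j i) (k (Suc i) - k i) (A i))"
proof (cases "m = 0")
  case True
  then show ?thesis by (simp add: emeasure_space_1)
next
  case False
  let ?K = "\<lambda>i. {k i<..k (Suc i)} \<times> {j i}"
  have "disjoint_family_on ?K {..<m}"
    unfolding disjoint_family_on_def
  proof (intro ballI impI)
    fix i i' :: nat assume ne: "i \<noteq> i'"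
    have "k (Suc i) \<le> k i' \<or> k (Suc i') \<le> k i"
      using ne monoD[OF k] by (metis Suc_leI linorder_neqE_nat)
    then show "?K i \<inter> ?K i' = {}" by auto
  qed
  then have "indep_vars (\<lambda>i. PiM (?K i) (\<lambda>_. borel)) (\<lambda>i \<omega>. restrict (\<lambda>p. (case p of (n, j) \<Rightarrow> Z n j) \<omega>) (?K i)) {..<m}"
    using j by (intro indep_vars_restrict[OF Z_indep]) (auto simp: Ball_def)
  then have "indep_vars (\<lambda>_. borel) (\<lambda>i \<omega>. (\<lambda>x. \<Sum>p\<in>?K i. x p) (restrict (\<lambda>p. (case p of (n, j) \<Rightarrow> Z n j) \<omega>) (?K i))) {..<m}"
    by (rule indep_vars_compose2) (intro borel_measurable_sum measurable_component_singleton)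
  then have "indep_vars (\<lambda>_. borel) (\<lambda>i. jump_sum (j i) (k i) (k (Suc i))) {..<m}"
    by (simp add: jump_sum_pairs[abs_def])
  from indep_varsD_finite[OF this, of A]
  have "prob (\<Inter>i<m. jump_sum (j i) (k i) (k (Suc i)) -` A i \<inter> space M)
      = (\<Prod>i<m. prob (jump_sum (j i) (k i) (k (Suc i)) -` A i \<inter> space M))"
    using False A by auto
  moreover have "(\<Inter>i<m. jump_sum (j i) (k i) (k (Suc i)) -` A i \<inter> space M)
      = {\<omega>\<in>space M. \<forall>i<m. jump_sum (j i) (k i) (k (Suc i)) \<omega> \<in> A i}"
    using False by auto
  moreover have "ennreal (prob (jump_sum (j i) (k i) (k (Suc i)) -` A i \<inter> space M))
      = jump_sum_law (j i) (k (Suc i) - k i) (A i)" if "i < m" for i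
    using jump_sum_law_eq[OF j[OF that] A[OF that] monoD[OF k, of i "Suc i"]]
    by (simp add: emeasure_eq_measure vimage_def Int_def conj_commute)
  ultimately show ?thesis
    by (simp add: emeasure_eq_measure prod_ennreal[symmetric])
qed

text \<open>\<open>ZN_indep\<close> speaks about two generated sigma-algebras. This lemma and the
  next place the events used in the conditioning in them, as preimages of sets that depend on
  finitely many coordinates.\<close>

lemma N_event_sigma:
  fixes u :: "nat \<Rightarrow> real"
  assumes "\<And>i. i \<le> m \<Longrightarrow> 0 \<le> u i"
  shows "{\<omega>\<in>space M. \<forall>i\<le>m. N (u i) \<omega> = k i} \<in>
    sets (vimage_algebra (space M) (\<lambda>\<omega>. \<lambda>u\<in>{0..}. N u \<omega>) (PiM {0..} (\<lambda>_. count_space UNIV)))"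
proof -
  let ?P = "PiM {0::real..} (\<lambda>_. count_space (UNIV :: nat set))"
  let ?n = "\<lambda>\<omega>. \<lambda>u\<in>{0..}. N u \<omega>"
  let ?B = "{x\<in>space ?P. \<forall>i\<in>{..m}. x (u i) \<in> {k i}}"
  have "(\<lambda>x. x (u i)) \<in> measurable ?P (count_space UNIV)" if "i \<le> m" for i
    using assms[OF that] by (intro measurable_component_singleton) auto
  then have "?B \<in> sets ?P"
    by (intro sets.sets_Collect_finite_All) (auto intro!: measurable_sets_Collect)
  then have "(?n) -` ?B \<inter> space M
      \<in> sets (vimage_algebra (space M) (?n) ?P)"
    by (rule in_vimage_algebra)
  also have "(?n) -` ?B \<inter> space M
      = {\<omega>\<in>space M. \<forall>i\<le>m. N (u i) \<omega> = k i}"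
    using assms by (fastforce simp: space_PiM)
  finally show ?thesis .
qed

lemma Z_event_sigma:
  fixes a b j :: "nat \<Rightarrow> nat"
  assumes j: "\<And>i. i < m \<Longrightarrow> j i \<in> {1..l}" and A: "\<And>i. i < m \<Longrightarrow> A i \<in> sets borel"
  shows "{\<omega>\<in>space M. \<forall>i<m. jump_sum (j i) (a i) (b i) \<omega> \<in> A i} \<in>
    sets (vimage_algebra (space M) (\<lambda>\<omega>. \<lambda>nj\<in>{1..} \<times> {1..l}. Z (fst nj) (snd nj) \<omega>)
                 (PiM ({1..} \<times> {1..l}) (\<lambda>_. borel)))"
proof -
  let ?P = "PiM ({1..} \<times> {1..l}) (\<lambda>_. borel :: real measure)"
  let ?z = "\<lambda>\<omega>. \<lambda>nj\<in>{1..} \<times> {1..l}. Z (fst nj) (snd nj) \<omega>"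
  let ?B = "{x\<in>space ?P. \<forall>i\<in>{..<m}. (\<Sum>n\<in>{a i<..b i}. x (n, j i)) \<in> A i}"
  have "(\<lambda>x. \<Sum>n\<in>{a i<..b i}. x (n, j i)) \<in> borel_measurable ?P" if "i < m" for i
    using j[OF that] by (intro borel_measurable_sum measurable_component_singleton) auto
  then have "?B \<in> sets ?P"
    using A by (intro sets.sets_Collect_finite_All) (auto intro!: measurable_sets_Collect)
  then have "(?z) -`
        ?B \<inter> space M
      \<in> sets (vimage_algebra (space M) (?z) ?P)"
    by (rule in_vimage_algebra)
  also have "(?z) -`
        ?B \<inter> space M
      = {\<omega>\<in>space M. \<forall>i<m. jump_sum (j i) (a i) (b i) \<omega> \<in> A i}"
  proof -
    have "(\<Sum>n\<in>{a i<..b i}. (\<lambda>nj\<in>{1..} \<times> {1..l}. Z (fst nj) (snd nj) \<omega>) (n, j i)) = jump_sum (j i) (a i) (b i) \<omega>"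
      if "i < m" for i \<omega>
      unfolding jump_sum_def using j[OF that] by (intro sum.cong) auto
    then show ?thesis by (auto simp: space_PiM)
  qed
  finally show ?thesis .
qed

text \<open>The compound Poisson law of an increment of X over an interval inside one block of class
  j.\<close>

definition incr_law :: "real \<Rightarrow> real \<Rightarrow> nat \<Rightarrow> real set \<Rightarrow> ennreal" where
  "incr_law a b j A = (\<integral>\<^sup>+\<omega>. jump_sum_law j (N b \<omega> - N a \<omega>) A \<partial>M)"

text \<open>Conditionally on the counting process, jump sums over disjoint index ranges are independent,
  and the law of each depends only on the number of its summands.\<close>

lemma marked_increments:
  fixes u :: "nat \<Rightarrow> real"
  assumes u: "0 \<le> u 0" "mono u" and j: "\<And>i. i < m \<Longrightarrow> j i \<in> {1..l}" and A: "\<And>i. i < m \<Longrightarrow> A i \<in> sets borel"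
  shows "emeasure M {\<omega>\<in>space M. \<forall>i<m. jump_sum (j i) (N (u i) \<omega>) (N (u (Suc i)) \<omega>) \<omega> \<in> A i}
     = (\<Prod>i<m. incr_law (u i) (u (Suc i)) (j i) (A i))"
proof -
  have u0: "0 \<le> u i" for i using u monoD[OF u(2), of 0 i] by simp
  \<comment> \<open>The values of N at all grid points are collected in a list: lists of naturals
    form a countable type, so \<open>emeasure_countable_mixture\<close> applies.\<close>
  define \<kappa> where "\<kappa> \<omega> = map (\<lambda>i. N (u i) \<omega>) [0..<Suc m]" for \<omega>
  define Q where "Q k \<omega> \<longleftrightarrow> (\<forall>i<m. jump_sum (j i) (k ! i) (k ! Suc i) \<omega> \<in> A i)" for k \<omega>
  define G where "G k = (\<Prod>i<m. jump_sum_law (j i) (k ! Suc i - k ! i) (A i))" for k :: "nat list"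
  let ?K = "\<lambda>k. {\<omega>\<in>space M. \<kappa> \<omega> = k}" and ?Q = "\<lambda>k. {\<omega>\<in>space M. Q k \<omega>}"
  have \<kappa>nth: "\<kappa> \<omega> ! i = N (u i) \<omega>" if "i \<le> m" for \<omega> i
    using that by (simp add: \<kappa>_def del: upt_Suc)
  have \<kappa>len: "length (\<kappa> \<omega>) = Suc m" for \<omega> by (simp add: \<kappa>_def)
  have \<kappa>iff: "(?K k) = {\<omega>\<in>space M. \<forall>i\<le>m. N (u i) \<omega> = k ! i}" if "length k = Suc m" for k
    using that \<kappa>nth \<kappa>len by (auto simp: list_eq_iff_nth_eq less_Suc_eq_le)
  note sN = indep_setD_ev2[OF ZN_indep, THEN subsetD] and sZ = indep_setD_ev1[OF ZN_indep, THEN subsetD]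
  have \<kappa>meas: "(?K k) \<in> sets M" for k
  proof (cases "length k = Suc m")
    case True
    show ?thesis unfolding \<kappa>iff[OF True] by (intro sN N_event_sigma u0)
  next
    case False
    then have "(?K k) = {}" using \<kappa>len by auto
    then show ?thesis by (simp only: sets.empty_sets)
  qed
  have Qmeas: "(?Q k) \<in> sets M" for k
    unfolding Q_def by (intro sZ Z_event_sigma j A)
  have split: "{\<omega>\<in>space M. \<kappa> \<omega> = k \<and> Q k \<omega>} = (?Q k) \<inter> (?K k)" for k
    by auto
  have "emeasure M {\<omega>\<in>space M. Q (\<kappa> \<omega>) \<omega>} = (\<integral>\<^sup>+\<omega>. G (\<kappa> \<omega>) \<partial>M)"
  proof (rule emeasure_countable_mixture[OF \<kappa>meas])
    fix k
    show "{\<omega>\<in>space M. \<kappa> \<omega> = k \<and> Q k \<omega>} \<in> sets M" unfolding split using Qmeas \<kappa>meas by blast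
    show "emeasure M {\<omega>\<in>space M. \<kappa> \<omega> = k \<and> Q k \<omega>} = G k * emeasure M (?K k)"
    proof (cases "(?K k) = {}")
      case True
      show ?thesis unfolding split True by simp
    next
      case False
      then obtain \<omega>0 where \<omega>0: "\<omega>0 \<in> space M" "k = \<kappa> \<omega>0" by auto
      then have len: "length k = Suc m" using \<kappa>len by simp
      have "prob ((?Q k) \<inter> (?K k)) = prob (?Q k) * prob (?K k)"
        unfolding \<kappa>iff[OF len] Q_def
        by (intro indep_setD[OF ZN_indep] Z_event_sigma N_event_sigma u0 j A)
      moreover have "emeasure M (?Q k) = G k"
      proof -
        \<comment> \<open>Only lists k attained at some sample point matter, for the others both
          sides vanish; an attained list is monotone. Freezing it beyond m gives a sequence monotone
          on all indices, as \<open>jump_sums_disjoint\<close> demands.\<close>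
        define k' where "k' i = N (u (min i m)) \<omega>0" for i
        have k': "k ! i = k' i" if "i \<le> m" for i using that \<omega>0 \<kappa>nth by (simp add: k'_def)
        have "mono k'"
          unfolding k'_def using \<omega>0 u0 monoD[OF u(2)] by (intro monoI N_mono) auto
        from jump_sums_disjoint[OF this j A]
        have "emeasure M {\<omega>\<in>space M. \<forall>i<m. jump_sum (j i) (k' i) (k' (Suc i)) \<omega> \<in> A i}
           = (\<Prod>i<m. jump_sum_law (j i) (k' (Suc i) - k' i) (A i))" .
        moreover have "Q k \<omega> \<longleftrightarrow> (\<forall>i<m. jump_sum (j i) (k' i) (k' (Suc i)) \<omega> \<in> A i)" for \<omega>
          by (auto simp: Q_def k' Suc_leI)
        moreover have "G k = (\<Prod>i<m. jump_sum_law (j i) (k' (Suc i) - k' i) (A i))"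
          unfolding G_def by (intro prod.cong) (auto simp: k' Suc_leI)
        ultimately show ?thesis by simp
      qed
      ultimately show ?thesis
        unfolding split by (simp add: emeasure_eq_measure ennreal_mult'')
    qed
  qed
  moreover have "{\<omega>\<in>space M. Q (\<kappa> \<omega>) \<omega>} = {\<omega>\<in>space M. \<forall>i<m. jump_sum (j i) (N (u i) \<omega>) (N (u (Suc i)) \<omega>) \<omega> \<in> A i}"
    by (auto simp: Q_def \<kappa>nth)
  moreover have "(\<integral>\<^sup>+\<omega>. G (\<kappa> \<omega>) \<partial>M) = (\<integral>\<^sup>+\<omega>. (\<Prod>i<m. jump_sum_law (j i) (N (u (Suc i)) \<omega> - N (u i) \<omega>) (A i)) \<partial>M)"
    unfolding G_def by (intro nn_integral_cong prod.cong) (auto simp: \<kappa>nth Suc_leI)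
  \<comment> \<open>Here the independence of the increments of N factorises the expectation.\<close>
  moreover have "\<dots> = (\<Prod>i<m. incr_law (u i) (u (Suc i)) (j i) (A i))"
    unfolding incr_law_def
    by (rule indep_vars_nn_integral)
       (use indep_vars_compose2[OF N_indep_incr[rule_format, of u m], of "\<lambda>i k. jump_sum_law (j i) k (A i)" "\<lambda>_. borel"] u in auto)
  ultimately show ?thesis by simp
qed

text \<open>Only the law of the increment of N enters, and its Poisson mean is a \<tau>-periodic
  increment of \<open>Lam\<close>. The case a = b is separate because \<open>N_poisson\<close>
  covers proper intervals.\<close>

lemma incr_law_shift:
  assumes ab: "0 \<le> a" "a \<le> b"
  shows "incr_law (a + \<tau>) (b + \<tau>) j A = incr_law a b j A"
proof (cases "a = b")
  case True
  then show ?thesis by (simp add: incr_law_def)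
next
  case False
  have mixture: "incr_law a b j A = (\<integral>\<^sup>+k. jump_sum_law j k A * emeasure M {\<omega>\<in>space M. N b \<omega> - N a \<omega> = k} \<partial>count_space UNIV)"
    if "0 \<le> a" "a < b" for a b
    unfolding incr_law_def using that by (intro nn_integral_countable_valued N_incr_event) auto
  have "emeasure M {\<omega>\<in>space M. N (b + \<tau>) \<omega> - N (a + \<tau>) \<omega> = k} = emeasure M {\<omega>\<in>space M. N b \<omega> - N a \<omega> = k}" for k
    using N_poisson[rule_format, of "a + \<tau>" "b + \<tau>" k] N_poisson[rule_format, of a b k] Lam_shift[OF ab] ab False tau_pos
    by (simp add: emeasure_eq_measure)
  then show ?thesis using mixture[of a b] mixture[of "a + \<tau>" "b + \<tau>"] ab False tau_pos by simp
qed

end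

section \<open>Independence and periodicity of the jump process\<close>

lemma sigma_sets_vimage_generator:
  assumes h: "h \<in> measurable M R" and R: "sets R = sigma_sets (space R) \<C>"
  shows "sigma_sets (space M) {h -` A \<inter> space M | A. A \<in> sets R} = sigma_sets (space M) {h -` A \<inter> space M | A. A \<in> \<C>}"
proof -
  have "h \<in> space M \<rightarrow> space R" using h by (auto simp: measurable_def)
  from sigma_sets_vimage_commute[OF this, of \<C>]
  have "{h -` A \<inter> space M | A. A \<in> sets R} = sigma_sets (space M) {h -` A \<inter> space M | A. A \<in> \<C>}"
    unfolding R .
  then show ?thesis by (simp only:) (rule sigma_sets_sigma_sets_eq, auto)
qed

lemma Int_stable_vimage:
  assumes "Int_stable \<C>"
  shows "Int_stable {h -` A \<inter> \<Omega> | A. A \<in> \<C>}"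
proof (rule Int_stableI)
  fix a b assume "a \<in> {h -` A \<inter> \<Omega> | A. A \<in> \<C>}" "b \<in> {h -` A \<inter> \<Omega> | A. A \<in> \<C>}"
  then obtain A B where AB: "A \<in> \<C>" "B \<in> \<C>" "a = h -` A \<inter> \<Omega>" "b = h -` B \<inter> \<Omega>" by blast
  then have "a \<inter> b = h -` (A \<inter> B) \<inter> \<Omega>" "A \<inter> B \<in> \<C>"
    using Int_stableD[OF assms] by auto
  then show "a \<inter> b \<in> {h -` A \<inter> \<Omega> | A. A \<in> \<C>}" by blast
qed

text \<open>\<open>indep_var\<close> requires both random variables to have the same type.\<close>

definition (in prob_space) indep_rv :: "'b measure \<Rightarrow> ('a \<Rightarrow> 'b) \<Rightarrow> 'c measure \<Rightarrow> ('a \<Rightarrow> 'c) \<Rightarrow> bool" where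
  "indep_rv S f T g \<longleftrightarrow> f \<in> measurable M S \<and> g \<in> measurable M T \<and>
    (\<forall>a\<in>sets S. \<forall>b\<in>sets T. prob ({\<omega>\<in>space M. f \<omega> \<in> a} \<inter> {\<omega>\<in>space M. g \<omega> \<in> b})
       = prob {\<omega>\<in>space M. f \<omega> \<in> a} * prob {\<omega>\<in>space M. g \<omega> \<in> b})"

lemma (in prob_space) indep_rvD:
  assumes "indep_rv S f T g"
  shows "f \<in> measurable M S" "g \<in> measurable M T"
    and "a \<in> sets S \<Longrightarrow> b \<in> sets T \<Longrightarrow> prob ({\<omega>\<in>space M. f \<omega> \<in> a} \<inter> {\<omega>\<in>space M. g \<omega> \<in> b})
       = prob {\<omega>\<in>space M. f \<omega> \<in> a} * prob {\<omega>\<in>space M. g \<omega> \<in> b}"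
  using assms by (auto simp: indep_rv_def)

text \<open>Preimages of intersection-stable generators generate the sigma-algebras of f and g, and
  independence passes from such generators to all events.\<close>

lemma (in prob_space) indep_rv_sigmaI:
  assumes f: "f \<in> measurable M S" and S: "sets S = sigma_sets (space S) \<A>" "Int_stable \<A>"
    and g: "g \<in> measurable M T" and T: "sets T = sigma_sets (space T) \<B>" "Int_stable \<B>"
    and prod: "\<And>a b. a \<in> \<A> \<Longrightarrow> b \<in> \<B> \<Longrightarrow>
      prob ((f -` a \<inter> space M) \<inter> (g -` b \<inter> space M)) = prob (f -` a \<inter> space M) * prob (g -` b \<inter> space M)"
  shows "indep_rv S f T g"
proof -
  let ?A = "{f -` A \<inter> space M | A. A \<in> \<A>}" and ?B = "{g -` B \<inter> space M | B. B \<in> \<B>}"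
  have "f -` a \<inter> space M \<in> events" if "a \<in> \<A>" for a
    using that S by (intro measurable_sets[OF f]) auto
  moreover have "g -` b \<inter> space M \<in> events" if "b \<in> \<B>" for b
    using that T by (intro measurable_sets[OF g]) auto
  ultimately have "indep_set ?A ?B"
    unfolding indep_sets2_eq using prod by auto
  then have ind: "indep_set (sigma_sets (space M) ?A) (sigma_sets (space M) ?B)"
    by (intro indep_set_sigma_sets Int_stable_vimage S T)
  show ?thesis
    unfolding indep_rv_def
  proof (intro conjI ballI f g)
    fix a b assume "a \<in> sets S" "b \<in> sets T"
    then have "f -` a \<inter> space M \<in> sigma_sets (space M) ?A"
      "g -` b \<inter> space M \<in> sigma_sets (space M) ?B"
      unfolding sigma_sets_vimage_generator[OF f S(1), symmetric] sigma_sets_vimage_generator[OF g T(1), symmetric] by auto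
    from indep_setD[OF ind this]
    show "prob ({\<omega>\<in>space M. f \<omega> \<in> a} \<inter> {\<omega>\<in>space M. g \<omega> \<in> b}) = prob {\<omega>\<in>space M. f \<omega> \<in> a} * prob {\<omega>\<in>space M. g \<omega> \<in> b}"
      by (simp add: vimage_def Int_def conj_ac)
  qed
qed

lemma (in prob_space) indep_rv_compose:
  assumes ind: "indep_rv S f T g" and \<phi>: "\<phi> \<in> measurable S S'" and \<psi>: "\<psi> \<in> measurable T T'"
  shows "indep_rv S' (\<lambda>\<omega>. \<phi> (f \<omega>)) T' (\<lambda>\<omega>. \<psi> (g \<omega>))"
  unfolding indep_rv_def
proof (intro conjI ballI)
  note f = indep_rvD(1)[OF ind] and g = indep_rvD(2)[OF ind]
  show "(\<lambda>\<omega>. \<phi> (f \<omega>)) \<in> measurable M S'" "(\<lambda>\<omega>. \<psi> (g \<omega>)) \<in> measurable M T'"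
    by (rule measurable_compose[OF f \<phi>] measurable_compose[OF g \<psi>])+
  fix a b assume a: "a \<in> sets S'" and b: "b \<in> sets T'"
  have "{\<omega>\<in>space M. \<phi> (f \<omega>) \<in> a} = {\<omega>\<in>space M. f \<omega> \<in> \<phi> -` a \<inter> space S}"
    "{\<omega>\<in>space M. \<psi> (g \<omega>) \<in> b} = {\<omega>\<in>space M. g \<omega> \<in> \<psi> -` b \<inter> space T}"
    using measurable_space[OF f] measurable_space[OF g] by auto
  then show "prob ({\<omega>\<in>space M. \<phi> (f \<omega>) \<in> a} \<inter> {\<omega>\<in>space M. \<psi> (g \<omega>) \<in> b})
      = prob {\<omega>\<in>space M. \<phi> (f \<omega>) \<in> a} * prob {\<omega>\<in>space M. \<psi> (g \<omega>) \<in> b}"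
    using indep_rvD(3)[OF ind measurable_sets[OF \<phi> a] measurable_sets[OF \<psi> b]] by (simp only:)
qed

lemma (in prob_space) indep_rv_distr:
  assumes ind: "indep_rv S f T g"
  shows "distr M S f \<Otimes>\<^sub>M distr M T g = distr M (S \<Otimes>\<^sub>M T) (\<lambda>\<omega>. (f \<omega>, g \<omega>))"
proof (rule pair_measure_eqI)
  note f = indep_rvD(1)[OF ind] and g = indep_rvD(2)[OF ind]
  interpret S: prob_space "distr M S f" by (rule prob_space_distr[OF f])
  interpret T: prob_space "distr M T g" by (rule prob_space_distr[OF g])
  show "sigma_finite_measure (distr M S f)" "sigma_finite_measure (distr M T g)" by unfold_locales
  show "sets (distr M S f \<Otimes>\<^sub>M distr M T g) = sets (distr M (S \<Otimes>\<^sub>M T) (\<lambda>\<omega>. (f \<omega>, g \<omega>)))"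
    by (simp add: sets_pair_measure_cong[OF sets_distr sets_distr])
  fix a b assume "a \<in> sets (distr M S f)" "b \<in> sets (distr M T g)"
  then have ab: "a \<in> sets S" "b \<in> sets T" by auto
  have fg: "(\<lambda>\<omega>. (f \<omega>, g \<omega>)) \<in> measurable M (S \<Otimes>\<^sub>M T)" using f g by simp
  have "f -` a \<inter> space M = {\<omega>\<in>space M. f \<omega> \<in> a}" "g -` b \<inter> space M = {\<omega>\<in>space M. g \<omega> \<in> b}"
    "(\<lambda>\<omega>. (f \<omega>, g \<omega>)) -` (a \<times> b) \<inter> space M = {\<omega>\<in>space M. f \<omega> \<in> a} \<inter> {\<omega>\<in>space M. g \<omega> \<in> b}" by auto
  then show "emeasure (distr M S f) a * emeasure (distr M T g) b = emeasure (distr M (S \<Otimes>\<^sub>M T) (\<lambda>\<omega>. (f \<omega>, g \<omega>))) (a \<times> b)"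
    using ab indep_rvD(3)[OF ind ab]
    by (simp add: emeasure_distr[OF f] emeasure_distr[OF g] emeasure_distr[OF fg] emeasure_eq_measure ennreal_mult)
qed

lemma vimage_prod_emb_process:
  fixes X :: "'i \<Rightarrow> 'a \<Rightarrow> real"
  assumes "J \<subseteq> I"
  shows "(\<lambda>\<omega>. \<lambda>i\<in>I. X i \<omega>) -` prod_emb I (\<lambda>_. borel) J (Pi\<^sub>E J B) \<inter> \<Omega> = {\<omega>\<in>\<Omega>. \<forall>j\<in>J. X j \<omega> \<in> B j}"
proof -
  have "restrict (\<lambda>i\<in>I. X i \<omega>) J = restrict (\<lambda>i. X i \<omega>) J" for \<omega>
    using assms by (auto simp: fun_eq_iff)
  then show ?thesis by (auto simp: prod_emb_def PiE_iff)
qed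

lemma vimage_PiE_process:
  "(\<lambda>\<omega>. \<lambda>i\<in>I. X i \<omega>) -` Pi\<^sub>E I B \<inter> \<Omega> = {\<omega>\<in>\<Omega>. \<forall>i\<in>I. X i \<omega> \<in> B i}"
  by (auto simp: PiE_iff)

lemma (in prob_space) indep_rv_processI:
  fixes X :: "'i \<Rightarrow> 'a \<Rightarrow> real" and X' :: "'j \<Rightarrow> 'a \<Rightarrow> real"
  assumes X: "\<And>i. i \<in> I \<Longrightarrow> X i \<in> borel_measurable M" and X': "\<And>i. i \<in> I' \<Longrightarrow> X' i \<in> borel_measurable M"
    and fdd: "\<And>J J' B B'. finite J \<Longrightarrow> J \<subseteq> I \<Longrightarrow> finite J' \<Longrightarrow> J' \<subseteq> I' \<Longrightarrow>
      (\<And>j. j \<in> J \<Longrightarrow> B j \<in> sets borel) \<Longrightarrow> (\<And>j. j \<in> J' \<Longrightarrow> B' j \<in> sets borel) \<Longrightarrow>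
      prob ({\<omega>\<in>space M. \<forall>j\<in>J. X j \<omega> \<in> B j} \<inter> {\<omega>\<in>space M. \<forall>j\<in>J'. X' j \<omega> \<in> B' j})
       = prob {\<omega>\<in>space M. \<forall>j\<in>J. X j \<omega> \<in> B j} * prob {\<omega>\<in>space M. \<forall>j\<in>J'. X' j \<omega> \<in> B' j}"
  shows "indep_rv (PiM I (\<lambda>_. borel)) (\<lambda>\<omega>. \<lambda>i\<in>I. X i \<omega>) (PiM I' (\<lambda>_. borel)) (\<lambda>\<omega>. \<lambda>i\<in>I'. X' i \<omega>)"
proof (rule indep_rv_sigmaI)
  show "(\<lambda>\<omega>. \<lambda>i\<in>I. X i \<omega>) \<in> measurable M (PiM I (\<lambda>_. borel))" by (rule measurable_restrict) (rule X)
  show "(\<lambda>\<omega>. \<lambda>i\<in>I'. X' i \<omega>) \<in> measurable M (PiM I' (\<lambda>_. borel))" by (rule measurable_restrict) (rule X')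
  show "sets (PiM I (\<lambda>_. borel :: real measure)) = sigma_sets (space (PiM I (\<lambda>_. borel))) (prod_algebra I (\<lambda>_. borel))"
    by (simp add: sets_PiM space_PiM)
  show "sets (PiM I' (\<lambda>_. borel :: real measure)) = sigma_sets (space (PiM I' (\<lambda>_. borel))) (prod_algebra I' (\<lambda>_. borel))"
    by (simp add: sets_PiM space_PiM)
  fix a b assume "a \<in> prod_algebra I (\<lambda>_. borel :: real measure)" "b \<in> prod_algebra I' (\<lambda>_. borel :: real measure)"
  then obtain J B J' B' where
    "a = prod_emb I (\<lambda>_. borel) J (Pi\<^sub>E J B)" "finite J" "J \<subseteq> I" "\<And>i. i \<in> J \<Longrightarrow> B i \<in> sets borel"
    "b = prod_emb I' (\<lambda>_. borel) J' (Pi\<^sub>E J' B')" "finite J'" "J' \<subseteq> I'" "\<And>i. i \<in> J' \<Longrightarrow> B' i \<in> sets borel"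
    by (elim prod_algebraE) blast
  then show "prob ((\<lambda>\<omega>. \<lambda>i\<in>I. X i \<omega>) -` a \<inter> space M \<inter> ((\<lambda>\<omega>. \<lambda>i\<in>I'. X' i \<omega>) -` b \<inter> space M)) =
    prob ((\<lambda>\<omega>. \<lambda>i\<in>I. X i \<omega>) -` a \<inter> space M) * prob ((\<lambda>\<omega>. \<lambda>i\<in>I'. X' i \<omega>) -` b \<inter> space M)"
    using fdd[of J J' B B'] by (simp only: vimage_prod_emb_process)
qed (rule Int_stable_prod_algebra)+

lemma (in prob_space) indep_rv_PairI:
  assumes A: "A \<in> measurable M S" and B: "B \<in> measurable M T" and C: "C \<in> measurable M U"
    and prod: "\<And>a b c. a \<in> sets S \<Longrightarrow> b \<in> sets T \<Longrightarrow> c \<in> sets U \<Longrightarrow>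
      prob ({\<omega>\<in>space M. A \<omega> \<in> a \<and> B \<omega> \<in> b} \<inter> {\<omega>\<in>space M. C \<omega> \<in> c})
       = prob {\<omega>\<in>space M. A \<omega> \<in> a \<and> B \<omega> \<in> b} * prob {\<omega>\<in>space M. C \<omega> \<in> c}"
  shows "indep_rv (S \<Otimes>\<^sub>M T) (\<lambda>\<omega>. (A \<omega>, B \<omega>)) U C"
proof (rule indep_rv_sigmaI)
  show "sets (S \<Otimes>\<^sub>M T) = sigma_sets (space (S \<Otimes>\<^sub>M T)) {a \<times> b | a b. a \<in> sets S \<and> b \<in> sets T}"
    by (simp add: sets_pair_measure space_pair_measure)
  show "Int_stable {a \<times> b | a b. a \<in> sets S \<and> b \<in> sets T}"
    by (rule Int_stable_pair_measure_generator)
  show "sets U = sigma_sets (space U) (sets U)" by (simp add: sets.sigma_sets_eq)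
  show "Int_stable (sets U)" by (auto simp: Int_stable_def)
  fix x c assume "x \<in> {a \<times> b | a b. a \<in> sets S \<and> b \<in> sets T}" "c \<in> sets U"
  then obtain a b where ab: "x = a \<times> b" "a \<in> sets S" "b \<in> sets T" by blast
  have "(\<lambda>\<omega>. (A \<omega>, B \<omega>)) -` x \<inter> space M = {\<omega>\<in>space M. A \<omega> \<in> a \<and> B \<omega> \<in> b}" "C -` c \<inter> space M = {\<omega>\<in>space M. C \<omega> \<in> c}"
    by (auto simp: ab)
  then show "prob ((\<lambda>\<omega>. (A \<omega>, B \<omega>)) -` x \<inter> space M \<inter> (C -` c \<inter> space M)) =
    prob ((\<lambda>\<omega>. (A \<omega>, B \<omega>)) -` x \<inter> space M) * prob (C -` c \<inter> space M)"
    using prod[OF ab(2,3) \<open>c \<in> sets U\<close>] by (simp only:)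
qed (use A B C in auto)

text \<open>Measurability is assumed because \<open>mark n\<close> is a junk value outside $\{n \le N_u\}$; in the theorem
  it comes for free, since independence of \<open>Y 0\<close> from \<open>S\<close> makes the events of \<open>S\<close> measurable.\<close>

locale marked_process = marked_poisson +
  assumes X_meas: "\<forall>u\<ge>0. (\<lambda>\<omega>. \<Sum>n = 1..N u \<omega>. mark tp l Z N n \<omega>) \<in> borel_measurable M"
begin

definition X :: "real \<Rightarrow> 'a \<Rightarrow> real" where
  "X u \<omega> = (\<Sum>n = 1..N u \<omega>. mark tp l Z N n \<omega>)"

lemma X_rv [measurable]: "0 \<le> u \<Longrightarrow> X u \<in> borel_measurable M"
  using X_meas by (simp add: X_def[abs_def])

lemma X_0: "\<omega> \<in> space M \<Longrightarrow> X 0 \<omega> = 0"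
  by (simp add: X_def N_0)

lemma counting_path: "\<omega> \<in> space M \<Longrightarrow> counting_path (\<lambda>u. N u \<omega>)"
  using N_paths by (auto simp: counting_path_def)

lemma arr_eq_arrival: "\<omega> \<in> space M \<Longrightarrow> counting_path.arr (\<lambda>u. N u \<omega>) n = arrival N n \<omega>"
  by (simp add: counting_path.arr_def[OF counting_path] arrival_def)

text \<open>Almost surely no jump falls on the right end point of the block, so all marks in between
  are drawn from the same distribution.\<close>

lemma X_increment_AE:
  assumes ab: "0 \<le> a" "a \<le> b" and n: "tp n \<le> a" "b \<le> tp (Suc n)"
  shows "AE \<omega> in M. X b \<omega> - X a \<omega> = jump_sum (Suc (n mod l)) (N a \<omega>) (N b \<omega>) \<omega>"
proof (cases "a = b")
  case True
  then show ?thesis by (simp add: jump_sum_def)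
next
  case False
  then have b: "0 < b" "a < b" using ab by auto
  show ?thesis
    using no_jump_at[OF b(1)]
  proof (rule AE_mp, intro AE_I2 impI)
    fix \<omega> assume \<omega>: "\<omega> \<in> space M" and "\<exists>v. 0 \<le> v \<and> v < b \<and> N v \<omega> = N b \<omega>"
    then obtain v where v: "0 \<le> v" "v < b" "N v \<omega> = N b \<omega>" by blast
    interpret counting_path "\<lambda>u. N u \<omega>" by (rule counting_path[OF \<omega>])
    have le: "N a \<omega> \<le> N b \<omega>" using ab \<omega> by (intro N_mono) auto
    have mark: "mark tp l Z N k \<omega> = Z k (Suc (n mod l)) \<omega>" if k: "k \<in> {N a \<omega><..N b \<omega>}" for k
    proof -
      have "arr k \<le> v" using arr_le_iff[of b k v] v k b by simp
      moreover have "\<not> arr k \<le> a" using arr_le_iff[of b k a] k b ab by simp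
      ultimately have "tp n \<le> arrival N k \<omega>" "arrival N k \<omega> < tp (Suc n)"
        using n v by (auto simp: arr_eq_arrival[OF \<omega>, symmetric])
      then show ?thesis by (simp add: mark_def jidx_eq)
    qed
    have "{1..N b \<omega>} = {1..N a \<omega>} \<union> {N a \<omega><..N b \<omega>}" using le by auto
    then have "X b \<omega> - X a \<omega> = (\<Sum>k\<in>{N a \<omega><..N b \<omega>}. mark tp l Z N k \<omega>)"
      by (simp add: X_def sum.union_disjoint ivl_disj_int)
    also have "\<dots> = jump_sum (Suc (n mod l)) (N a \<omega>) (N b \<omega>) \<omega>"
      unfolding jump_sum_def using mark by (rule sum.cong[OF refl])
    finally show "X b \<omega> - X a \<omega> = jump_sum (Suc (n mod l)) (N a \<omega>) (N b \<omega>) \<omega>" .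
  qed
qed

section \<open>Joint law of the increments of X on a grid\<close>

lemma jump_sum_N_rv:
  assumes j: "j \<in> {1..l}" and ab: "0 \<le> a" "0 \<le> b"
  shows "(\<lambda>\<omega>. jump_sum j (N a \<omega>) (N b \<omega>) \<omega>) \<in> borel_measurable M"
proof (rule measurable_compose_countable[where g="N a"])
  fix i
  show "(\<lambda>\<omega>. jump_sum j i (N b \<omega>) \<omega>) \<in> borel_measurable M"
    by (rule measurable_compose_countable[where g="N b"]) (use j ab in auto)
qed (use ab in auto)

lemma mod_l: "Suc (n mod l) \<in> {1..l}"
  using l_pos by (simp add: Suc_leI)

lemma emeasure_X_increments_aux:
  fixes u :: "nat \<Rightarrow> real" and n :: "nat \<Rightarrow> nat"
  assumes u: "0 \<le> u 0" "mono u" and n: "\<And>i. i < m \<Longrightarrow> tp (n i) \<le> u i \<and> u (Suc i) \<le> tp (Suc (n i))"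
    and A: "\<And>i. i < m \<Longrightarrow> A i \<in> sets borel"
  shows "emeasure M {\<omega>\<in>space M. \<forall>i<m. X (u (Suc i)) \<omega> - X (u i) \<omega> \<in> A i}
    = (\<Prod>i<m. incr_law (u i) (u (Suc i)) (Suc (n i mod l)) (A i))"
proof -
  let ?S = "{\<omega>\<in>space M. \<forall>i\<in>{..<m}. X (u (Suc i)) \<omega> - X (u i) \<omega> \<in> A i}"
  let ?S' = "{\<omega>\<in>space M. \<forall>i\<in>{..<m}. jump_sum (Suc (n i mod l)) (N (u i) \<omega>) (N (u (Suc i)) \<omega>) \<omega> \<in> A i}"
  have u0: "0 \<le> u i" for i using u monoD[OF u(2), of 0 i] by simp
  have "AE \<omega> in M. \<forall>i\<in>{..<m}. X (u (Suc i)) \<omega> - X (u i) \<omega> = jump_sum (Suc (n i mod l)) (N (u i) \<omega>) (N (u (Suc i)) \<omega>) \<omega>"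
    by (intro AE_finite_allI X_increment_AE) (use n u0 monoD[OF u(2)] in auto)
  moreover have "?S \<in> sets M"
    using A u0 by (intro sets.sets_Collect_finite_All) (auto intro!: measurable_sets_Collect[of _ _ borel])
  moreover have "?S' \<in> sets M"
    using A u0 by (intro sets.sets_Collect_finite_All) (auto intro!: measurable_sets_Collect[OF jump_sum_N_rv[OF mod_l]])
  ultimately have "emeasure M ?S
     = emeasure M ?S'"
    by (intro emeasure_eq_AE) auto
  also have "\<dots> = (\<Prod>i<m. incr_law (u i) (u (Suc i)) (Suc (n i mod l)) (A i))"
    using marked_increments[OF u, of m "\<lambda>i. Suc (n i mod l)" A, OF mod_l A] by (simp add: Ball_def)
  finally show ?thesis by (simp add: Ball_def)
qed

lemma emeasure_X_increment:
  assumes ab: "0 \<le> a" "a \<le> b" and n: "tp n \<le> a" "b \<le> tp (Suc n)" and A: "A \<in> sets borel"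
  shows "emeasure M {\<omega>\<in>space M. X b \<omega> - X a \<omega> \<in> A} = incr_law a b (Suc (n mod l)) A"
proof -
  have "mono (\<lambda>i::nat. if i = 0 then a else b)" using ab by (intro monoI) auto
  from emeasure_X_increments_aux[OF _ this, of 1 "\<lambda>_. n" "\<lambda>_. A"] show ?thesis
    using ab n A by simp
qed

text \<open>No interval of the grid straddles a partition point. Monotonicity is required beyond m
  because \<open>N_indep_incr\<close> quantifies over monotone sequences on all naturals.\<close>

definition block_grid :: "nat \<Rightarrow> (nat \<Rightarrow> real) \<Rightarrow> bool" where
  "block_grid m u \<longleftrightarrow> 0 \<le> u 0 \<and> mono u \<and> (\<forall>i<m. \<exists>n. tp n \<le> u i \<and> u (Suc i) \<le> tp (Suc n))"

lemma block_grid_nonneg: "block_grid m u \<Longrightarrow> 0 \<le> u i"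
  using monoD[of u 0 i] by (auto simp: block_grid_def)

text \<open>Stating the joint law as a product measure serves twice: it yields the independence of
  the increments, and it reduces periodicity of the joint law to single increments.\<close>

lemma X_increments_distr:
  assumes u: "block_grid m u"
  shows "distr M (PiM {..<m} (\<lambda>_. borel)) (\<lambda>\<omega>. \<lambda>i\<in>{..<m}. X (u (Suc i)) \<omega> - X (u i) \<omega>)
    = PiM {..<m} (\<lambda>i. distr M borel (\<lambda>\<omega>. X (u (Suc i)) \<omega> - X (u i) \<omega>))"
proof -
  let ?dX = "\<lambda>i \<omega>. X (u (Suc i)) \<omega> - X (u i) \<omega>"
  let ?P = "PiM {..<m} (\<lambda>_. borel :: real measure)" and ?V = "\<lambda>\<omega>. \<lambda>i\<in>{..<m}. ?dX i \<omega>"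
  let ?D = "\<lambda>i. distr M borel (?dX i)"
  have rv: "(?dX i) \<in> borel_measurable M" for i
    using block_grid_nonneg[OF u] by measurable
  obtain n where n: "\<And>i. i < m \<Longrightarrow> tp (n i) \<le> u i \<and> u (Suc i) \<le> tp (Suc (n i))"
    using u unfolding block_grid_def by metis
  have u': "0 \<le> u 0" "mono u" using u by (auto simp: block_grid_def)
  interpret D: prob_space "distr M borel (?dX i)" for i
    by (intro prob_space_distr rv)
  interpret product_sigma_finite "?D" ..
  show ?thesis
  proof (rule PiM_eqI)
    fix A assume "\<And>i. i \<in> {..<m} \<Longrightarrow> A i \<in> sets (distr M borel (?dX i))"
    then have A: "A i \<in> sets borel" if "i < m" for i using that by simp
    have "emeasure (distr M (?P) ?V) (Pi\<^sub>E {..<m} A)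
        = emeasure M {\<omega>\<in>space M. \<forall>i<m. X (u (Suc i)) \<omega> - X (u i) \<omega> \<in> A i}"
    proof (subst emeasure_distr)
      show "?V \<in> measurable M (?P)"
        by (intro measurable_restrict rv)
      show "Pi\<^sub>E {..<m} A \<in> sets (?P)"
        using A by (intro sets_PiM_I_finite) auto
      show "emeasure M (?V -` Pi\<^sub>E {..<m} A \<inter> space M)
        = emeasure M {\<omega>\<in>space M. \<forall>i<m. X (u (Suc i)) \<omega> - X (u i) \<omega> \<in> A i}"
        unfolding vimage_PiE_process by (simp only: lessThan_iff Ball_def)
    qed
    also have "\<dots> = (\<Prod>i<m. incr_law (u i) (u (Suc i)) (Suc (n i mod l)) (A i))"
      by (rule emeasure_X_increments_aux[OF u' n A])
    also have "\<dots> = (\<Prod>i<m. emeasure (distr M borel (?dX i)) (A i))"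
    proof (rule prod.cong[OF refl])
      fix i assume "i \<in> {..<m}"
      then have i: "i < m" by simp
      show "incr_law (u i) (u (Suc i)) (Suc (n i mod l)) (A i) = emeasure (distr M borel (?dX i)) (A i)"
      proof -
        have "emeasure (distr M borel (?dX i)) (A i)
            = emeasure M {\<omega>\<in>space M. X (u (Suc i)) \<omega> - X (u i) \<omega> \<in> A i}"
          unfolding emeasure_distr[OF rv A[OF i]] by (rule arg_cong[where f="emeasure M"]) auto
        moreover have "u i \<le> u (Suc i)" using monoD[OF u'(2), of i "Suc i"] by simp
        ultimately show ?thesis
          using emeasure_X_increment[OF block_grid_nonneg[OF u], of i "u (Suc i)" "n i" "A i"] n[OF i] A[OF i] by simp
      qed
    qed
    finally show "emeasure (distr M (?P) ?V) (Pi\<^sub>E {..<m} A)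
        = (\<Prod>i\<in>{..<m}. emeasure (distr M borel (?dX i)) (A i))" .
  qed (auto intro!: sets_PiM_cong)
qed

lemma X_increments_indep:
  assumes u: "block_grid m u"
  shows "indep_vars (\<lambda>_. borel) (\<lambda>i \<omega>. X (u (Suc i)) \<omega> - X (u i) \<omega>) {..<m}"
proof (cases "m = 0")
  case True
  then show ?thesis by (simp add: indep_vars_def2 indep_sets_def)
next
  case False
  have rv: "(\<lambda>\<omega>. X (u (Suc i)) \<omega> - X (u i) \<omega>) \<in> borel_measurable M" for i
    using block_grid_nonneg[OF u] by measurable
  have "{..<m} \<noteq> {}" using False by auto
  from indep_vars_iff_distr_eq_PiM[OF this rv] show ?thesis using X_increments_distr[OF u] by simp
qed

lemma block_grid_shift:
  assumes u: "block_grid m u" shows "block_grid m (\<lambda>i. \<tau> + u i)"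
  unfolding block_grid_def
proof (intro conjI allI impI)
  show "0 \<le> \<tau> + u 0" using block_grid_nonneg[OF u, of 0] tau_pos by simp
  show "mono (\<lambda>i. \<tau> + u i)" using u by (auto simp: block_grid_def mono_def)
  fix i assume "i < m"
  then obtain n where "tp n \<le> u i" "u (Suc i) \<le> tp (Suc n)" using u by (auto simp: block_grid_def)
  then have "tp (n + l) \<le> \<tau> + u i" "\<tau> + u (Suc i) \<le> tp (Suc (n + l))"
    using tp_shift[of n] tp_shift[of "Suc n"] by auto
  then show "\<exists>n. tp n \<le> \<tau> + u i \<and> \<tau> + u (Suc i) \<le> tp (Suc n)" by blast
qed

text \<open>The shift by \<tau> moves block index n to n + l, which has the same class modulo l, and
  \<open>incr_law\<close> itself is periodic.\<close>

lemma X_increment_distr_shift: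
  assumes u: "block_grid m u" and i: "i < m"
  shows "distr M borel (\<lambda>\<omega>. X (\<tau> + u (Suc i)) \<omega> - X (\<tau> + u i) \<omega>) = distr M borel (\<lambda>\<omega>. X (u (Suc i)) \<omega> - X (u i) \<omega>)"
proof (rule measure_eqI)
  let ?dX' = "\<lambda>\<omega>. X (\<tau> + u (Suc i)) \<omega> - X (\<tau> + u i) \<omega>" and ?dX = "\<lambda>\<omega>. X (u (Suc i)) \<omega> - X (u i) \<omega>"
  fix A assume "A \<in> sets (distr M borel ?dX')"
  then have A: "A \<in> sets borel" by simp
  obtain n where n: "tp n \<le> u i" "u (Suc i) \<le> tp (Suc n)" using u i by (auto simp: block_grid_def)
  then have n': "tp (n + l) \<le> \<tau> + u i" "\<tau> + u (Suc i) \<le> tp (Suc (n + l))"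
    using tp_shift[of n] tp_shift[of "Suc n"] by auto
  have u0: "0 \<le> u i" "u i \<le> u (Suc i)" using u block_grid_nonneg[OF u] by (auto simp: block_grid_def mono_def)
  have "emeasure M {\<omega>\<in>space M. X (\<tau> + u (Suc i)) \<omega> - X (\<tau> + u i) \<omega> \<in> A} = emeasure M {\<omega>\<in>space M. X (u (Suc i)) \<omega> - X (u i) \<omega> \<in> A}"
    using emeasure_X_increment[OF u0 n A] emeasure_X_increment[of "\<tau> + u i" "\<tau> + u (Suc i)", OF _ _ n' A] u0 tau_pos
      incr_law_shift[OF u0, of "Suc (n mod l)" A]
    by (simp add: add.commute)
  then show "emeasure (distr M borel ?dX') A
      = emeasure (distr M borel ?dX) A"
    using A u0 tau_pos by (simp add: emeasure_distr vimage_def Int_def conj_commute)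
qed simp

text \<open>J is sorted together with the partition points up to some \<open>tp n0\<close> beyond
  all of J, which exists because the partition points tend to infinity.\<close>

lemma block_grid_exists:
  assumes J: "finite J" "J \<subseteq> {0..}"
  obtains m u where "u 0 = 0" "block_grid m u" "J \<subseteq> u ` {..m}"
proof -
  obtain n0 where n0: "\<forall>s\<in>J. s \<le> tp n0"
  proof -
    have "eventually (\<lambda>n. \<forall>s\<in>J. s \<le> tp n) sequentially"
      using tp_lim J(1) by (intro eventually_ball_finite) (auto simp: filterlim_at_top)
    then show thesis using that by (auto simp: eventually_sequentially)
  qed
  define G where "G = J \<union> tp ` {..n0}"
  have G: "finite G" using J by (simp add: G_def)
  have tp0': "0 \<le> tp n" for n using tp_le[of 0 n] tp0 by simp
  have Gb: "0 \<le> s" "s \<le> tp n0" if "s \<in> G" for s using that n0 J tp_le tp0' by (auto simp: G_def)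
  define xs where "xs = sorted_list_of_set G"
  define m where "m = length xs - 1"
  have set: "set xs = G" and srt: "sorted xs" and dst: "distinct xs" using G by (simp_all add: xs_def)
  have "0 \<in> set xs" unfolding set G_def using tp0 by (auto intro!: image_eqI[of _ _ 0])
  then have len: "length xs = Suc m" by (cases xs) (auto simp: m_def)
  define u where "u i = xs ! min i m" for i
  have nth_mono: "xs ! i \<le> xs ! j" if "i \<le> j" "j \<le> m" for i j
    using sorted_nth_mono[OF srt that(1)] that len by simp
  have idx: "\<exists>k\<le>m. xs ! k = s" if "s \<in> G" for s
    using that len unfolding set[symmetric] in_set_conv_nth by (auto simp: less_Suc_eq_le)
  show thesis
  proof (rule that)
    show u0: "u 0 = 0"
    proof -
      obtain k where "k \<le> m" "xs ! k = 0" using idx \<open>0 \<in> set xs\<close> set by auto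
      then have "xs ! 0 \<le> 0" using nth_mono[of 0 k] by simp
      moreover have "xs ! 0 \<in> G" using len set nth_mem[of 0 xs] by simp
      ultimately show ?thesis using Gb(1)[of "xs ! 0"] by (simp add: u_def)
    qed
    show "J \<subseteq> u ` {..m}"
    proof
      fix s assume "s \<in> J"
      then obtain k where "k \<le> m" "xs ! k = s" using idx[of s] by (auto simp: G_def)
      then show "s \<in> u ` {..m}" by (intro image_eqI[of _ _ k]) (auto simp: u_def)
    qed
    show "block_grid m u"
      unfolding block_grid_def
    proof (intro conjI allI impI)
      show "0 \<le> u 0" by (simp add: u0)
      show "mono u" by (intro monoI) (auto simp: u_def intro!: nth_mono)
      fix i assume i: "i < m"
      have a: "u i = xs ! i" "u (Suc i) = xs ! Suc i" using i by (simp_all add: u_def min_def)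
      have inG: "xs ! i \<in> G" "xs ! Suc i \<in> G" using i len set nth_mem[of i xs] nth_mem[of "Suc i" xs] by auto
      have lt: "xs ! i < xs ! Suc i"
        using nth_mono[of i "Suc i"] i len dst by (auto simp: nth_eq_iff_index_eq order.strict_iff_order)
      \<comment> \<open>The last partition point not after \<open>xs ! i\<close>. Its successor is
        itself a grid point, so \<open>xs ! Suc i\<close> cannot lie beyond it.\<close>
      define n where "n = Max {n. n \<le> n0 \<and> tp n \<le> xs ! i}"
      have fin: "finite {n. n \<le> n0 \<and> tp n \<le> xs ! i}" by (rule finite_subset[of _ "{..n0}"]) auto
      have "0 \<in> {n. n \<le> n0 \<and> tp n \<le> xs ! i}" using Gb(1)[OF inG(1)] tp0 by simp
      then have "n \<in> {n. n \<le> n0 \<and> tp n \<le> xs ! i}" unfolding n_def by (intro Max_in[OF fin]) blast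
      then have n: "n \<le> n0" "tp n \<le> xs ! i" by auto
      have "n \<noteq> n0" using n Gb(2)[OF inG(2)] lt by auto
      then have Sn: "Suc n \<le> n0" using n by simp
      have gt: "xs ! i < tp (Suc n)"
      proof (rule ccontr)
        assume "\<not> xs ! i < tp (Suc n)"
        then have "Suc n \<in> {n. n \<le> n0 \<and> tp n \<le> xs ! i}" using Sn by simp
        from Max_ge[OF fin this] have "Suc n \<le> n" by (simp only: n_def)
        then show False by simp
      qed
      have "tp (Suc n) \<in> G" using Sn by (simp add: G_def)
      then obtain k where k: "k \<le> m" "xs ! k = tp (Suc n)" using idx by blast
      have "\<not> k \<le> i" using nth_mono[of k i] k gt i by auto
      then have "xs ! Suc i \<le> tp (Suc n)" using nth_mono[of "Suc i" k] k by simp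
      then show "\<exists>n. tp n \<le> u i \<and> u (Suc i) \<le> tp (Suc n)" using n a by auto
    qed
  qed
qed

lemma X_telescope: "c \<le> k \<Longrightarrow> (\<Sum>i\<in>{c..<k}. X (u (Suc i)) \<omega> - X (u i) \<omega>) = X (u k) \<omega> - X (u c) \<omega>"
  by (rule sum_Suc_diff')

text \<open>Values of X relative to the start are partial sums of grid increments, so both events
  are preimages of one set E, under the increments on the grid and on the shifted grid.\<close>

lemma X_fdd_shift:
  assumes J: "finite J" "J \<subseteq> {0..}" and B: "\<And>j. j \<in> J \<Longrightarrow> B j \<in> sets borel"
  shows "emeasure M {\<omega>\<in>space M. \<forall>j\<in>J. X (\<tau> + j) \<omega> - X \<tau> \<omega> \<in> B j} = emeasure M {\<omega>\<in>space M. \<forall>j\<in>J. X j \<omega> \<in> B j}"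
proof -
  let ?S = "{\<omega>\<in>space M. \<forall>j\<in>J. X j \<omega> \<in> B j}"
  let ?S' = "{\<omega>\<in>space M. \<forall>j\<in>J. X (\<tau> + j) \<omega> - X \<tau> \<omega> \<in> B j}"
  obtain m u where u0: "u 0 = 0" and u: "block_grid m u" and Ju: "J \<subseteq> u ` {..m}"
    using block_grid_exists[OF J] .
  have "\<forall>j\<in>J. \<exists>k. k \<le> m \<and> u k = j"
  proof
    fix j assume "j \<in> J"
    then have "j \<in> u ` {..m}" using Ju by blast
    then show "\<exists>k. k \<le> m \<and> u k = j" by blast
  qed
  then obtain k where k: "\<And>j. j \<in> J \<Longrightarrow> k j \<le> m \<and> u (k j) = j" by metis
  let ?P = "PiM {..<m} (\<lambda>_. borel :: real measure)"
  let ?V = "\<lambda>u \<omega>. \<lambda>i\<in>{..<m}. X (u (Suc i)) \<omega> - X (u i) \<omega>"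
  define E where "E = {x\<in>space ?P. \<forall>j\<in>J. (\<Sum>i\<in>{0..<k j}. x i) \<in> B j}"
  have "(\<lambda>x. \<Sum>i\<in>{0..<k j}. x i) \<in> borel_measurable ?P" if "j \<in> J" for j
    using k[OF that] by (intro borel_measurable_sum measurable_component_singleton) auto
  then have E: "E \<in> sets ?P"
    unfolding E_def using B J(1) by (intro sets.sets_Collect_finite_All) (auto intro!: measurable_sets_Collect)
  have key: "emeasure M {\<omega>\<in>space M. \<forall>j\<in>J. X (v (k j)) \<omega> - X (v 0) \<omega> \<in> B j} = emeasure (distr M ?P (?V v)) E"
    if v: "block_grid m v" for v
  proof -
    have "?V v \<in> measurable M ?P"
      using block_grid_nonneg[OF v] by (intro measurable_restrict borel_measurable_diff X_rv)
    moreover have "?V v -` E \<inter> space M = {\<omega>\<in>space M. \<forall>j\<in>J. X (v (k j)) \<omega> - X (v 0) \<omega> \<in> B j}"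
    proof -
      have "(\<Sum>i\<in>{0..<k j}. ?V v \<omega> i) = X (v (k j)) \<omega> - X (v 0) \<omega>" if "j \<in> J" for j \<omega>
      proof -
        have "(\<Sum>i\<in>{0..<k j}. ?V v \<omega> i) = (\<Sum>i\<in>{0..<k j}. X (v (Suc i)) \<omega> - X (v i) \<omega>)"
          using k[OF that] by (intro sum.cong) auto
        then show ?thesis by (simp only: X_telescope[OF le0])
      qed
      then show ?thesis by (auto simp: E_def space_PiM)
    qed
    ultimately show ?thesis using E by (simp add: emeasure_distr)
  qed
  have "distr M ?P (?V (\<lambda>i. \<tau> + u i)) = distr M ?P (?V u)"
    unfolding X_increments_distr[OF u] X_increments_distr[OF block_grid_shift[OF u]]
    by (intro PiM_cong refl X_increment_distr_shift[OF u]) simp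
  then have "emeasure M {\<omega>\<in>space M. \<forall>j\<in>J. X (\<tau> + u (k j)) \<omega> - X (\<tau> + u 0) \<omega> \<in> B j}
      = emeasure M {\<omega>\<in>space M. \<forall>j\<in>J. X (u (k j)) \<omega> - X (u 0) \<omega> \<in> B j}"
    using key[OF u] key[OF block_grid_shift[OF u]] by simp
  moreover have "{\<omega>\<in>space M. \<forall>j\<in>J. X (\<tau> + u (k j)) \<omega> - X (\<tau> + u 0) \<omega> \<in> B j}
      = ?S'"
    using k u0 by auto
  moreover have "{\<omega>\<in>space M. \<forall>j\<in>J. X (u (k j)) \<omega> - X (u 0) \<omega> \<in> B j} = ?S"
    using k u0 X_0 by auto
  ultimately show ?thesis by metis
qed

text \<open>The grid is made to contain \<tau>, at index c: the past is a function of the increments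
  before c, the future of those from c on.\<close>

lemma X_fdd_indep:
  assumes J: "finite J" "J \<subseteq> {0..\<tau>}" and J': "finite J'" "J' \<subseteq> {0..}"
    and B: "\<And>j. j \<in> J \<Longrightarrow> B j \<in> sets borel" and B': "\<And>j. j \<in> J' \<Longrightarrow> B' j \<in> sets borel"
  shows "prob ({\<omega>\<in>space M. \<forall>j\<in>J. X j \<omega> \<in> B j} \<inter> {\<omega>\<in>space M. \<forall>j\<in>J'. X (\<tau> + j) \<omega> - X \<tau> \<omega> \<in> B' j})
    = prob {\<omega>\<in>space M. \<forall>j\<in>J. X j \<omega> \<in> B j} * prob {\<omega>\<in>space M. \<forall>j\<in>J'. X (\<tau> + j) \<omega> - X \<tau> \<omega> \<in> B' j}"
proof -
  let ?S = "{\<omega>\<in>space M. \<forall>j\<in>J. X j \<omega> \<in> B j}"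
  let ?S' = "{\<omega>\<in>space M. \<forall>j\<in>J'. X (\<tau> + j) \<omega> - X \<tau> \<omega> \<in> B' j}"
  have "finite (insert \<tau> J \<union> (+) \<tau> ` J')" "insert \<tau> J \<union> (+) \<tau> ` J' \<subseteq> {0..}"
    using J J' tau_pos by auto
  then obtain m u where u0: "u 0 = 0" and u: "block_grid m u" and Ju: "insert \<tau> J \<union> (+) \<tau> ` J' \<subseteq> u ` {..m}"
    by (rule block_grid_exists)
  have um: "mono u" using u by (simp add: block_grid_def)
  obtain c where c: "c \<le> m" "u c = \<tau>" using Ju by auto
  \<comment> \<open>The grid may repeat values, so an index for j can exceed c; this happens only
    for j = \<tau>, and then c itself serves.\<close>
  have "\<exists>k\<le>c. u k = j" if j: "j \<in> J" for j
  proof -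
    obtain k where k: "k \<le> m" "u k = j" using Ju j by auto
    show ?thesis
    proof (cases "k \<le> c")
      case False
      then have "\<tau> \<le> j" using monoD[OF um, of c k] k c by simp
      then have "j = \<tau>" using j J by auto
      then show ?thesis using c by auto
    qed (use k in auto)
  qed
  then obtain k where k: "\<And>j. j \<in> J \<Longrightarrow> k j \<le> c \<and> u (k j) = j" by metis
  have "\<exists>k\<ge>c. k \<le> m \<and> u k = \<tau> + j" if j: "j \<in> J'" for j
  proof -
    obtain k where k: "k \<le> m" "u k = \<tau> + j" using Ju j by auto
    show ?thesis
    proof (cases "c \<le> k")
      case False
      then have "\<tau> + j \<le> \<tau>" using monoD[OF um, of k c] k c by simp
      then have "j = 0" using j J' by auto
      then show ?thesis using c by auto
    qed (use k in auto)
  qed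
  then obtain k' where k': "\<And>j. j \<in> J' \<Longrightarrow> c \<le> k' j \<and> k' j \<le> m \<and> u (k' j) = \<tau> + j" by metis
  let ?dX = "\<lambda>i \<omega>. X (u (Suc i)) \<omega> - X (u i) \<omega>"
  let ?P = "PiM {..<c} (\<lambda>_. borel :: real measure)" and ?P' = "PiM {c..<m} (\<lambda>_. borel :: real measure)"
  have ind: "indep_var ?P (\<lambda>\<omega>. restrict (\<lambda>i. ?dX i \<omega>) {..<c}) ?P' (\<lambda>\<omega>. restrict (\<lambda>i. ?dX i \<omega>) {c..<m})"
    by (rule indep_var_restrict[OF X_increments_indep[OF u]]) (use c in auto)
  define E where "E = {x\<in>space ?P. \<forall>j\<in>J. (\<Sum>i\<in>{0..<k j}. x i) \<in> B j}"
  define E' where "E' = {x\<in>space ?P'. \<forall>j\<in>J'. (\<Sum>i\<in>{c..<k' j}. x i) \<in> B' j}"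
  have "(\<lambda>x. \<Sum>i\<in>{0..<k j}. x i) \<in> borel_measurable ?P" if "j \<in> J" for j
    using k[OF that] by (intro borel_measurable_sum measurable_component_singleton) auto
  then have E: "E \<in> sets ?P"
    unfolding E_def using B J(1) by (intro sets.sets_Collect_finite_All) (auto intro!: measurable_sets_Collect)
  have "(\<lambda>x. \<Sum>i\<in>{c..<k' j}. x i) \<in> borel_measurable ?P'" if "j \<in> J'" for j
    using k'[OF that] by (intro borel_measurable_sum measurable_component_singleton) auto
  then have E': "E' \<in> sets ?P'"
    unfolding E'_def using B' J'(1) by (intro sets.sets_Collect_finite_All) (auto intro!: measurable_sets_Collect)
  have 1: "(\<lambda>\<omega>. restrict (\<lambda>i. ?dX i \<omega>) {..<c}) -` E \<inter> space M = ?S"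
  proof -
    have "(\<Sum>i\<in>{0..<k j}. restrict (\<lambda>i. ?dX i \<omega>) {..<c} i) = X j \<omega>" if "j \<in> J" "\<omega> \<in> space M" for j \<omega>
    proof -
      have "(\<Sum>i\<in>{0..<k j}. restrict (\<lambda>i. ?dX i \<omega>) {..<c} i) = (\<Sum>i\<in>{0..<k j}. ?dX i \<omega>)"
        using k[OF that(1)] by (intro sum.cong) auto
      then show ?thesis using X_telescope[of 0 "k j" u \<omega>] X_0[OF that(2)] k[OF that(1)] u0 by simp
    qed
    then show ?thesis by (auto simp: E_def space_PiM)
  qed
  have 2: "(\<lambda>\<omega>. restrict (\<lambda>i. ?dX i \<omega>) {c..<m}) -` E' \<inter> space M
      = ?S'"
  proof -
    have "(\<Sum>i\<in>{c..<k' j}. restrict (\<lambda>i. ?dX i \<omega>) {c..<m} i) = X (\<tau> + j) \<omega> - X \<tau> \<omega>" if "j \<in> J'" for j \<omega>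
    proof -
      have "(\<Sum>i\<in>{c..<k' j}. restrict (\<lambda>i. ?dX i \<omega>) {c..<m} i) = (\<Sum>i\<in>{c..<k' j}. ?dX i \<omega>)"
        using k'[OF that(1)] by (intro sum.cong) auto
      then show ?thesis using X_telescope[of c "k' j" u \<omega>] k'[OF that(1)] c by simp
    qed
    then show ?thesis by (auto simp: E'_def space_PiM)
  qed
  have "(\<lambda>\<omega>. (restrict (\<lambda>i. ?dX i \<omega>) {..<c}, restrict (\<lambda>i. ?dX i \<omega>) {c..<m})) -` (E \<times> E') \<inter> space M
     = ?S \<inter> ?S'"
    unfolding 1[symmetric] 2[symmetric] by auto
  with indep_varD[OF ind E E'] show ?thesis by (simp only: 1 2)
qed

section \<open>The path process and its restart after one period\<close>

lemma X_process_indep: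
  "indep_rv (PiM {0..\<tau>} (\<lambda>_. borel)) (\<lambda>\<omega>. \<lambda>u\<in>{0..\<tau>}. X u \<omega>)
     (PiM {0..} (\<lambda>_. borel)) (\<lambda>\<omega>. \<lambda>u\<in>{0..}. X (\<tau> + u) \<omega> - X \<tau> \<omega>)"
proof (rule indep_rv_processI)
  show "X u \<in> borel_measurable M" if "u \<in> {0..\<tau>}" for u using that by auto
  show "(\<lambda>\<omega>. X (\<tau> + u) \<omega> - X \<tau> \<omega>) \<in> borel_measurable M" if "u \<in> {0..}" for u
    using that tau_pos by (intro borel_measurable_diff X_rv) auto
qed (rule X_fdd_indep)

lemma X_process_shift:
  "distr M (PiM {0..} (\<lambda>_. borel)) (\<lambda>\<omega>. \<lambda>u\<in>{0..}. X (\<tau> + u) \<omega> - X \<tau> \<omega>)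
    = distr M (PiM {0..} (\<lambda>_. borel)) (\<lambda>\<omega>. \<lambda>u\<in>{0..}. X u \<omega>)"
proof (rule measure_eqI_PiM_infinite[where I="{0..}" and M="\<lambda>_. borel"])
  let ?P = "PiM {0::real..} (\<lambda>_. borel :: real measure)"
  let ?XS = "\<lambda>\<omega>. \<lambda>u\<in>{0..}. X (\<tau> + u) \<omega> - X \<tau> \<omega>" and ?XU = "\<lambda>\<omega>. \<lambda>u\<in>{0..}. X u \<omega>"
  have rv: "(\<lambda>\<omega>. X (\<tau> + u) \<omega> - X \<tau> \<omega>) \<in> borel_measurable M" if "u \<in> {0..}" for u
    using that tau_pos by (intro borel_measurable_diff X_rv) auto
  have m1: "?XS \<in> measurable M ?P"
    by (rule measurable_restrict) (rule rv)
  have m2: "?XU \<in> measurable M ?P"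
    by (rule measurable_restrict) auto
  show "finite_measure (distr M ?P ?XS)"
    using m1 by (rule finite_measure_distr)
  fix B :: "real \<Rightarrow> real set" and J assume J: "finite J" "J \<subseteq> {0..}" and B: "\<And>i. i \<in> J \<Longrightarrow> B i \<in> sets borel"
  let ?E = "prod_emb {0..} (\<lambda>_. borel) J (Pi\<^sub>E J B)"
  have E: "?E \<in> sets ?P"
    using J B by (intro sets_PiM_I) auto
  show "emeasure (distr M ?P ?XS) ?E
      = emeasure (distr M ?P ?XU) ?E"
    unfolding emeasure_distr[OF m1 E] emeasure_distr[OF m2 E] vimage_prod_emb_process[OF J(2)]
    by (rule X_fdd_shift[OF J B])
qed simp_all

text \<open>Both joint laws are products: the right one by hypothesis, the left one because W, the
  path on [0, \<tau>] and the path after \<tau> are mutually independent. The second factors agree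
  by \<open>X_process_shift\<close>, the first by \<open>inv\<close>, which is the fixed point
  equation with the path integrated out.\<close>

lemma restart:
  fixes W :: "'a \<Rightarrow> 'b" and \<Psi> :: "'b \<Rightarrow> (real \<Rightarrow> real) \<Rightarrow> 'b"
  assumes ind: "indep_rv S W (PiM {0..} (\<lambda>_. borel)) (\<lambda>\<omega>. \<lambda>u\<in>{0..}. X u \<omega>)"
    and \<Psi>: "(\<lambda>p. \<Psi> (fst p) (snd p)) \<in> measurable (S \<Otimes>\<^sub>M PiM {0..\<tau>} (\<lambda>_. borel)) S"
    and inv: "\<And>A. A \<in> sets S \<Longrightarrow> emeasure (distr M S W) A
      = (\<integral>\<^sup>+\<omega>. emeasure (distr M S W) {y\<in>space S. \<Psi> y (\<lambda>u\<in>{0..\<tau>}. X u \<omega>) \<in> A} \<partial>M)"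
  shows "distr M (S \<Otimes>\<^sub>M PiM {0..} (\<lambda>_. borel)) (\<lambda>\<omega>. (\<Psi> (W \<omega>) (\<lambda>u\<in>{0..\<tau>}. X u \<omega>), \<lambda>u\<in>{0..}. X (\<tau> + u) \<omega> - X \<tau> \<omega>))
    = distr M (S \<Otimes>\<^sub>M PiM {0..} (\<lambda>_. borel)) (\<lambda>\<omega>. (W \<omega>, \<lambda>u\<in>{0..}. X u \<omega>))"
proof -
  let ?T = "PiM {0..\<tau>::real} (\<lambda>_. borel :: real measure)" and ?U = "PiM {0::real..} (\<lambda>_. borel :: real measure)"
  define XT where "XT \<omega> = (\<lambda>u\<in>{0..\<tau>}. X u \<omega>)" for \<omega>
  define XU where "XU \<omega> = (\<lambda>u\<in>{0..}. X u \<omega>)" for \<omega>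
  define XS where "XS \<omega> = (\<lambda>u\<in>{0..}. X (\<tau> + u) \<omega> - X \<tau> \<omega>)" for \<omega>
  \<comment> \<open>The two pieces of the path are read off from the whole path, so the independence
    of W from \<open>XU\<close> covers them jointly.\<close>
  define \<rho> :: "(real \<Rightarrow> real) \<Rightarrow> real \<Rightarrow> real" where "\<rho> x = (\<lambda>u\<in>{0..\<tau>}. x u)" for x
  define \<sigma> :: "(real \<Rightarrow> real) \<Rightarrow> real \<Rightarrow> real" where "\<sigma> x = (\<lambda>u\<in>{0..}. x (\<tau> + u) - x \<tau>)" for x
  have \<rho>: "\<rho> \<in> measurable ?U ?T"
    unfolding \<rho>_def by (rule measurable_restrict) (auto intro!: measurable_component_singleton)
  have \<sigma>: "\<sigma> \<in> measurable ?U ?U"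
    unfolding \<sigma>_def using tau_pos
    by (intro measurable_restrict borel_measurable_diff measurable_component_singleton) auto
  have \<rho>XU: "\<rho> (XU \<omega>) = XT \<omega>" and \<sigma>XU: "\<sigma> (XU \<omega>) = XS \<omega>" for \<omega>
    using tau_pos by (auto simp: \<rho>_def \<sigma>_def XU_def XT_def XS_def fun_eq_iff restrict_def)
  have ind: "indep_rv S W ?U XU" using ind by (simp add: XU_def[abs_def])
  have W: "W \<in> measurable M S" and XU: "XU \<in> measurable M ?U"
    using indep_rvD(1,2)[OF ind] by auto
  have XT: "XT \<in> measurable M ?T" using measurable_compose[OF XU \<rho>] by (simp add: \<rho>XU)
  have XS: "XS \<in> measurable M ?U" using measurable_compose[OF XU \<sigma>] by (simp add: \<sigma>XU)
  have indX: "indep_rv ?T XT ?U XS" using X_process_indep by (simp add: XT_def[abs_def] XS_def[abs_def])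
  note prod2 = indep_rvD(3)[OF indX] and prodW = indep_rvD(3)[OF ind]
  have "indep_rv (S \<Otimes>\<^sub>M ?T) (\<lambda>\<omega>. (W \<omega>, XT \<omega>)) ?U XS"
  proof (rule indep_rv_PairI[OF W XT XS])
    fix a b c assume a: "a \<in> sets S" and b: "b \<in> sets ?T" and c: "c \<in> sets ?U"
    let ?Wa = "{\<omega>\<in>space M. W \<omega> \<in> a}"
    let ?Tb = "{\<omega>\<in>space M. XT \<omega> \<in> b}"
    let ?Sc = "{\<omega>\<in>space M. XS \<omega> \<in> c}"
    let ?WT = "{\<omega>\<in>space M. W \<omega> \<in> a \<and> XT \<omega> \<in> b}"
    let ?b = "\<rho> -` b \<inter> space ?U"
    let ?c = "\<sigma> -` c \<inter> space ?U"
    have b': "?b \<in> sets ?U" and c': "?c \<in> sets ?U"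
      using measurable_sets[OF \<rho> b] measurable_sets[OF \<sigma> c] by auto
    have iff: "XU \<omega> \<in> ?b \<longleftrightarrow> XT \<omega> \<in> b" "XU \<omega> \<in> ?c \<longleftrightarrow> XS \<omega> \<in> c" if "\<omega> \<in> space M" for \<omega>
      using measurable_space[OF XU that] by (auto simp: \<rho>XU \<sigma>XU)
    \<comment> \<open>W is split off from the whole path, the path is split at \<tau>, and W is then
      joined again with the part up to \<tau>.\<close>
    have "?WT \<inter> ?Sc
        = ?Wa \<inter> {\<omega>\<in>space M. XU \<omega> \<in> ?b \<inter> ?c}"
      using iff by blast
    then have "prob (?WT \<inter> ?Sc)
        = prob ?Wa * prob {\<omega>\<in>space M. XU \<omega> \<in> ?b \<inter> ?c}"
      using prodW[OF a sets.Int[OF b' c']] by simp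
    also have "{\<omega>\<in>space M. XU \<omega> \<in> ?b \<inter> ?c} = ?Tb \<inter> ?Sc"
      using iff by blast
    also have "prob \<dots> = prob ?Tb * prob ?Sc"
      by (rule prod2[OF b c])
    also have "?Tb = {\<omega>\<in>space M. XU \<omega> \<in> ?b}"
      using iff by blast
    also have "prob ?Wa * (prob {\<omega>\<in>space M. XU \<omega> \<in> ?b} * prob ?Sc)
        = prob (?Wa \<inter> {\<omega>\<in>space M. XU \<omega> \<in> ?b}) * prob ?Sc"
      unfolding prodW[OF a b'] by (simp only: mult.assoc)
    also have "?Wa \<inter> {\<omega>\<in>space M. XU \<omega> \<in> ?b} = ?WT"
      using iff by blast
    finally show "prob (?WT \<inter> ?Sc)
       = prob ?WT * prob ?Sc" .
  qed
  from indep_rv_compose[OF this \<Psi> measurable_ident]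
  have "indep_rv S (\<lambda>\<omega>. \<Psi> (W \<omega>) (XT \<omega>)) ?U XS" by simp
  note W'S = indep_rv_distr[OF this] and WU = indep_rv_distr[OF ind]
  have "indep_rv S W ?T XT"
    using indep_rv_compose[OF ind measurable_ident \<rho>] by (simp add: \<rho>XU)
  note WT = indep_rv_distr[OF this]
  have WTm: "(\<lambda>\<omega>. (W \<omega>, XT \<omega>)) \<in> measurable M (S \<Otimes>\<^sub>M ?T)" using W XT by simp
  have law: "distr M S (\<lambda>\<omega>. \<Psi> (W \<omega>) (XT \<omega>)) = distr M S W"
  proof (rule measure_eqI)
    fix A assume "A \<in> sets (distr M S (\<lambda>\<omega>. \<Psi> (W \<omega>) (XT \<omega>)))"
    then have A: "A \<in> sets S" by simp
    interpret DW: prob_space "distr M S W" by (rule prob_space_distr[OF W])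
    interpret DT: prob_space "distr M ?T XT" by (rule prob_space_distr[OF XT])
    interpret P: pair_sigma_finite "distr M S W" "distr M ?T XT" ..
    let ?A = "(\<lambda>p. \<Psi> (fst p) (snd p)) -` A \<inter> space (S \<Otimes>\<^sub>M ?T)"
    have A': "?A \<in> sets (S \<Otimes>\<^sub>M ?T)" by (rule measurable_sets[OF \<Psi> A])
    have "emeasure (distr M S (\<lambda>\<omega>. \<Psi> (W \<omega>) (XT \<omega>))) A = emeasure (distr (distr M (S \<Otimes>\<^sub>M ?T) (\<lambda>\<omega>. (W \<omega>, XT \<omega>))) S (\<lambda>p. \<Psi> (fst p) (snd p))) A"
      by (simp add: distr_distr[OF \<Psi> WTm] comp_def)
    also have "\<dots> = emeasure (distr M S W \<Otimes>\<^sub>M distr M ?T XT) ?A"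
      using A \<Psi> by (subst emeasure_distr) (simp_all add: WT)
    \<comment> \<open>Fubini with the path held fixed: the inner term, the law of W on a section, is
      the integrand of \<open>inv\<close>.\<close>
    also have "\<dots> = (\<integral>\<^sup>+x. emeasure (distr M S W) ((\<lambda>y. (y, x)) -` ?A) \<partial>distr M ?T XT)"
      using A' by (intro P.emeasure_pair_measure_alt2) (simp add: sets_pair_measure_cong[OF sets_distr sets_distr])
    also have "\<dots> = (\<integral>\<^sup>+\<omega>. emeasure (distr M S W) ((\<lambda>y. (y, XT \<omega>)) -` ?A) \<partial>M)"
      using P.measurable_emeasure_Pair2[of ?A] A' XT
      by (intro nn_integral_distr) (simp_all add: sets_pair_measure_cong[OF sets_distr sets_distr])
    also have "\<dots> = (\<integral>\<^sup>+\<omega>. emeasure (distr M S W) {y\<in>space S. \<Psi> y (XT \<omega>) \<in> A} \<partial>M)"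
    proof (intro nn_integral_cong arg_cong[where f="emeasure (distr M S W)"])
      fix \<omega> assume "\<omega> \<in> space M"
      then have "XT \<omega> \<in> space ?T" by (rule measurable_space[OF XT])
      then show "(\<lambda>y. (y, XT \<omega>)) -` ?A = {y\<in>space S. \<Psi> y (XT \<omega>) \<in> A}" by (auto simp: space_pair_measure)
    qed
    also have "\<dots> = emeasure (distr M S W) A" unfolding XT_def by (rule inv[OF A, symmetric])
    finally show "emeasure (distr M S (\<lambda>\<omega>. \<Psi> (W \<omega>) (XT \<omega>))) A = emeasure (distr M S W) A" .
  qed simp
  have "distr M (S \<Otimes>\<^sub>M ?U) (\<lambda>\<omega>. (\<Psi> (W \<omega>) (XT \<omega>), XS \<omega>)) = distr M (S \<Otimes>\<^sub>M ?U) (\<lambda>\<omega>. (W \<omega>, XU \<omega>))"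
    unfolding W'S[symmetric] WU[symmetric] law using X_process_shift by (simp add: XS_def[abs_def] XU_def[abs_def])
  then show ?thesis by (simp add: XT_def XS_def XU_def)
qed

end

section \<open>Periodic stationarity\<close>

lemma vimage_Int_space: "f -` A \<inter> space M = {\<omega>\<in>space M. f \<omega> \<in> A}"
  by auto

text \<open>Members of \<open>indep_set\<close> are events, so independence of the generated
  sigma-algebras already contains the measurability of f and g.\<close>

lemma (in prob_space) indep_rv_vimage:
  assumes f: "f \<in> space M \<rightarrow> space S" and g: "g \<in> space M \<rightarrow> space T"
    and ind: "indep_set (sets (vimage_algebra (space M) f S)) (sets (vimage_algebra (space M) g T))"
  shows "indep_rv S f T g"
  unfolding indep_rv_def
proof (intro conjI ballI)
  show "f \<in> measurable M S"
    using f indep_setD_ev1[OF ind] by (intro measurableI) (auto intro: in_vimage_algebra)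
  show "g \<in> measurable M T"
    using g indep_setD_ev2[OF ind] by (intro measurableI) (auto intro: in_vimage_algebra)
  fix a b assume "a \<in> sets S" "b \<in> sets T"
  from indep_setD[OF ind in_vimage_algebra[OF this(1)] in_vimage_algebra[OF this(2)]]
  show "prob ({\<omega>\<in>space M. f \<omega> \<in> a} \<inter> {\<omega>\<in>space M. g \<omega> \<in> b}) = prob {\<omega>\<in>space M. f \<omega> \<in> a} * prob {\<omega>\<in>space M. g \<omega> \<in> b}"
    by (simp add: vimage_def Int_def conj_ac)
qed

locale cogarch = marked_process M \<tau> l tp lam N F Z
  for M :: "'a measure" and \<tau> l tp lam N F Z +
  fixes q :: nat and \<alpha>0 :: real and \<alpha> \<beta> :: "nat \<Rightarrow> real" and Y :: "real \<Rightarrow> 'a \<Rightarrow> nat \<Rightarrow> real"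
  assumes Y_meas: "\<And>u. 0 \<le> u \<Longrightarrow> (\<lambda>\<omega>. \<lambda>i\<in>{..<q}. Y u \<omega> i) \<in> measurable M (PiM {..<q} (\<lambda>_. borel))"
    and Y0_indep: "indep_rv (PiM {..<q} (\<lambda>_. borel)) (\<lambda>\<omega>. \<lambda>i\<in>{..<q}. Y 0 \<omega> i)
      (PiM {0..} (\<lambda>_. borel)) (\<lambda>\<omega>. \<lambda>u\<in>{0..}. X u \<omega>)"
    and Y_path: "\<And>\<omega>. \<omega> \<in> space M \<Longrightarrow>
      cogarch_path (\<lambda>u. N u \<omega>) q (Bmat q \<beta>) \<alpha>0 \<alpha> (\<lambda>n. mark tp l Z N n \<omega>) (\<lambda>u. Y u \<omega>)"
    and Y0_U0: "\<And>E. E \<in> sets (PiM {..<q} (\<lambda>_. borel)) \<Longrightarrow>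
         emeasure (distr M (PiM {..<q} (\<lambda>_. borel)) (\<lambda>\<omega>. \<lambda>i\<in>{..<q}. Y 0 \<omega> i)) E
         = (\<integral>\<^sup>+\<omega>. emeasure (distr M (PiM {..<q} (\<lambda>_. borel)) (\<lambda>\<omega>. \<lambda>i\<in>{..<q}. Y 0 \<omega> i))
               (affmap q (Jst q \<alpha> \<beta> (\<lambda>u. N u \<omega>) (\<lambda>n. arrival N n \<omega>) (\<lambda>n. mark tp l Z N n \<omega>) 0 \<tau>)
                         (Kst q \<alpha>0 \<alpha> \<beta> (\<lambda>u. N u \<omega>) (\<lambda>n. arrival N n \<omega>) (\<lambda>n. mark tp l Z N n \<omega>) 0 \<tau>)
                 -` E \<inter> space (PiM {..<q} (\<lambda>_. borel))) \<partial>M)"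
begin

abbreviation PQ :: "(nat \<Rightarrow> real) measure" where "PQ \<equiv> PiM {..<q} (\<lambda>_. borel)"

abbreviation PU :: "(real \<Rightarrow> real) measure" where "PU \<equiv> PiM {0..} (\<lambda>_. borel)"

definition state :: "real \<Rightarrow> 'a \<Rightarrow> nat \<Rightarrow> real" where
  "state u \<omega> = (\<lambda>i\<in>{..<q}. Y u \<omega> i)"

abbreviation \<Psi> :: "real \<Rightarrow> (nat \<Rightarrow> real) \<Rightarrow> (real \<Rightarrow> real) \<Rightarrow> nat \<Rightarrow> real" where
  "\<Psi> \<equiv> solution_map q (Bmat q \<beta>) \<alpha>0 \<alpha>"

lemma state_rv: "0 \<le> u \<Longrightarrow> state u \<in> measurable M PQ"
  using Y_meas[of u] by (simp add: state_def[abs_def])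

lemma skip_free_path: "AE \<omega> in M. counting_path.skip_free (\<lambda>u. N u \<omega>)"
  using skip_free_AE
proof (rule AE_mp, intro AE_I2 impI)
  fix \<omega> assume \<omega>: "\<omega> \<in> space M" and sf: "\<forall>u\<ge>0. \<forall>k\<le>N u \<omega>. \<exists>v\<ge>0. N v \<omega> = k"
  interpret counting_path "\<lambda>u. N u \<omega>" by (rule counting_path[OF \<omega>])
  show "skip_free" using sf by (simp add: skip_free_def)
qed

lemma state_solution:
  assumes s: "0 \<le> s" "0 \<le> t"
  shows "AE \<omega> in M. state (s + t) \<omega> = \<Psi> t (state s \<omega>) (\<lambda>u\<in>{0..}. X (s + u) \<omega> - X s \<omega>)"
  using skip_free_path
proof (rule AE_mp, intro AE_I2 impI)
  fix \<omega> assume \<omega>: "\<omega> \<in> space M" and sf: "counting_path.skip_free (\<lambda>u. N u \<omega>)"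
  interpret cogarch_path "\<lambda>u. N u \<omega>" q "Bmat q \<beta>" \<alpha>0 \<alpha> "\<lambda>n. mark tp l Z N n \<omega>" "\<lambda>u. Y u \<omega>"
    by (rule Y_path[OF \<omega>])
  have "state (s + t) \<omega> = \<Psi> t (Y s \<omega>) (\<lambda>u. X (s + u) \<omega> - X s \<omega>)"
    using solution[OF sf s] by (simp add: state_def X_def)
  also have "\<dots> = \<Psi> t (state s \<omega>) (\<lambda>u\<in>{0..}. X (s + u) \<omega> - X s \<omega>)"
    by (rule solution_map_cong[OF s(2)]) (auto simp: state_def)
  finally show "state (s + t) \<omega> = \<Psi> t (state s \<omega>) (\<lambda>u\<in>{0..}. X (s + u) \<omega> - X s \<omega>)" .
qed

lemma \<Psi>_measurable: "0 \<le> t \<Longrightarrow> {0..t} \<subseteq> I \<Longrightarrow>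
    (\<lambda>p. \<Psi> t (fst p) (snd p)) \<in> measurable (PQ \<Otimes>\<^sub>M PiM I (\<lambda>_. borel)) PQ"
  by (rule solution_map_measurable)

text \<open>Here J and K leave the proof: for almost every path their affine map is \<Psi> applied
  to the path of X on [0, \<tau>], so the fixed point equation becomes the premise
  \<open>inv\<close> of \<open>restart\<close>.\<close>

lemma state_0_invariant:
  assumes A: "A \<in> sets PQ"
  shows "emeasure (distr M PQ (state 0)) A
      = (\<integral>\<^sup>+\<omega>. emeasure (distr M PQ (state 0)) {y\<in>space PQ. \<Psi> \<tau> y (\<lambda>u\<in>{0..\<tau>}. X u \<omega>) \<in> A} \<partial>M)"
proof -
  let ?aff = "\<lambda>\<omega>. affmap q
    (Jst q \<alpha> \<beta> (\<lambda>u. N u \<omega>) (\<lambda>n. arrival N n \<omega>) (\<lambda>n. mark tp l Z N n \<omega>) 0 \<tau>)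
    (Kst q \<alpha>0 \<alpha> \<beta> (\<lambda>u. N u \<omega>) (\<lambda>n. arrival N n \<omega>) (\<lambda>n. mark tp l Z N n \<omega>) 0 \<tau>)"
  let ?E = "\<lambda>\<omega>. {y\<in>space PQ. \<Psi> \<tau> y (\<lambda>u\<in>{0..\<tau>}. X u \<omega>) \<in> A}"
  have "AE \<omega> in M. ?aff \<omega> -` A \<inter> space PQ = (?E \<omega>)"
    using skip_free_path
  proof (rule AE_mp, intro AE_I2 impI)
    fix \<omega> assume \<omega>: "\<omega> \<in> space M" and sf: "counting_path.skip_free (\<lambda>u. N u \<omega>)"
    interpret counting_path "\<lambda>u. N u \<omega>" by (rule counting_path[OF \<omega>])
    have arr: "arr = (\<lambda>n. arrival N n \<omega>)" using arr_eq_arrival[OF \<omega>] by (simp add: fun_eq_iff)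
    have "\<Psi> \<tau> y (\<lambda>u\<in>{0..\<tau>}. X u \<omega>) = \<Psi> \<tau> y (\<lambda>u. X u \<omega>)" for y
      using tau_pos by (intro solution_map_cong) auto
    also have "\<Psi> \<tau> y (\<lambda>u. X u \<omega>) = ?aff \<omega> y" for y
      unfolding X_def arr[symmetric] using tau_pos by (intro solution_map_affmap[OF sf]) simp
    finally show "?aff \<omega> -` A \<inter> space PQ = (?E \<omega>)"
      by auto
  qed
  then have "(\<integral>\<^sup>+\<omega>. emeasure (distr M PQ (state 0))
     (?aff \<omega> -` A \<inter> space PQ) \<partial>M)
    = (\<integral>\<^sup>+\<omega>. emeasure (distr M PQ (state 0)) (?E \<omega>) \<partial>M)"
    by (intro nn_integral_cong_AE) (erule AE_mp, auto intro!: AE_I2 simp only:)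
  then show ?thesis using Y0_U0[OF A] unfolding state_def[abs_def] by (simp only:)
qed

lemma state_0_indep: "indep_rv PQ (state 0) PU (\<lambda>\<omega>. \<lambda>u\<in>{0..}. X u \<omega>)"
  using Y0_indep unfolding state_def[abs_def] .

text \<open>One set C of pairs of a state and a path describes both events: evaluated at the state
  at 0 and the path from 0, or at the state at \<tau> and the path after \<tau>.
  \<open>restart\<close> says that the two pairs have the same law.\<close>

lemma state_shift:
  fixes n :: nat and s :: "nat \<Rightarrow> real"
  assumes s: "\<And>i. i < n \<Longrightarrow> 0 \<le> s i" and E: "\<And>i. i < n \<Longrightarrow> E i \<in> sets PQ"
  shows "prob {\<omega>\<in>space M. \<forall>i<n. state (s i + \<tau>) \<omega> \<in> E i} = prob {\<omega>\<in>space M. \<forall>i<n. state (s i) \<omega> \<in> E i}"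
proof -
  let ?S = "\<lambda>v. {\<omega>\<in>space M. \<forall>i\<in>{..<n}. state (v i) \<omega> \<in> E i}"
  define C where "C = {p\<in>space (PQ \<Otimes>\<^sub>M PU). \<forall>i\<in>{..<n}. \<Psi> (s i) (fst p) (snd p) \<in> E i}"
  have C: "C \<in> sets (PQ \<Otimes>\<^sub>M PU)"
    unfolding C_def using s E
    by (intro sets.sets_Collect_finite_All) (auto intro!: measurable_sets_Collect[OF \<Psi>_measurable])
  define XU where "XU \<omega> = (\<lambda>u\<in>{0..}. X u \<omega>)" for \<omega>
  define XS where "XS \<omega> = (\<lambda>u\<in>{0..}. X (\<tau> + u) \<omega> - X \<tau> \<omega>)" for \<omega>
  define XT where "XT \<omega> = (\<lambda>u\<in>{0..\<tau>}. X u \<omega>)" for \<omega>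
  have XU: "XU \<in> measurable M PU"
    unfolding XU_def by (rule measurable_restrict) auto
  have XS: "XS \<in> measurable M PU"
    unfolding XS_def using tau_pos by (intro measurable_restrict borel_measurable_diff X_rv) auto
  have XT: "XT \<in> measurable M (PiM {0..\<tau>} (\<lambda>_. borel))"
    unfolding XT_def by (rule measurable_restrict) auto
  have st0: "state 0 \<in> measurable M PQ" by (rule state_rv) simp
  have W': "(\<lambda>\<omega>. \<Psi> \<tau> (state 0 \<omega>) (XT \<omega>)) \<in> measurable M PQ"
    using measurable_compose[OF measurable_Pair[OF st0 XT] \<Psi>_measurable[of \<tau> "{0..\<tau>}"]] tau_pos by simp
  have law: "distr M (PQ \<Otimes>\<^sub>M PU) (\<lambda>\<omega>. (\<Psi> \<tau> (state 0 \<omega>) (XT \<omega>), XS \<omega>)) = distr M (PQ \<Otimes>\<^sub>M PU) (\<lambda>\<omega>. (state 0 \<omega>, XU \<omega>))"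
    unfolding XT_def XS_def XU_def
    using tau_pos by (intro restart state_0_indep \<Psi>_measurable state_0_invariant) auto
  have meas: "(?S v) \<in> sets M" if "\<And>i. i < n \<Longrightarrow> 0 \<le> v i" for v
    using E that by (intro sets.sets_Collect_finite_All) (auto intro!: measurable_sets_Collect[OF state_rv])
  have ev: "emeasure M (?S v) = emeasure (distr M (PQ \<Otimes>\<^sub>M PU) (\<lambda>\<omega>. (f \<omega>, g \<omega>))) C"
    if f: "f \<in> measurable M PQ" and g: "g \<in> measurable M PU" and v: "\<And>i. i < n \<Longrightarrow> 0 \<le> v i"
      and AE: "AE \<omega> in M. \<forall>i\<in>{..<n}. state (v i) \<omega> = \<Psi> (s i) (f \<omega>) (g \<omega>)" for f g v
  proof -
    have fg: "(\<lambda>\<omega>. (f \<omega>, g \<omega>)) \<in> measurable M (PQ \<Otimes>\<^sub>M PU)" using f g by simp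
    have "emeasure M (?S v) = emeasure M ((\<lambda>\<omega>. (f \<omega>, g \<omega>)) -` C \<inter> space M)"
    proof (rule emeasure_eq_AE[OF _ meas[OF v] measurable_sets[OF fg C]])
      show "AE \<omega> in M. \<omega> \<in> (?S v) \<longleftrightarrow> \<omega> \<in> (\<lambda>\<omega>. (f \<omega>, g \<omega>)) -` C \<inter> space M"
        using AE
      proof (rule AE_mp, intro AE_I2 impI)
        fix \<omega> assume \<omega>: "\<omega> \<in> space M" and eq: "\<forall>i\<in>{..<n}. state (v i) \<omega> = \<Psi> (s i) (f \<omega>) (g \<omega>)"
        have "(f \<omega>, g \<omega>) \<in> space (PQ \<Otimes>\<^sub>M PU)" using measurable_space[OF fg \<omega>] .
        then show "\<omega> \<in> (?S v) \<longleftrightarrow> \<omega> \<in> (\<lambda>\<omega>. (f \<omega>, g \<omega>)) -` C \<inter> space M"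
          using \<omega> eq by (simp add: C_def)
      qed
    qed simp
    then show ?thesis unfolding emeasure_distr[OF fg C] .
  qed
  have "AE \<omega> in M. \<forall>i\<in>{..<n}. state (s i) \<omega> = \<Psi> (s i) (state 0 \<omega>) (XU \<omega>)"
  proof (rule AE_finite_allI)
    fix i assume "i \<in> {..<n}"
    then have "0 \<le> s i" using s by simp
    from state_solution[OF order_refl this]
    show "AE \<omega> in M. state (s i) \<omega> = \<Psi> (s i) (state 0 \<omega>) (XU \<omega>)"
    proof (rule AE_mp, intro AE_I2 impI)
      fix \<omega> assume \<omega>: "\<omega> \<in> space M" and "state (0 + s i) \<omega> = \<Psi> (s i) (state 0 \<omega>) (\<lambda>u\<in>{0..}. X (0 + u) \<omega> - X 0 \<omega>)"
      then show "state (s i) \<omega> = \<Psi> (s i) (state 0 \<omega>) (XU \<omega>)" by (simp add: X_0[OF \<omega>] XU_def)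
    qed
  qed simp
  from ev[OF st0 XU s this]
  have 1: "emeasure M (?S s) = emeasure (distr M (PQ \<Otimes>\<^sub>M PU) (\<lambda>\<omega>. (state 0 \<omega>, XU \<omega>))) C"
    by simp
  have "AE \<omega> in M. state (0 + \<tau>) \<omega> = \<Psi> \<tau> (state 0 \<omega>) (\<lambda>u\<in>{0..}. X (0 + u) \<omega> - X 0 \<omega>)"
    using tau_pos by (intro state_solution) auto
  \<comment> \<open>\<open>restart\<close> knows the state at \<tau> only in the form of \<Psi>
    applied to the initial state and the path up to \<tau>.\<close>
  then have "AE \<omega> in M. state \<tau> \<omega> = \<Psi> \<tau> (state 0 \<omega>) (XT \<omega>)"
  proof (rule AE_mp, intro AE_I2 impI)
    fix \<omega> assume \<omega>: "\<omega> \<in> space M" and "state (0 + \<tau>) \<omega> = \<Psi> \<tau> (state 0 \<omega>) (\<lambda>u\<in>{0..}. X (0 + u) \<omega> - X 0 \<omega>)"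
    moreover have "\<Psi> \<tau> (state 0 \<omega>) (\<lambda>u\<in>{0..}. X (0 + u) \<omega> - X 0 \<omega>) = \<Psi> \<tau> (state 0 \<omega>) (XT \<omega>)"
      using tau_pos X_0[OF \<omega>] by (intro solution_map_cong) (auto simp: XT_def)
    ultimately show "state \<tau> \<omega> = \<Psi> \<tau> (state 0 \<omega>) (XT \<omega>)" by simp
  qed
  moreover have "AE \<omega> in M. \<forall>i\<in>{..<n}. state (\<tau> + s i) \<omega> = \<Psi> (s i) (state \<tau> \<omega>) (XS \<omega>)"
    unfolding XS_def using tau_pos s by (intro AE_finite_allI state_solution) auto
  ultimately have "AE \<omega> in M. \<forall>i\<in>{..<n}. state (\<tau> + s i) \<omega> = \<Psi> (s i) (\<Psi> \<tau> (state 0 \<omega>) (XT \<omega>)) (XS \<omega>)"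
    by eventually_elim simp
  from ev[OF W' XS _ this] have 2: "emeasure M {\<omega>\<in>space M. \<forall>i\<in>{..<n}. state (\<tau> + s i) \<omega> \<in> E i}
      = emeasure (distr M (PQ \<Otimes>\<^sub>M PU) (\<lambda>\<omega>. (\<Psi> \<tau> (state 0 \<omega>) (XT \<omega>), XS \<omega>))) C"
    using tau_pos s by simp
  show ?thesis
    using 1 2 law by (simp add: measure_def Ball_def add.commute)
qed

lemma state_periodic:
  fixes n :: nat and s :: "nat \<Rightarrow> real"
  assumes s: "\<And>i. i < n \<Longrightarrow> 0 \<le> s i" and E: "\<And>i. i < n \<Longrightarrow> E i \<in> sets PQ"
  shows "prob {\<omega>\<in>space M. \<forall>i<n. state (s i + real k * \<tau>) \<omega> \<in> E i} = prob {\<omega>\<in>space M. \<forall>i<n. state (s i) \<omega> \<in> E i}"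
proof (induction k)
  case 0
  then show ?case by simp
next
  case (Suc k)
  have "prob {\<omega>\<in>space M. \<forall>i<n. state (s i + real k * \<tau> + \<tau>) \<omega> \<in> E i} = prob {\<omega>\<in>space M. \<forall>i<n. state (s i + real k * \<tau>) \<omega> \<in> E i}"
    using s tau_pos by (intro state_shift E) auto
  then show ?case using Suc.IH by (simp add: algebra_simps)
qed

section \<open>The volatility\<close>

lemma V_AE:
  assumes s: "0 \<le> s"
  shows "AE \<omega> in M. Vproc q \<alpha>0 \<alpha> Y s \<omega> = \<alpha>0 + (\<Sum>k<q. \<alpha> (Suc k) * state s \<omega> k)"
proof (cases "s = 0")
  case True
  then show ?thesis by (simp add: Vproc_def state_def)
next
  case False
  then have s: "0 < s" using s by simp
  show ?thesis
    using no_jump_at[OF s]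
  proof (rule AE_mp, intro AE_I2 impI)
    fix \<omega> assume \<omega>: "\<omega> \<in> space M" and "\<exists>v. 0 \<le> v \<and> v < s \<and> N v \<omega> = N s \<omega>"
    then obtain v where v: "0 \<le> v" "v < s" "N v \<omega> = N s \<omega>" by blast
    interpret cogarch_path "\<lambda>u. N u \<omega>" q "Bmat q \<beta>" \<alpha>0 \<alpha> "\<lambda>n. mark tp l Z N n \<omega>" "\<lambda>u. Y u \<omega>"
      by (rule Y_path[OF \<omega>])
    have "leftlim (\<lambda>u. Y u \<omega> k) s = Y s \<omega> k" if "k < q" for k
      using no_jump(2)[OF v(1) less_imp_le[OF v(2)] v(3) that v(2)] .
    then show "Vproc q \<alpha>0 \<alpha> Y s \<omega> = \<alpha>0 + (\<Sum>k<q. \<alpha> (Suc k) * state s \<omega> k)"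
      using s by (simp add: Vproc_def state_def)
  qed
qed

lemma Y_rv: "0 \<le> u \<Longrightarrow> k < q \<Longrightarrow> (\<lambda>\<omega>. Y u \<omega> k) \<in> borel_measurable M"
  using measurable_compose[OF state_rv[of u] measurable_component_singleton[of k "{..<q}"]]
  by (simp add: state_def)

text \<open>M need not be complete, so the almost sure identity \<open>V_AE\<close> does not give
  measurability; the left limit is obtained as a limit along a fixed sequence of times.\<close>

lemma V_rv:
  assumes s: "0 \<le> s"
  shows "Vproc q \<alpha>0 \<alpha> Y s \<in> borel_measurable M"
proof (cases "s = 0")
  case True
  then have "Vproc q \<alpha>0 \<alpha> Y s = (\<lambda>\<omega>. \<alpha>0 + (\<Sum>k<q. \<alpha> (Suc k) * Y 0 \<omega> k))"
    by (simp add: Vproc_def fun_eq_iff)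
  then show ?thesis
    by (simp only:) (intro borel_measurable_add borel_measurable_sum borel_measurable_times borel_measurable_const Y_rv, auto)
next
  case False
  then have s: "0 < s" using s by simp
  have "(\<lambda>\<omega>. leftlim (\<lambda>v. Y v \<omega> k) s) \<in> borel_measurable M" if k: "k < q" for k
  proof (rule borel_measurable_LIMSEQ_real)
    let ?v = "\<lambda>m. s - s / real (Suc m)"
    note v = left_sequence[OF s]
    show "(\<lambda>\<omega>. Y (?v m) \<omega> k) \<in> borel_measurable M" for m using Y_rv[OF v(1) k] .
    have lim: "filterlim ?v (at_left s) sequentially"
      unfolding filterlim_at using v(2,3) less_imp_neq[OF v(2)] by (intro conjI always_eventually allI) auto
    fix \<omega> assume \<omega>: "\<omega> \<in> space M"
    interpret cogarch_path "\<lambda>u. N u \<omega>" q "Bmat q \<beta>" \<alpha>0 \<alpha> "\<lambda>n. mark tp l Z N n \<omega>" "\<lambda>u. Y u \<omega>"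
      by (rule Y_path[OF \<omega>])
    show "(\<lambda>m. Y (?v m) \<omega> k) \<longlonglongrightarrow> leftlim (\<lambda>v. Y v \<omega> k) s"
      using filterlim_compose[OF cadlag_tendsto_leftlim[OF cadlag[OF k] s] lim] .
  qed
  moreover have "Vproc q \<alpha>0 \<alpha> Y s = (\<lambda>\<omega>. \<alpha>0 + (\<Sum>k<q. \<alpha> (Suc k) * leftlim (\<lambda>v. Y v \<omega> k) s))"
    using s by (simp add: Vproc_def fun_eq_iff)
  ultimately show ?thesis
    by (simp only:) (intro borel_measurable_add borel_measurable_sum borel_measurable_times borel_measurable_const, auto)
qed

lemma V_preimage:
  assumes "J \<in> sets borel"
  shows "{y\<in>space PQ. \<alpha>0 + (\<Sum>k<q. \<alpha> (Suc k) * y k) \<in> J} \<in> sets PQ"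
proof -
  have "(\<lambda>y. \<alpha>0 + (\<Sum>k<q. \<alpha> (Suc k) * y k)) \<in> borel_measurable PQ"
    by (intro borel_measurable_add borel_measurable_sum borel_measurable_times borel_measurable_const
        measurable_component_singleton) auto
  from measurable_sets[OF this assms] show ?thesis
    by (simp add: vimage_def Int_def conj_commute)
qed

lemma V_state_prob:
  fixes n :: nat and s :: "nat \<Rightarrow> real"
  assumes s: "\<And>i. i < n \<Longrightarrow> 0 \<le> s i" and J: "\<And>i. i < n \<Longrightarrow> J i \<in> sets borel"
  shows "prob {\<omega>\<in>space M. \<forall>i<n. Vproc q \<alpha>0 \<alpha> Y (s i) \<omega> \<in> J i}
     = prob {\<omega>\<in>space M. \<forall>i<n. state (s i) \<omega> \<in> {y\<in>space PQ. \<alpha>0 + (\<Sum>k<q. \<alpha> (Suc k) * y k) \<in> J i}}"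
proof (rule measure_eq_AE)
  let ?H = "\<lambda>i. {y\<in>space PQ. \<alpha>0 + (\<Sum>k<q. \<alpha> (Suc k) * y k) \<in> J i}"
  let ?V = "{\<omega>\<in>space M. \<forall>i<n. Vproc q \<alpha>0 \<alpha> Y (s i) \<omega> \<in> J i}"
  let ?St = "{\<omega>\<in>space M. \<forall>i<n. state (s i) \<omega> \<in> (?H i)}"
  have "{\<omega>\<in>space M. \<forall>i\<in>{..<n}. Vproc q \<alpha>0 \<alpha> Y (s i) \<omega> \<in> J i} \<in> sets M"
    using s J by (intro sets.sets_Collect_finite_All) (auto intro!: measurable_sets_Collect[OF V_rv])
  then show "?V \<in> sets M"
    by (simp only: Ball_def lessThan_iff)
  have "{\<omega>\<in>space M. \<forall>i\<in>{..<n}. state (s i) \<omega> \<in> (?H i)} \<in> sets M"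
  proof (intro sets.sets_Collect_finite_All)
    fix i assume "i \<in> {..<n}"
    then have i: "i < n" by simp
    from measurable_sets[OF state_rv[OF s[OF i]] V_preimage[OF J[OF i]]]
    show "{\<omega>\<in>space M. state (s i) \<omega> \<in> (?H i)} \<in> sets M"
      by (simp only: vimage_Int_space)
  qed simp
  then show "?St \<in> sets M"
    by (simp only: Ball_def lessThan_iff)
  have "AE \<omega> in M. \<forall>i\<in>{..<n}. Vproc q \<alpha>0 \<alpha> Y (s i) \<omega> = \<alpha>0 + (\<Sum>k<q. \<alpha> (Suc k) * state (s i) \<omega> k)"
    using s by (intro AE_finite_allI V_AE) auto
  then show "AE \<omega> in M. \<omega> \<in> ?V \<longleftrightarrow>
    \<omega> \<in> ?St"
  proof (rule AE_mp, intro AE_I2 impI)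
    fix \<omega> assume \<omega>: "\<omega> \<in> space M"
      and eq: "\<forall>i\<in>{..<n}. Vproc q \<alpha>0 \<alpha> Y (s i) \<omega> = \<alpha>0 + (\<Sum>k<q. \<alpha> (Suc k) * state (s i) \<omega> k)"
    have "state (s i) \<omega> \<in> space PQ" if "i < n" for i using measurable_space[OF state_rv[OF s[OF that]] \<omega>] .
    then show "\<omega> \<in> ?V \<longleftrightarrow>
      \<omega> \<in> ?St"
      using \<omega> eq by simp
  qed
qed

lemma V_periodic:
  fixes n :: nat and s :: "nat \<Rightarrow> real"
  assumes s: "\<And>i. i < n \<Longrightarrow> 0 \<le> s i" and J: "\<And>i. i < n \<Longrightarrow> J i \<in> sets borel"
  shows "prob {\<omega>\<in>space M. \<forall>i<n. Vproc q \<alpha>0 \<alpha> Y (s i + real k * \<tau>) \<omega> \<in> J i}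
    = prob {\<omega>\<in>space M. \<forall>i<n. Vproc q \<alpha>0 \<alpha> Y (s i) \<omega> \<in> J i}"
proof -
  have s': "0 \<le> s i + real k * \<tau>" if "i < n" for i using s[OF that] tau_pos by simp
  show ?thesis
    using V_state_prob[OF s J] V_state_prob[OF s' J] state_periodic[where k=k, OF s V_preimage[OF J]]
    by (simp only:)
qed

end

theorem theorem3p1:
  fixes M :: "'a measure"
    and \<tau> :: real and l :: nat and tp :: "nat \<Rightarrow> real"
    and lam :: "real \<Rightarrow> real"
    and N :: "real \<Rightarrow> 'a \<Rightarrow> nat"
    and F :: "nat \<Rightarrow> real measure"
    and Z :: "nat \<Rightarrow> nat \<Rightarrow> 'a \<Rightarrow> real"
    and D :: "real \<Rightarrow> real"
    and q p :: nat and \<alpha>0 :: real and \<alpha> \<beta> :: "nat \<Rightarrow> real"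
    and Y :: "real \<Rightarrow> 'a \<Rightarrow> nat \<Rightarrow> real"
    and P Pinv :: "complex mat" and r :: ereal
  assumes M: "prob_space M"
    \<comment> \<open>partition and period\<close>
    and tau_pos: "\<tau> > 0" and l_pos: "l \<ge> 1"
    and tp0: "tp 0 = 0" and tp_mono: "strict_mono tp" and tp_lim: "filterlim tp at_top sequentially"
    and tp_per: "\<forall>j\<ge>1. tp (j + l) - tp (j + l - 1) = tp j - tp (j - 1)"
    and tau_def: "\<tau> = (\<Sum>j = 1..l. tp j - tp (j - 1))"
    \<comment> \<open>intensity\<close>
    and lam_nonneg: "\<forall>s\<ge>0. 0 \<le> lam s"
    and lam_locint: "\<forall>a b. 0 \<le> a \<longrightarrow> set_integrable lborel {a..b} lam"
    and lam_per: "\<forall>s\<ge>0. lam (s + \<tau>) = lam s"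
    \<comment> \<open>Poisson process N with independent increments and counting paths\<close>
    and N_meas: "\<forall>u\<ge>0. N u \<in> measurable M (count_space UNIV)"
    and N_paths: "\<forall>\<omega>\<in>space M. N 0 \<omega> = 0 \<and> mono_on {0..} (\<lambda>u. N u \<omega>)
                    \<and> (\<forall>u\<ge>0. \<exists>e>0. \<forall>v\<in>{u..u+e}. N v \<omega> = N u \<omega>)"
    and N_poisson: "\<forall>s u k. 0 \<le> s \<and> s < u \<longrightarrow>
         measure M {\<omega>\<in>space M. N u \<omega> - N s \<omega> = k}
           = (Lam lam u - Lam lam s) ^ k / fact k * exp (- (Lam lam u - Lam lam s))"
    and N_indep_incr: "\<forall>m (u :: nat \<Rightarrow> real). 0 \<le> u 0 \<and> mono u \<longrightarrow>
         prob_space.indep_vars M (\<lambda>_. count_space UNIV) (\<lambda>i \<omega>. N (u (Suc i)) \<omega> - N (u i) \<omega>) {..<m}"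
    \<comment> \<open>jump distributions and marks\<close>
    and F_prob: "\<forall>j\<in>{1..l}. prob_space (F j) \<and> sets (F j) = sets borel \<and> integrable (F j) (\<lambda>z. z\<^sup>2)"
    and Z_distr: "\<forall>n\<ge>1. \<forall>j\<in>{1..l}. distr M borel (Z n j) = F j"
    and Z_indep: "prob_space.indep_vars M (\<lambda>_. borel) (\<lambda>(n, j). Z n j) ({1..} \<times> {1..l})"
    and ZN_indep: "prob_space.indep_set M
         (sets (vimage_algebra (space M) (\<lambda>\<omega>. \<lambda>nj\<in>{1..} \<times> {1..l}. Z (fst nj) (snd nj) \<omega>)
                 (PiM ({1..} \<times> {1..l}) (\<lambda>_. borel))))
         (sets (vimage_algebra (space M) (\<lambda>\<omega>. \<lambda>u\<in>{0..}. N u \<omega>) (PiM {0..} (\<lambda>_. count_space UNIV))))"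
    \<comment> \<open>drift\<close>
    and D_cont: "continuous_on {0..} D" and D_per: "\<forall>s\<ge>0. D (s + \<tau>) = D s"
    and D_fv: "loc_bounded_variation D" and D0: "D 0 = 0"
    \<comment> \<open>COGARCH parameters\<close>
    and pq: "1 \<le> p" "p \<le> q" and alpha0: "\<alpha>0 > 0"
    and alpha_p: "\<alpha> p \<noteq> 0" and beta_q: "\<beta> q \<noteq> 0"
    and alpha_zero: "\<forall>k. p < k \<and> k \<le> q \<longrightarrow> \<alpha> k = 0"
    \<comment> \<open>state process: Y_0 measurable, independent of S; cadlag solution of the SDE\<close>
    and Y_meas: "\<forall>u\<ge>0. (\<lambda>\<omega>. \<lambda>i\<in>{..<q}. Y u \<omega> i) \<in> measurable M (PiM {..<q} (\<lambda>_. borel))"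
    and Y0_indep: "prob_space.indep_set M
         (sets (vimage_algebra (space M) (\<lambda>\<omega>. \<lambda>i\<in>{..<q}. Y 0 \<omega> i) (PiM {..<q} (\<lambda>_. borel))))
         (sets (vimage_algebra (space M) (\<lambda>\<omega>. \<lambda>u\<in>{0..}. Sproc D tp l Z N u \<omega>) (PiM {0..} (\<lambda>_. borel))))"
    and Y_cadlag: "\<forall>\<omega>\<in>space M. \<forall>i<q. \<forall>u\<ge>0.
         ((\<lambda>v. Y v \<omega> i) \<longlongrightarrow> Y u \<omega> i) (at_right u)
         \<and> (0 < u \<longrightarrow> (\<exists>L. ((\<lambda>v. Y v \<omega> i) \<longlongrightarrow> L) (at_left u)))"
    and Y_sde: "\<forall>\<omega>\<in>space M. \<forall>u\<ge>0. \<forall>i<q.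
         Y u \<omega> i = Y 0 \<omega> i
           + (LINT v:{0..u}|lborel. (\<Sum>k<q. Bmat q \<beta> $$ (i, k) * leftlim (\<lambda>w. Y w \<omega> k) v))
           + (\<Sum>n = 1..N u \<omega>. evec q $ i
                 * (\<alpha>0 + (\<Sum>k<q. avec q \<alpha> $ k * leftlim (\<lambda>w. Y w \<omega> k) (arrival N n \<omega>)))
                 * (mark tp l Z N n \<omega>)\<^sup>2)"
    \<comment> \<open>hypotheses of Theorem 3.1(b)\<close>
    and B_inv: "invertible_mat (Bmat q \<beta>)"
    and P_carrier: "P \<in> carrier_mat q q" "Pinv \<in> carrier_mat q q"
    and P_inv: "P * Pinv = 1\<^sub>m q" "Pinv * P = 1\<^sub>m q"
    and P_diag: "diagonal_mat (Pinv * map_mat complex_of_real (Bmat q \<beta>) * P)"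
    and eig_neg: "\<forall>ev. eigenvalue (map_mat complex_of_real (Bmat q \<beta>)) ev \<longrightarrow> Re ev < 0"
    and r_ge: "1 \<le> r"
    and log_moment: "\<forall>t\<in>{0..<\<tau>}.
         (\<integral>z. ln (1 + opnorm q r (Pinv * map_mat complex_of_real (EAmat q \<alpha>) * P) * z\<^sup>2) \<partial>nu lam F tp l t)
         < - measure (nu lam F tp l t) UNIV
             * Max {Re ev | ev. eigenvalue (map_mat complex_of_real (Bmat q \<beta>)) ev} * \<tau>
             / (Lam lam (t + \<tau>) - Lam lam t)"
    \<comment> \<open>Y_0 has the law of U^(0): its law solves U = J_(0,tau) U + K_(0,tau) with U independent of (J,K)\<close>
    and Y0_U0: "\<forall>E \<in> sets (PiM {..<q} (\<lambda>_. borel)).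
         emeasure (distr M (PiM {..<q} (\<lambda>_. borel)) (\<lambda>\<omega>. \<lambda>i\<in>{..<q}. Y 0 \<omega> i)) E
         = (\<integral>\<^sup>+\<omega>. emeasure (distr M (PiM {..<q} (\<lambda>_. borel)) (\<lambda>\<omega>. \<lambda>i\<in>{..<q}. Y 0 \<omega> i))
               (affmap q (Jst q \<alpha> \<beta> (\<lambda>u. N u \<omega>) (\<lambda>n. arrival N n \<omega>) (\<lambda>n. mark tp l Z N n \<omega>) 0 \<tau>)
                         (Kst q \<alpha>0 \<alpha> \<beta> (\<lambda>u. N u \<omega>) (\<lambda>n. arrival N n \<omega>) (\<lambda>n. mark tp l Z N n \<omega>) 0 \<tau>)
                 -` E \<inter> space (PiM {..<q} (\<lambda>_. borel))) \<partial>M)"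
  shows "\<forall>(n :: nat) (s :: nat \<Rightarrow> real) (E :: nat \<Rightarrow> (nat \<Rightarrow> real) set) (J :: nat \<Rightarrow> real set) (k :: nat).
           (\<forall>i<n. 0 \<le> s i \<and> E i \<in> sets (PiM {..<q} (\<lambda>_. borel)) \<and> J i \<in> sets borel) \<longrightarrow>
             measure M {\<omega>\<in>space M. \<forall>i<n. (\<lambda>j\<in>{..<q}. Y (s i) \<omega> j) \<in> E i}
               = measure M {\<omega>\<in>space M. \<forall>i<n. (\<lambda>j\<in>{..<q}. Y (s i + real k * \<tau>) \<omega> j) \<in> E i}
           \<and> measure M {\<omega>\<in>space M. \<forall>i<n. Vproc q \<alpha>0 \<alpha> Y (s i) \<omega> \<in> J i}
               = measure M {\<omega>\<in>space M. \<forall>i<n. Vproc q \<alpha>0 \<alpha> Y (s i + real k * \<tau>) \<omega> \<in> J i}"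
proof -
  interpret prob_space M by (rule M)
  let ?PQ = "PiM {..<q} (\<lambda>_. borel :: real measure)" and ?PU = "PiM {0::real..} (\<lambda>_. borel :: real measure)"
  have indS: "indep_rv ?PQ (\<lambda>\<omega>. \<lambda>i\<in>{..<q}. Y 0 \<omega> i) ?PU (\<lambda>\<omega>. \<lambda>u\<in>{0..}. Sproc D tp l Z N u \<omega>)"
    by (rule indep_rv_vimage[OF _ _ Y0_indep]) (auto simp: space_PiM)
  interpret poisson: marked_poisson M \<tau> l tp lam N F Z
    by (unfold_locales; fact)
  interpret process: marked_process M \<tau> l tp lam N F Z
  proof (unfold_locales, intro allI impI)
    fix u :: real assume u: "0 \<le> u"
    have "Sproc D tp l Z N u \<in> borel_measurable M"
      using measurable_compose[OF indep_rvD(2)[OF indS] measurable_component_singleton[of u "{0..}"]] u by simp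
    then have "(\<lambda>\<omega>. Sproc D tp l Z N u \<omega> - D u) \<in> borel_measurable M" by simp
    then show "(\<lambda>\<omega>. \<Sum>n = 1..N u \<omega>. mark tp l Z N n \<omega>) \<in> borel_measurable M"
      by (simp add: Sproc_def)
  qed
  have X: "process.X u \<omega> = Sproc D tp l Z N u \<omega> - D u" for u \<omega>
    by (simp add: process.X_def Sproc_def)
  \<comment> \<open>Subtracting the deterministic drift is a measurable map on path space; it
    carries the independence of the initial state from S over to X.\<close>
  have "(\<lambda>x. \<lambda>u\<in>{0..}. x u - D u) \<in> measurable ?PU ?PU"
    by (intro measurable_restrict borel_measurable_diff measurable_component_singleton) auto
  from indep_rv_compose[OF indS measurable_ident this]
  have indX: "indep_rv ?PQ (\<lambda>\<omega>. \<lambda>i\<in>{..<q}. Y 0 \<omega> i) ?PU (\<lambda>\<omega>. \<lambda>u\<in>{0..}. process.X u \<omega>)"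
    by (simp add: X[abs_def] restrict_def if_distrib cong: if_cong)
  interpret cogarch M \<tau> l tp lam N F Z q \<alpha>0 \<alpha> \<beta> Y
  proof (intro cogarch.intro cogarch_axioms.intro process.marked_process_axioms)
    show "(\<lambda>\<omega>. \<lambda>i\<in>{..<q}. Y u \<omega> i) \<in> measurable M ?PQ" if "0 \<le> u" for u
      using Y_meas that by blast
    show "indep_rv ?PQ (\<lambda>\<omega>. \<lambda>i\<in>{..<q}. Y 0 \<omega> i) ?PU (\<lambda>\<omega>. \<lambda>u\<in>{0..}. process.X u \<omega>)"
      by (rule indX)
    show "cogarch_path (\<lambda>u. N u \<omega>) q (Bmat q \<beta>) \<alpha>0 \<alpha> (\<lambda>n. mark tp l Z N n \<omega>) (\<lambda>u. Y u \<omega>)"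
      if \<omega>: "\<omega> \<in> space M" for \<omega>
    proof (intro cogarch_path.intro cogarch_path_axioms.intro process.counting_path[OF \<omega>] carrier_Bmat)
      show "cadlag (\<lambda>u. Y u \<omega> i)" if "i < q" for i
        using Y_cadlag \<omega> that unfolding cadlag_def by blast
      show "Y u \<omega> i = Y 0 \<omega> i
           + (LINT v:{0..u}|lborel. (\<Sum>k<q. Bmat q \<beta> $$ (i, k) * leftlim (\<lambda>w. Y w \<omega> k) v))
           + (\<Sum>j = 1..N u \<omega>. evec q $ i
                 * (\<alpha>0 + (\<Sum>k<q. avec q \<alpha> $ k * leftlim (\<lambda>w. Y w \<omega> k) (counting_path.arr (\<lambda>u. N u \<omega>) j)))
                 * (mark tp l Z N j \<omega>)\<^sup>2)" if "0 \<le> u" "i < q" for u i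
        unfolding process.arr_eq_arrival[OF \<omega>] using Y_sde \<omega> that by blast
    qed
  qed (rule Y0_U0[rule_format])
  show ?thesis
  proof (intro allI impI conjI)
    fix n :: nat and s :: "nat \<Rightarrow> real" and E :: "nat \<Rightarrow> (nat \<Rightarrow> real) set" and J :: "nat \<Rightarrow> real set" and k :: nat
    assume A: "\<forall>i<n. 0 \<le> s i \<and> E i \<in> sets (PiM {..<q} (\<lambda>_. borel)) \<and> J i \<in> sets borel"
    show "measure M {\<omega>\<in>space M. \<forall>i<n. (\<lambda>j\<in>{..<q}. Y (s i) \<omega> j) \<in> E i}
        = measure M {\<omega>\<in>space M. \<forall>i<n. (\<lambda>j\<in>{..<q}. Y (s i + real k * \<tau>) \<omega> j) \<in> E i}"
      using state_periodic[of n s E k] A by (simp add: state_def)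
    show "measure M {\<omega>\<in>space M. \<forall>i<n. Vproc q \<alpha>0 \<alpha> Y (s i) \<omega> \<in> J i}
        = measure M {\<omega>\<in>space M. \<forall>i<n. Vproc q \<alpha>0 \<alpha> Y (s i + real k * \<tau>) \<omega> \<in> J i}"
      using V_periodic[of n s J k] A by simp
  qed
qed

end
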